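(* Let $(\mathcal C,\mathbb E,\mathfrak s)$ be an extriangulated category satisfying (WIC), with a proper class $\xi$ of $\mathbb E$-triangles having enough $\xi$-projectives and enough $\xi$-injectives, and let $\mathcal X$ be a quasi-resolving subcategory of $\mathcal C$. Then the subcategory $\mathcal{GQP}_{\mathcal X}(\xi)$ of $\mathcal{GQ}_{\mathcal X}(\xi)$-projective objects is a quasi-resolving subcategory of $\mathcal C$.
   Context: Extriangulated category (Nakaoka--Palu): an additive category $\mathcal C$, a biadditive functor $\mathbb E:\mathcal C^{\mathrm{op}}\times\mathcal C\to\mathbf{Ab}$, and $\mathfrak s$, as follows. For $\delta\in\mathbb E(C,A)$, $a:A\to A'$, $c:C'\to C$ put $a_*\delta=\mathbb E(C,a)(\delta)$ and $c^*\delta=\mathbb E(c,A)(\delta)$. Sequences $A\to B\to C$ and $A\to B'\to C$ are equivalent if some isomorphism $B\to B'$ commutes with the maps from $A$ and to $C$. $\mathfrak s$ assigns to each $\delta\in\mathbb E(C,A)$ an equivalence class of sequences $A\xrightarrow{x}B\xrightarrow{y}C$; a representative is written $A\xrightarrow{x}B\xrightarrow{y}C\overset{\delta}{\dashrightarrow}$ and called an $\mathbb E$-triangle ($x$ is an inflation, $y$ a deflation; $\delta$ is often omitted). Axioms, for $\mathbb E$-triangles $A\xrightarrow{x}B\xrightarrow{y}C\overset{\delta}{\dashrightarrow}$ and $A'\xrightarrow{x'}B'\xrightarrow{y'}C'\overset{\delta'}{\dashrightarrow}$: (i) if $a:A\to A'$, $c:C\to C'$ satisfy $a_*\delta=c^*\delta'$,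 there is $b:B\to B'$ with $bx=x'a$, $y'b=cy$; (ii) $\mathfrak s(0)=[A\to A\oplus C\to C]$ and $\mathfrak s(\delta\oplus\delta')=\mathfrak s(\delta)\oplus\mathfrak s(\delta')$; (iii) if $a:A\to A'$, $b:B\to B'$ satisfy $bx=x'a$, there is $c:C\to C'$ with $y'b=cy$ and $a_*\delta=c^*\delta'$, and dually; (iv) given $\mathbb E$-triangles $A\xrightarrow{f}B\xrightarrow{f'}D\overset{\delta}{\dashrightarrow}$ and $B\xrightarrow{g}C\xrightarrow{g'}F\overset{\delta'}{\dashrightarrow}$, there are $\mathbb E$-triangles $A\xrightarrow{gf}C\xrightarrow{h'}E\overset{\delta''}{\dashrightarrow}$ and $D\xrightarrow{d}E\xrightarrow{e}F\overset{f'_*\delta'}{\dashrightarrow}$ with $h'g=df'$, $eh'=g'$, $d^*\delta''=\delta$, $f_*\delta''=e^*\delta'$, and dually. (WIC): if $gf$ is an inflation so is $f$; if $gf$ is a deflation so is $g$. Proper class: a class $\xi$ of $\mathbb E$-triangles, closed under isomorphisms and finite coproducts, containing all split $\mathbb E$-triangles ($\delta=0$), closed under base change (replacing $\delta$ by $c^*\delta$) and cobase change (replacing $\delta$ by $a_*\delta$), and saturated: given $\mathbb E$-triangles $A_1\to B_1\to C\overset{\delta_1}{\dashrightarrow}$ and $A_2\to B_2\xrightarrow{y_2}C\overset{\delta_2}{\dashrightarrow}$, if the second one and the $\mathbb E$-triangle $A_1\to M\to B_2\overset{y_2^*\delta_1}{\dashrightarrow}$ lie in $\xi$, so does the first. $P$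 is $\xi$-projective if $0\to\mathcal C(P,A)\to\mathcal C(P,B)\to\mathcal C(P,C)\to0$ is exact for every $\mathbb E$-triangle $A\to B\to C\dashrightarrow$ in $\xi$; $\xi$-injectives are defined dually; $\mathcal P(\xi)$ is the class of $\xi$-projectives. Enough $\xi$-projectives (injectives): every $A$ has an $\mathbb E$-triangle $K\to P\to A\dashrightarrow$ (resp. $A\to I\to K\dashrightarrow$) in $\xi$ with $P$ $\xi$-projective (resp. $I$ $\xi$-injective). A complex $\cdots\to X_{n+1}\to X_n\xrightarrow{d_n}X_{n-1}\to\cdots$ is $\xi$-exact if there are $\mathbb E$-triangles $K_{n+1}\xrightarrow{g_n}X_n\xrightarrow{f_n}K_n\dashrightarrow$ in $\xi$ (its $\xi$-resolution $\mathbb E$-triangles) with $d_n=g_{n-1}f_n$ for all $n$; for one-sided complexes $\cdots\to X_1\to X_0\to M\to0$ one requires $K_0=M$. All subcategories are full and additive. An $\mathcal X$-resolution of $M$ is a $\xi$-exact complex $\cdots\to X_1\to X_0\to M\to0$ with all $X_i\in\mathcal X$; $\mathrm{res}(\mathcal X)$ is the class of objects having one. $\mathcal P_{\mathcal X}(\xi)=\mathcal X\cap\mathcal P(\xi)$. $\mathcal X$ is quasi-resolving if for every $\mathbb E$-triangle $A\to B\to C\dashrightarrow$ in $\xi$: $A,C\in\mathcal X$ implies $B\in\mathcal X$ (closed under $\xi$-extensions) and $B,C\in\mathcal X$ implies $A\in\mathcal X$ (closed under $\xi$-cocones); and $\mathcal X\subseteq\mathrm{res}(\mathcal P_{\mathcal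 X}(\xi))$. An $\mathbb E$-triangle $A\to B\to C\dashrightarrow$ in $\xi$ is $\mathcal C(-,\mathcal X)$-exact if $0\to\mathcal C(C,X)\to\mathcal C(B,X)\to\mathcal C(A,X)\to0$ is exact for all $X\in\mathcal X$. A complex is $\mathcal C(-,\mathcal X)$-exact if it is $\xi$-exact with $\mathcal C(-,\mathcal X)$-exact $\xi$-resolution $\mathbb E$-triangles. A complete $\mathcal P_{\mathcal X}(\xi)$-resolution is a $\mathcal C(-,\mathcal X)$-exact complex $\cdots\to P_1\to P_0\to P_{-1}\to\cdots$ with all $P_n\in\mathcal P_{\mathcal X}(\xi)$; the objects $K_n$ in its ($\mathcal C(-,\mathcal X)$-exact) $\xi$-resolution $\mathbb E$-triangles $K_{n+1}\to P_n\to K_n\dashrightarrow$ are called $\mathcal{GQ}_{\mathcal X}(\xi)$-projective, and $\mathcal{GQP}_{\mathcal X}(\xi)$ is the subcategory of all of them. *)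

theory Defs
  imports "HOL-Algebra.Exact_Sequence"
begin

section \<open>Additive categories\<close>

text \<open>
  Hom-groups are abelian groups in the sense of HOL-Algebra, hence written multiplicatively: the sum
  of two parallel morphisms is \<open>f \<otimes>\<^bsub>Hom \<C> A B\<^esub> g\<close> and the zero morphism is \<open>\<one>\<^bsub>Hom \<C> A B\<^esub>\<close>.
  Composition is in the usual order, \<open>g \<cdot> f\<close> meaning \<open>f\<close> first. As composition is not indexed by objects,
  distinct Hom-sets are required to be disjoint.
\<close>

record ('o, 'm) cat_data =
  Obj :: "'o set"
  Hom :: "'o \<Rightarrow> 'o \<Rightarrow> 'm monoid"
  Comp :: "'m \<Rightarrow> 'm \<Rightarrow> 'm"  (infixl \<open>\<cdot>\<index>\<close> 70)
  Ident :: "'o \<Rightarrow> 'm"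

abbreviation mor :: "('o, 'm, 'z) cat_data_scheme \<Rightarrow> 'o \<Rightarrow> 'o \<Rightarrow> 'm set" where
  "mor \<C> A B \<equiv> carrier (Hom \<C> A B)"

definition zero_object :: "('o, 'm, 'z) cat_data_scheme \<Rightarrow> 'o \<Rightarrow> bool" where
  "zero_object \<C> Z \<longleftrightarrow> Z \<in> Obj \<C> \<and>
     (\<forall>A \<in> Obj \<C>. mor \<C> A Z = {\<one>\<^bsub>Hom \<C> A Z\<^esub>} \<and> mor \<C> Z A = {\<one>\<^bsub>Hom \<C> Z A\<^esub>})"

text \<open>All biproduct diagrams \<open>(S, i, j, p, q)\<close> of \<open>A\<close> and \<open>B\<close>: injections \<open>i\<close>, \<open>j\<close> and projections \<open>p\<close>, \<open>q\<close>.\<close>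

definition biproducts ::
  "('o, 'm, 'z) cat_data_scheme \<Rightarrow> 'o \<Rightarrow> 'o \<Rightarrow> ('o \<times> 'm \<times> 'm \<times> 'm \<times> 'm) set" where
  "biproducts \<C> A B = {(S, i, j, p, q).
     S \<in> Obj \<C> \<and> i \<in> mor \<C> A S \<and> j \<in> mor \<C> B S \<and> p \<in> mor \<C> S A \<and> q \<in> mor \<C> S B \<and>
     p \<cdot>\<^bsub>\<C>\<^esub> i = Ident \<C> A \<and> q \<cdot>\<^bsub>\<C>\<^esub> j = Ident \<C> B \<and>
     q \<cdot>\<^bsub>\<C>\<^esub> i = \<one>\<^bsub>Hom \<C> A B\<^esub> \<and> p \<cdot>\<^bsub>\<C>\<^esub> j = \<one>\<^bsub>Hom \<C> B A\<^esub> \<and>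
     (i \<cdot>\<^bsub>\<C>\<^esub> p) \<otimes>\<^bsub>Hom \<C> S S\<^esub> (j \<cdot>\<^bsub>\<C>\<^esub> q) = Ident \<C> S}"

definition isomorphisms :: "('o, 'm, 'z) cat_data_scheme \<Rightarrow> 'o \<Rightarrow> 'o \<Rightarrow> 'm set" where
  "isomorphisms \<C> A B = {f \<in> mor \<C> A B.
     \<exists>g \<in> mor \<C> B A. g \<cdot>\<^bsub>\<C>\<^esub> f = Ident \<C> A \<and> f \<cdot>\<^bsub>\<C>\<^esub> g = Ident \<C> B}"

locale additive_category =
  fixes \<C> (structure)
  assumes Hom_disjoint:
      "\<lbrakk>A \<in> Obj \<C>; B \<in> Obj \<C>; A' \<in> Obj \<C>; B' \<in> Obj \<C>; f \<in> mor \<C> A B; f \<in> mor \<C> A' B'\<rbrakk>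
        \<Longrightarrow> A = A' \<and> B = B'"
    and Ident_mor: "A \<in> Obj \<C> \<Longrightarrow> Ident \<C> A \<in> mor \<C> A A"
    and Comp_mor:
      "\<lbrakk>A \<in> Obj \<C>; B \<in> Obj \<C>; C \<in> Obj \<C>; f \<in> mor \<C> A B; g \<in> mor \<C> B C\<rbrakk> \<Longrightarrow> g \<cdot> f \<in> mor \<C> A C"
    and Comp_assoc:
      "\<lbrakk>A \<in> Obj \<C>; B \<in> Obj \<C>; C \<in> Obj \<C>; D \<in> Obj \<C>; f \<in> mor \<C> A B; g \<in> mor \<C> B C; h \<in> mor \<C> C D\<rbrakk>
        \<Longrightarrow> h \<cdot> (g \<cdot> f) = (h \<cdot> g) \<cdot> f"
    and Comp_Ident: "\<lbrakk>A \<in> Obj \<C>; B \<in> Obj \<C>; f \<in> mor \<C> A B\<rbrakk> \<Longrightarrow> f \<cdot> Ident \<C> A = f"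
    and Ident_Comp: "\<lbrakk>A \<in> Obj \<C>; B \<in> Obj \<C>; f \<in> mor \<C> A B\<rbrakk> \<Longrightarrow> Ident \<C> B \<cdot> f = f"
    and Hom_comm_group: "\<lbrakk>A \<in> Obj \<C>; B \<in> Obj \<C>\<rbrakk> \<Longrightarrow> comm_group (Hom \<C> A B)"
    and Comp_hom_left:
      "\<lbrakk>A \<in> Obj \<C>; B \<in> Obj \<C>; C \<in> Obj \<C>; g \<in> mor \<C> B C\<rbrakk>
        \<Longrightarrow> (\<lambda>f. g \<cdot> f) \<in> hom (Hom \<C> A B) (Hom \<C> A C)"
    and Comp_hom_right:
      "\<lbrakk>A \<in> Obj \<C>; B \<in> Obj \<C>; C \<in> Obj \<C>; f \<in> mor \<C> A B\<rbrakk>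
        \<Longrightarrow> (\<lambda>g. g \<cdot> f) \<in> hom (Hom \<C> B C) (Hom \<C> A C)"
    and zero_object_exists: "\<exists>Z. zero_object \<C> Z"
    and biproduct_exists: "\<lbrakk>A \<in> Obj \<C>; B \<in> Obj \<C>\<rbrakk> \<Longrightarrow> biproducts \<C> A B \<noteq> {}"


section \<open>Extriangulated categories\<close>

text \<open>
  \<open>Ext \<C> C A\<close> is the abelian group of extensions of \<open>C\<close> by \<open>A\<close>, and \<open>EMap \<C> c a\<close> is the action of the
  bifunctor on \<open>c : C' \<rightarrow> C\<close> and \<open>a : A \<rightarrow> A'\<close>, a map from \<open>Ext \<C> C A\<close> to \<open>Ext \<C> C' A'\<close>.
  \<open>Rlz \<C> C A \<delta>\<close> is the equivalence class assigned to \<open>\<delta>\<close>; its members \<open>(B, x, y)\<close> are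
  the sequences \<open>A \<rightarrow> B \<rightarrow> C\<close> with maps \<open>x\<close> and \<open>y\<close>.
\<close>

record ('o, 'm, 'e) extri_data = "('o, 'm) cat_data" +
  Ext :: "'o \<Rightarrow> 'o \<Rightarrow> 'e monoid"
  EMap :: "'m \<Rightarrow> 'm \<Rightarrow> 'e \<Rightarrow> 'e"
  Rlz :: "'o \<Rightarrow> 'o \<Rightarrow> 'e \<Rightarrow> ('o \<times> 'm \<times> 'm) set"

text \<open>For \<open>\<delta> \<in> Ext \<C> C A\<close>: \<open>push \<C> C a \<delta>\<close> is \<open>a\<^sub>*\<delta>\<close> and \<open>pull \<C> A c \<delta>\<close> is \<open>c\<^sup>*\<delta>\<close>.\<close>

definition push :: "('o, 'm, 'e, 'z) extri_data_scheme \<Rightarrow> 'o \<Rightarrow> 'm \<Rightarrow> 'e \<Rightarrow> 'e" where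
  "push \<C> C a \<delta> = EMap \<C> (Ident \<C> C) a \<delta>"

definition pull :: "('o, 'm, 'e, 'z) extri_data_scheme \<Rightarrow> 'o \<Rightarrow> 'm \<Rightarrow> 'e \<Rightarrow> 'e" where
  "pull \<C> A c \<delta> = EMap \<C> c (Ident \<C> A) \<delta>"

definition sequences :: "('o, 'm, 'z) cat_data_scheme \<Rightarrow> 'o \<Rightarrow> 'o \<Rightarrow> ('o \<times> 'm \<times> 'm) set" where
  "sequences \<C> A C = {(B, x, y). B \<in> Obj \<C> \<and> x \<in> mor \<C> A B \<and> y \<in> mor \<C> B C}"

definition seq_equiv ::
  "('o, 'm, 'z) cat_data_scheme \<Rightarrow> 'o \<Rightarrow> 'o \<Rightarrow> (('o \<times> 'm \<times> 'm) \<times> ('o \<times> 'm \<times> 'm)) set" where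
  "seq_equiv \<C> A C = {((B, x, y), (B', x', y')).
     (B, x, y) \<in> sequences \<C> A C \<and> (B', x', y') \<in> sequences \<C> A C \<and>
     (\<exists>b \<in> isomorphisms \<C> B B'. b \<cdot>\<^bsub>\<C>\<^esub> x = x' \<and> y' \<cdot>\<^bsub>\<C>\<^esub> b = y)}"

text \<open>The tuple \<open>(A, B, C, x, y, \<delta>)\<close> stands for \<open>A \<rightarrow> B \<rightarrow> C\<close> with maps \<open>x\<close>, \<open>y\<close> and extension \<open>\<delta>\<close>.\<close>

type_synonym ('o, 'm, 'e) triangle = "'o \<times> 'o \<times> 'o \<times> 'm \<times> 'm \<times> 'e"

definition E_triangles ::
  "('o, 'm, 'e, 'z) extri_data_scheme \<Rightarrow> ('o, 'm, 'e) triangle set" where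
  "E_triangles \<C> = {(A, B, C, x, y, \<delta>).
     A \<in> Obj \<C> \<and> C \<in> Obj \<C> \<and> \<delta> \<in> carrier (Ext \<C> C A) \<and> (B, x, y) \<in> Rlz \<C> C A \<delta>}"

text \<open>
  All direct sums of two triangles, one for each choice of biproduct diagrams. The extension
  \<open>\<delta> \<oplus> \<delta>'\<close> is the element corresponding to \<open>(\<delta>, 0, 0, \<delta>')\<close> under the decomposition of
  \<open>Ext \<C> (C \<oplus> C') (A \<oplus> A')\<close> into four summands given by biadditivity.
\<close>

definition triangle_sums ::
  "('o, 'm, 'e, 'z) extri_data_scheme \<Rightarrow> ('o, 'm, 'e) triangle \<Rightarrow> ('o, 'm, 'e) triangle
    \<Rightarrow> ('o, 'm, 'e) triangle set" where
  "triangle_sums \<C> = (\<lambda>(A, B, C, x, y, \<delta>) (A', B', C', x', y', \<delta>').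
     {(SA, SB, SC,
       (iB \<cdot>\<^bsub>\<C>\<^esub> x \<cdot>\<^bsub>\<C>\<^esub> pA) \<otimes>\<^bsub>Hom \<C> SA SB\<^esub> (jB \<cdot>\<^bsub>\<C>\<^esub> x' \<cdot>\<^bsub>\<C>\<^esub> qA),
       (iC \<cdot>\<^bsub>\<C>\<^esub> y \<cdot>\<^bsub>\<C>\<^esub> pB) \<otimes>\<^bsub>Hom \<C> SB SC\<^esub> (jC \<cdot>\<^bsub>\<C>\<^esub> y' \<cdot>\<^bsub>\<C>\<^esub> qB),
       EMap \<C> pC iA \<delta> \<otimes>\<^bsub>Ext \<C> SC SA\<^esub> EMap \<C> qC jA \<delta>')
      | SA iA jA pA qA SB iB jB pB qB SC iC jC pC qC.
        (SA, iA, jA, pA, qA) \<in> biproducts \<C> A A' \<and>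
        (SB, iB, jB, pB, qB) \<in> biproducts \<C> B B' \<and>
        (SC, iC, jC, pC, qC) \<in> biproducts \<C> C C'})"

locale extriangulated_category = additive_category \<C>
  for \<C> :: "('o, 'm, 'e, 'z) extri_data_scheme" (structure) +
  assumes Ext_comm_group: "\<lbrakk>C \<in> Obj \<C>; A \<in> Obj \<C>\<rbrakk> \<Longrightarrow> comm_group (Ext \<C> C A)"
    and EMap_hom:
      "\<lbrakk>A \<in> Obj \<C>; A' \<in> Obj \<C>; C \<in> Obj \<C>; C' \<in> Obj \<C>; c \<in> mor \<C> C' C; a \<in> mor \<C> A A'\<rbrakk>
        \<Longrightarrow> EMap \<C> c a \<in> hom (Ext \<C> C A) (Ext \<C> C' A')"
    and EMap_Ident:
      "\<lbrakk>A \<in> Obj \<C>; C \<in> Obj \<C>; \<delta> \<in> carrier (Ext \<C> C A)\<rbrakk>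
        \<Longrightarrow> EMap \<C> (Ident \<C> C) (Ident \<C> A) \<delta> = \<delta>"
    and EMap_Comp:
      "\<lbrakk>A \<in> Obj \<C>; A' \<in> Obj \<C>; A'' \<in> Obj \<C>; C \<in> Obj \<C>; C' \<in> Obj \<C>; C'' \<in> Obj \<C>;
        a \<in> mor \<C> A A'; a' \<in> mor \<C> A' A''; c \<in> mor \<C> C' C; c' \<in> mor \<C> C'' C';
        \<delta> \<in> carrier (Ext \<C> C A)\<rbrakk>
        \<Longrightarrow> EMap \<C> (c \<cdot> c') (a' \<cdot> a) \<delta> = EMap \<C> c' a' (EMap \<C> c a \<delta>)"
    and EMap_add_left:
      "\<lbrakk>A \<in> Obj \<C>; A' \<in> Obj \<C>; C \<in> Obj \<C>; C' \<in> Obj \<C>;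
        c \<in> mor \<C> C' C; d \<in> mor \<C> C' C; a \<in> mor \<C> A A'; \<delta> \<in> carrier (Ext \<C> C A)\<rbrakk>
        \<Longrightarrow> EMap \<C> (c \<otimes>\<^bsub>Hom \<C> C' C\<^esub> d) a \<delta> = EMap \<C> c a \<delta> \<otimes>\<^bsub>Ext \<C> C' A'\<^esub> EMap \<C> d a \<delta>"
    and EMap_add_right:
      "\<lbrakk>A \<in> Obj \<C>; A' \<in> Obj \<C>; C \<in> Obj \<C>; C' \<in> Obj \<C>;
        c \<in> mor \<C> C' C; a \<in> mor \<C> A A'; b \<in> mor \<C> A A'; \<delta> \<in> carrier (Ext \<C> C A)\<rbrakk>
        \<Longrightarrow> EMap \<C> c (a \<otimes>\<^bsub>Hom \<C> A A'\<^esub> b) \<delta> = EMap \<C> c a \<delta> \<otimes>\<^bsub>Ext \<C> C' A'\<^esub> EMap \<C> c b \<delta>"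
    and Rlz_class:
      "\<lbrakk>A \<in> Obj \<C>; C \<in> Obj \<C>; \<delta> \<in> carrier (Ext \<C> C A)\<rbrakk>
        \<Longrightarrow> Rlz \<C> C A \<delta> \<in> sequences \<C> A C // seq_equiv \<C> A C"
    and Rlz_morphism:
      "\<lbrakk>(A, B, C, x, y, \<delta>) \<in> E_triangles \<C>; (A', B', C', x', y', \<delta>') \<in> E_triangles \<C>;
        a \<in> mor \<C> A A'; c \<in> mor \<C> C C'; push \<C> C a \<delta> = pull \<C> A' c \<delta>'\<rbrakk>
        \<Longrightarrow> \<exists>b \<in> mor \<C> B B'. b \<cdot> x = x' \<cdot> a \<and> y' \<cdot> b = c \<cdot> y"
    and Rlz_zero:
      "\<lbrakk>A \<in> Obj \<C>; C \<in> Obj \<C>; (S, i, j, p, q) \<in> biproducts \<C> A C\<rbrakk>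
        \<Longrightarrow> (A, S, C, i, q, \<one>\<^bsub>Ext \<C> C A\<^esub>) \<in> E_triangles \<C>"
    and Rlz_sum:
      "\<lbrakk>T \<in> E_triangles \<C>; T' \<in> E_triangles \<C>\<rbrakk> \<Longrightarrow> triangle_sums \<C> T T' \<subseteq> E_triangles \<C>"
    and ET3:
      "\<lbrakk>(A, B, C, x, y, \<delta>) \<in> E_triangles \<C>; (A', B', C', x', y', \<delta>') \<in> E_triangles \<C>;
        a \<in> mor \<C> A A'; b \<in> mor \<C> B B'; b \<cdot> x = x' \<cdot> a\<rbrakk>
        \<Longrightarrow> \<exists>c \<in> mor \<C> C C'. y' \<cdot> b = c \<cdot> y \<and> push \<C> C a \<delta> = pull \<C> A' c \<delta>'"
    and ET3_op:
      "\<lbrakk>(A, B, C, x, y, \<delta>) \<in> E_triangles \<C>; (A', B', C', x', y', \<delta>') \<in> E_triangles \<C>;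
        b \<in> mor \<C> B B'; c \<in> mor \<C> C C'; y' \<cdot> b = c \<cdot> y\<rbrakk>
        \<Longrightarrow> \<exists>a \<in> mor \<C> A A'. b \<cdot> x = x' \<cdot> a \<and> push \<C> C a \<delta> = pull \<C> A' c \<delta>'"
    and ET4:
      "\<lbrakk>(A, B, D, f, f', \<delta>) \<in> E_triangles \<C>; (B, C, F, g, g', \<delta>') \<in> E_triangles \<C>\<rbrakk>
        \<Longrightarrow> \<exists>E h' d e \<delta>''.
              (A, C, E, g \<cdot> f, h', \<delta>'') \<in> E_triangles \<C> \<and>
              (D, E, F, d, e, push \<C> F f' \<delta>') \<in> E_triangles \<C> \<and>
              h' \<cdot> g = d \<cdot> f' \<and> e \<cdot> h' = g' \<and>
              pull \<C> A d \<delta>'' = \<delta> \<and> push \<C> E f \<delta>'' = pull \<C> B e \<delta>'"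
    and ET4_op:
      "\<lbrakk>(D, A, B, f', f, \<delta>) \<in> E_triangles \<C>; (F, B, C, g', g, \<delta>') \<in> E_triangles \<C>\<rbrakk>
        \<Longrightarrow> \<exists>E h' d e \<delta>''.
              (E, A, C, h', g \<cdot> f, \<delta>'') \<in> E_triangles \<C> \<and>
              (D, E, F, d, e, pull \<C> D g' \<delta>) \<in> E_triangles \<C> \<and>
              f \<cdot> h' = g' \<cdot> e \<and> h' \<cdot> d = f' \<and>
              push \<C> C e \<delta>'' = \<delta>' \<and> pull \<C> E g \<delta>'' = push \<C> B d \<delta>"

definition inflations :: "('o, 'm, 'e, 'z) extri_data_scheme \<Rightarrow> 'm set" where
  "inflations \<C> = {x. \<exists>A B C y \<delta>. (A, B, C, x, y, \<delta>) \<in> E_triangles \<C>}"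

definition deflations :: "('o, 'm, 'e, 'z) extri_data_scheme \<Rightarrow> 'm set" where
  "deflations \<C> = {y. \<exists>A B C x \<delta>. (A, B, C, x, y, \<delta>) \<in> E_triangles \<C>}"

definition WIC :: "('o, 'm, 'e, 'z) extri_data_scheme \<Rightarrow> bool" where
  "WIC \<C> \<longleftrightarrow>
     (\<forall>A \<in> Obj \<C>. \<forall>B \<in> Obj \<C>. \<forall>C \<in> Obj \<C>. \<forall>f \<in> mor \<C> A B. \<forall>g \<in> mor \<C> B C.
        (g \<cdot>\<^bsub>\<C>\<^esub> f \<in> inflations \<C> \<longrightarrow> f \<in> inflations \<C>) \<and>
        (g \<cdot>\<^bsub>\<C>\<^esub> f \<in> deflations \<C> \<longrightarrow> g \<in> deflations \<C>))"


section \<open>Proper classes\<close>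

definition triangle_isomorphic ::
  "('o, 'm, 'e, 'z) extri_data_scheme \<Rightarrow> ('o, 'm, 'e) triangle \<Rightarrow> ('o, 'm, 'e) triangle \<Rightarrow> bool" where
  "triangle_isomorphic \<C> = (\<lambda>(A, B, C, x, y, \<delta>) (A', B', C', x', y', \<delta>').
     \<exists>a \<in> isomorphisms \<C> A A'. \<exists>b \<in> isomorphisms \<C> B B'. \<exists>c \<in> isomorphisms \<C> C C'.
       b \<cdot>\<^bsub>\<C>\<^esub> x = x' \<cdot>\<^bsub>\<C>\<^esub> a \<and> y' \<cdot>\<^bsub>\<C>\<^esub> b = c \<cdot>\<^bsub>\<C>\<^esub> y \<and> push \<C> C a \<delta> = pull \<C> A' c \<delta>')"

text \<open>The empty coproduct of triangles, the zero triangle, is split and so is covered by \<open>split_closed\<close>.\<close>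

locale proper_class = extriangulated_category \<C>
  for \<C> :: "('o, 'm, 'e, 'z) extri_data_scheme" (structure) +
  fixes \<xi> :: "('o, 'm, 'e) triangle set"
  assumes triangles: "\<xi> \<subseteq> E_triangles \<C>"
    and iso_closed: "\<lbrakk>T \<in> \<xi>; T' \<in> E_triangles \<C>; triangle_isomorphic \<C> T T'\<rbrakk> \<Longrightarrow> T' \<in> \<xi>"
    and sum_closed: "\<lbrakk>T \<in> \<xi>; T' \<in> \<xi>\<rbrakk> \<Longrightarrow> triangle_sums \<C> T T' \<subseteq> \<xi>"
    and split_closed: "(A, B, C, x, y, \<one>\<^bsub>Ext \<C> C A\<^esub>) \<in> E_triangles \<C> \<Longrightarrow> (A, B, C, x, y, \<one>\<^bsub>Ext \<C> C A\<^esub>) \<in> \<xi>"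
    and base_change:
      "\<lbrakk>(A, B, C, x, y, \<delta>) \<in> \<xi>; C' \<in> Obj \<C>; c \<in> mor \<C> C' C;
        (A, B', C', x', y', pull \<C> A c \<delta>) \<in> E_triangles \<C>\<rbrakk>
        \<Longrightarrow> (A, B', C', x', y', pull \<C> A c \<delta>) \<in> \<xi>"
    and cobase_change:
      "\<lbrakk>(A, B, C, x, y, \<delta>) \<in> \<xi>; A' \<in> Obj \<C>; a \<in> mor \<C> A A';
        (A', B', C, x', y', push \<C> C a \<delta>) \<in> E_triangles \<C>\<rbrakk>
        \<Longrightarrow> (A', B', C, x', y', push \<C> C a \<delta>) \<in> \<xi>"
    and saturated:
      "\<lbrakk>(A1, B1, C, x1, y1, \<delta>1) \<in> E_triangles \<C>; (A2, B2, C, x2, y2, \<delta>2) \<in> \<xi>;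
        (A1, M, B2, m, n, pull \<C> A1 y2 \<delta>1) \<in> \<xi>\<rbrakk>
        \<Longrightarrow> (A1, B1, C, x1, y1, \<delta>1) \<in> \<xi>"

text \<open>
  The library predicate \<open>short_exact_sequence\<close> lists its groups and maps from right to left:
  \<open>short_exact_sequence R Q P v u\<close> says that \<open>0 \<rightarrow> P \<rightarrow> Q \<rightarrow> R \<rightarrow> 0\<close> with maps \<open>u\<close> and \<open>v\<close> is exact.
\<close>

definition projectives ::
  "('o, 'm, 'e, 'z) extri_data_scheme \<Rightarrow> ('o, 'm, 'e) triangle set \<Rightarrow> 'o set" where
  "projectives \<C> \<xi> = {P \<in> Obj \<C>. \<forall>(A, B, C, x, y, \<delta>) \<in> \<xi>.
     short_exact_sequence (Hom \<C> P C) (Hom \<C> P B) (Hom \<C> P A) (\<lambda>g. y \<cdot>\<^bsub>\<C>\<^esub> g) (\<lambda>f. x \<cdot>\<^bsub>\<C>\<^esub> f)}"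

definition injectives ::
  "('o, 'm, 'e, 'z) extri_data_scheme \<Rightarrow> ('o, 'm, 'e) triangle set \<Rightarrow> 'o set" where
  "injectives \<C> \<xi> = {I \<in> Obj \<C>. \<forall>(A, B, C, x, y, \<delta>) \<in> \<xi>.
     short_exact_sequence (Hom \<C> A I) (Hom \<C> B I) (Hom \<C> C I) (\<lambda>g. g \<cdot>\<^bsub>\<C>\<^esub> x) (\<lambda>f. f \<cdot>\<^bsub>\<C>\<^esub> y)}"

definition enough_projectives ::
  "('o, 'm, 'e, 'z) extri_data_scheme \<Rightarrow> ('o, 'm, 'e) triangle set \<Rightarrow> bool" where
  "enough_projectives \<C> \<xi> \<longleftrightarrow>
     (\<forall>A \<in> Obj \<C>. \<exists>K P x y \<delta>. (K, P, A, x, y, \<delta>) \<in> \<xi> \<and> P \<in> projectives \<C> \<xi>)"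

definition enough_injectives ::
  "('o, 'm, 'e, 'z) extri_data_scheme \<Rightarrow> ('o, 'm, 'e) triangle set \<Rightarrow> bool" where
  "enough_injectives \<C> \<xi> \<longleftrightarrow>
     (\<forall>A \<in> Obj \<C>. \<exists>I K x y \<delta>. (A, I, K, x, y, \<delta>) \<in> \<xi> \<and> I \<in> injectives \<C> \<xi>)"


section \<open>Resolutions\<close>

definition complex :: "('o, 'm, 'z) cat_data_scheme \<Rightarrow> (int \<Rightarrow> 'o) \<Rightarrow> (int \<Rightarrow> 'm) \<Rightarrow> bool" where
  "complex \<C> X d \<longleftrightarrow>
     (\<forall>n. X n \<in> Obj \<C> \<and> d n \<in> mor \<C> (X n) (X (n - 1)) \<and>
          d n \<cdot>\<^bsub>\<C>\<^esub> d (n + 1) = \<one>\<^bsub>Hom \<C> (X (n + 1)) (X (n - 1))\<^esub>)"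

text \<open>
  The triangles \<open>K (n + 1) \<rightarrow> X n \<rightarrow> K n\<close>, with maps \<open>g n\<close>, \<open>f n\<close>, are resolution triangles of the complex
  \<open>(X, d)\<close> lying in the class \<open>\<tau>\<close>. So \<open>(X, d)\<close> is \<open>\<xi>\<close>-exact if it has them for \<open>\<tau> = \<xi>\<close>.
\<close>

definition resolution_triangles ::
  "('o, 'm, 'e, 'z) extri_data_scheme \<Rightarrow> ('o, 'm, 'e) triangle set \<Rightarrow> (int \<Rightarrow> 'o) \<Rightarrow> (int \<Rightarrow> 'm)
    \<Rightarrow> (int \<Rightarrow> 'o) \<Rightarrow> (int \<Rightarrow> 'm) \<Rightarrow> (int \<Rightarrow> 'm) \<Rightarrow> (int \<Rightarrow> 'e) \<Rightarrow> bool" where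
  "resolution_triangles \<C> \<tau> X d K g f \<delta> \<longleftrightarrow>
     (\<forall>n. (K (n + 1), X n, K n, g n, f n, \<delta> n) \<in> \<tau> \<and> d n = g (n - 1) \<cdot>\<^bsub>\<C>\<^esub> f n)"

text \<open>
  One-sided complexes \<open>\<cdots> \<rightarrow> X 1 \<rightarrow> X 0 \<rightarrow> M \<rightarrow> 0\<close>; here \<open>d 0\<close> is the augmentation \<open>X 0 \<rightarrow> M\<close> and
  \<open>d (Suc n)\<close> maps \<open>X (Suc n)\<close> to \<open>X n\<close>.
\<close>

definition augmented_complex ::
  "('o, 'm, 'z) cat_data_scheme \<Rightarrow> (nat \<Rightarrow> 'o) \<Rightarrow> (nat \<Rightarrow> 'm) \<Rightarrow> 'o \<Rightarrow> bool" where
  "augmented_complex \<C> X d M \<longleftrightarrow>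
     M \<in> Obj \<C> \<and> d 0 \<in> mor \<C> (X 0) M \<and> d 0 \<cdot>\<^bsub>\<C>\<^esub> d 1 = \<one>\<^bsub>Hom \<C> (X 1) M\<^esub> \<and>
     (\<forall>n. X n \<in> Obj \<C> \<and> d (Suc n) \<in> mor \<C> (X (Suc n)) (X n) \<and>
          d (Suc n) \<cdot>\<^bsub>\<C>\<^esub> d (Suc (Suc n)) = \<one>\<^bsub>Hom \<C> (X (Suc (Suc n))) (X n)\<^esub>)"

definition augmented_resolution_triangles ::
  "('o, 'm, 'e, 'z) extri_data_scheme \<Rightarrow> ('o, 'm, 'e) triangle set
    \<Rightarrow> (nat \<Rightarrow> 'o) \<Rightarrow> (nat \<Rightarrow> 'm) \<Rightarrow> 'o
    \<Rightarrow> (nat \<Rightarrow> 'o) \<Rightarrow> (nat \<Rightarrow> 'm) \<Rightarrow> (nat \<Rightarrow> 'm) \<Rightarrow> (nat \<Rightarrow> 'e) \<Rightarrow> bool" where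
  "augmented_resolution_triangles \<C> \<tau> X d M K g f \<delta> \<longleftrightarrow>
     K 0 = M \<and> d 0 = f 0 \<and>
     (\<forall>n. (K (Suc n), X n, K n, g n, f n, \<delta> n) \<in> \<tau> \<and> d (Suc n) = g n \<cdot>\<^bsub>\<C>\<^esub> f (Suc n))"

definition res ::
  "('o, 'm, 'e, 'z) extri_data_scheme \<Rightarrow> ('o, 'm, 'e) triangle set \<Rightarrow> 'o set \<Rightarrow> 'o set" where
  "res \<C> \<xi> \<X> = {M. \<exists>X d K g f \<delta>. augmented_complex \<C> X d M \<and> (\<forall>n. X n \<in> \<X>) \<and>
     augmented_resolution_triangles \<C> \<xi> X d M K g f \<delta>}"


section \<open>Quasi-resolving subcategories\<close>

text \<open>Full subcategories are given by their sets of objects.\<close>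

definition additive_subcategory :: "('o, 'm, 'z) cat_data_scheme \<Rightarrow> 'o set \<Rightarrow> bool" where
  "additive_subcategory \<C> \<X> \<longleftrightarrow> \<X> \<subseteq> Obj \<C> \<and> (\<exists>Z \<in> \<X>. zero_object \<C> Z) \<and>
     (\<forall>A \<in> \<X>. \<forall>B \<in> \<X>. \<exists>(S, i, j, p, q) \<in> biproducts \<C> A B. S \<in> \<X>)"

definition projectives_in ::
  "('o, 'm, 'e, 'z) extri_data_scheme \<Rightarrow> ('o, 'm, 'e) triangle set \<Rightarrow> 'o set \<Rightarrow> 'o set" where
  "projectives_in \<C> \<xi> \<X> = \<X> \<inter> projectives \<C> \<xi>"

definition closed_under_extensions ::
  "('o, 'm, 'e) triangle set \<Rightarrow> 'o set \<Rightarrow> bool" where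
  "closed_under_extensions \<xi> \<X> \<longleftrightarrow> (\<forall>(A, B, C, x, y, \<delta>) \<in> \<xi>. A \<in> \<X> \<and> C \<in> \<X> \<longrightarrow> B \<in> \<X>)"

definition closed_under_cocones ::
  "('o, 'm, 'e) triangle set \<Rightarrow> 'o set \<Rightarrow> bool" where
  "closed_under_cocones \<xi> \<X> \<longleftrightarrow> (\<forall>(A, B, C, x, y, \<delta>) \<in> \<xi>. B \<in> \<X> \<and> C \<in> \<X> \<longrightarrow> A \<in> \<X>)"

definition quasi_resolving ::
  "('o, 'm, 'e, 'z) extri_data_scheme \<Rightarrow> ('o, 'm, 'e) triangle set \<Rightarrow> 'o set \<Rightarrow> bool" where
  "quasi_resolving \<C> \<xi> \<X> \<longleftrightarrow>
     additive_subcategory \<C> \<X> \<and> closed_under_extensions \<xi> \<X> \<and> closed_under_cocones \<xi> \<X> \<and>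
     \<X> \<subseteq> res \<C> \<xi> (projectives_in \<C> \<xi> \<X>)"

text \<open>The \<open>\<C>(-, \<X>)\<close>-exact triangles in \<open>\<xi>\<close>.\<close>

definition hom_exact_triangles ::
  "('o, 'm, 'e, 'z) extri_data_scheme \<Rightarrow> ('o, 'm, 'e) triangle set \<Rightarrow> 'o set
    \<Rightarrow> ('o, 'm, 'e) triangle set" where
  "hom_exact_triangles \<C> \<xi> \<X> = {(A, B, C, x, y, \<delta>) \<in> \<xi>. \<forall>X \<in> \<X>.
     short_exact_sequence (Hom \<C> A X) (Hom \<C> B X) (Hom \<C> C X) (\<lambda>g. g \<cdot>\<^bsub>\<C>\<^esub> x) (\<lambda>f. f \<cdot>\<^bsub>\<C>\<^esub> y)}"

definition complete_resolution ::
  "('o, 'm, 'e, 'z) extri_data_scheme \<Rightarrow> ('o, 'm, 'e) triangle set \<Rightarrow> 'o set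
    \<Rightarrow> (int \<Rightarrow> 'o) \<Rightarrow> (int \<Rightarrow> 'm)
    \<Rightarrow> (int \<Rightarrow> 'o) \<Rightarrow> (int \<Rightarrow> 'm) \<Rightarrow> (int \<Rightarrow> 'm) \<Rightarrow> (int \<Rightarrow> 'e) \<Rightarrow> bool" where
  "complete_resolution \<C> \<xi> \<X> P d K g f \<delta> \<longleftrightarrow>
     complex \<C> P d \<and> (\<forall>n. P n \<in> projectives_in \<C> \<xi> \<X>) \<and>
     resolution_triangles \<C> (hom_exact_triangles \<C> \<xi> \<X>) P d K g f \<delta>"

definition GQP ::
  "('o, 'm, 'e, 'z) extri_data_scheme \<Rightarrow> ('o, 'm, 'e) triangle set \<Rightarrow> 'o set \<Rightarrow> 'o set" where
  "GQP \<C> \<xi> \<X> = {M. \<exists>P d K g f \<delta> n. complete_resolution \<C> \<xi> \<X> P d K g f \<delta> \<and> M = K n}"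

end

theory Submission
  imports Defs
begin

text \<open>
  Call a triangle of \<open>\<xi>\<close> Hom-exact if it is \<open>\<C>(-, \<X>)\<close>-exact, and write \<open>\<P>\<close> for the \<open>\<xi>\<close>-projectives
  in \<open>\<X>\<close>. By \<open>GQP_coinduct\<close>, the subcategory of Gorenstein quasi-projective objects is the largest class in
  which every \<open>M\<close> has Hom-exact triangles \<open>K \<rightarrow> P \<rightarrow> M\<close> and \<open>M \<rightarrow> P' \<rightarrow> K'\<close> with \<open>P, P' \<in> \<P>\<close> and
  \<open>K\<close>, \<open>K'\<close> in the class. To show that an object is Gorenstein quasi-projective it therefore suffices to find
  one step on either side. The steps are built from three facts.

  First, Hom-exact deflations compose, and the kernel of a composite is an extension, in \<open>\<xi>\<close>, of the two
  kernels; dually for inflations (\<open>hom_exact_comp_deflations\<close>, \<open>hom_exact_comp_inflations\<close>). This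
  uses (ET4) together with the description of \<open>\<xi>\<close> by lifting from projectives
  (\<open>xi_iff_projective_lift\<close>), where saturation and the existence of enough projectives enter.

  Secondly, every triangle of \<open>\<xi>\<close> ending in a Gorenstein quasi-projective object is Hom-exact, as relative
  extensions of such an object by objects of \<open>\<X>\<close> vanish (\<open>hom_exact_of_projective_cover\<close>).

  Thirdly, two triangles with a common end fit into a pullback or pushout square
  (\<open>pullback_square\<close>, \<open>pushout_square\<close>). For \<open>A \<rightarrow> B \<rightarrow> C\<close> in \<open>\<xi>\<close>, the pullback of \<open>B \<rightarrow> C\<close> to a
  projective cover of \<open>C\<close> splits, and so does the pushout along a map from \<open>A\<close> to an object of \<open>\<X>\<close> that extends
  to \<open>B\<close>. This turns covers and inflations to \<open>\<P>\<close> of \<open>A\<close> and \<open>C\<close> into those of \<open>B\<close> (\<open>GQP_extension\<close>), and those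
  of \<open>B\<close> and \<open>C\<close> into those of \<open>A\<close> (\<open>GQP_cocone\<close>). Objects of \<open>\<P>\<close> are Gorenstein quasi-projective, so half of a
  complete resolution is a resolution of the kind that is required.
\<close>


section \<open>Calculating with morphisms\<close>

context additive_category
begin

text \<open>
  As distinct Hom-sets are disjoint, a morphism determines its source and target. Keeping them as
  functions lets the simplifier find the objects in the typing conditions of composition by itself.
\<close>

definition arr :: "'b \<Rightarrow> bool" where
  "arr f \<longleftrightarrow> (\<exists>A \<in> Obj \<C>. \<exists>B \<in> Obj \<C>. f \<in> mor \<C> A B)"

definition src :: "'b \<Rightarrow> 'a" where
  "src f = (THE A. A \<in> Obj \<C> \<and> (\<exists>B \<in> Obj \<C>. f \<in> mor \<C> A B))"

definition trg :: "'b \<Rightarrow> 'a" where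
  "trg f = (THE B. B \<in> Obj \<C> \<and> (\<exists>A \<in> Obj \<C>. f \<in> mor \<C> A B))"

definition in_hom :: "'b \<Rightarrow> 'a \<Rightarrow> 'a \<Rightarrow> bool"  (\<open>\<guillemotleft>_ : _ \<rightarrow> _\<guillemotright>\<close>) where
  in_hom_simp [simp]: "\<guillemotleft>f : A \<rightarrow> B\<guillemotright> \<longleftrightarrow> A \<in> Obj \<C> \<and> B \<in> Obj \<C> \<and> arr f \<and> src f = A \<and> trg f = B"

abbreviation null :: "'a \<Rightarrow> 'a \<Rightarrow> 'b"  (\<open>\<zero>[_, _]\<close>) where
  "\<zero>[A, B] \<equiv> \<one>\<^bsub>Hom \<C> A B\<^esub>"

lemma in_hom_iff: "\<guillemotleft>f : A \<rightarrow> B\<guillemotright> \<longleftrightarrow> A \<in> Obj \<C> \<and> B \<in> Obj \<C> \<and> f \<in> mor \<C> A B"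
proof
  assume f: "A \<in> Obj \<C> \<and> B \<in> Obj \<C> \<and> f \<in> mor \<C> A B"
  have "src f = A" "trg f = B"
    unfolding src_def trg_def using f Hom_disjoint by (blast intro!: the_equality)+
  with f show "\<guillemotleft>f : A \<rightarrow> B\<guillemotright>"
    by (auto simp: arr_def)
next
  assume f: "\<guillemotleft>f : A \<rightarrow> B\<guillemotright>"
  then obtain A' B' where f': "A' \<in> Obj \<C>" "B' \<in> Obj \<C>" "f \<in> mor \<C> A' B'"
    by (auto simp: arr_def)
  have "src f = A'" "trg f = B'"
    unfolding src_def trg_def using f' Hom_disjoint by (blast intro!: the_equality)+
  with f f' show "A \<in> Obj \<C> \<and> B \<in> Obj \<C> \<and> f \<in> mor \<C> A B"
    by simp
qed

lemma in_mor: "\<lbrakk>A \<in> Obj \<C>; B \<in> Obj \<C>\<rbrakk> \<Longrightarrow> f \<in> mor \<C> A B \<longleftrightarrow> \<guillemotleft>f : A \<rightarrow> B\<guillemotright>"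
  using in_hom_iff by blast

lemma in_hom_src_trg: "arr f \<Longrightarrow> \<guillemotleft>f : src f \<rightarrow> trg f\<guillemotright>"
  unfolding arr_def using in_hom_iff in_hom_simp by metis

lemma src_trg_Obj [simp]: "arr f \<Longrightarrow> src f \<in> Obj \<C>" "arr f \<Longrightarrow> trg f \<in> Obj \<C>"
  using in_hom_src_trg by auto

lemma comp_in_hom: "\<lbrakk>\<guillemotleft>f : A \<rightarrow> B\<guillemotright>; \<guillemotleft>g : B \<rightarrow> C\<guillemotright>\<rbrakk> \<Longrightarrow> \<guillemotleft>g \<cdot> f : A \<rightarrow> C\<guillemotright>"
  unfolding in_hom_iff using Comp_mor by blast

lemma comp_simps [simp]:
  assumes "arr f" "arr g" "src g = trg f"
  shows "arr (g \<cdot> f)" "src (g \<cdot> f) = src f" "trg (g \<cdot> f) = trg g"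
  using comp_in_hom[OF in_hom_src_trg[OF assms(1)], of g "trg g"] assms by auto

lemma comp_assoc [simp]:
  "\<lbrakk>arr f; arr g; arr h; src g = trg f; src h = trg g\<rbrakk> \<Longrightarrow> (h \<cdot> g) \<cdot> f = h \<cdot> (g \<cdot> f)"
  using Comp_assoc[of "src f" "trg f" "trg g" "trg h" f g h] in_hom_src_trg in_hom_iff
  by (metis src_trg_Obj)

lemma ident_simps [simp]:
  assumes "A \<in> Obj \<C>"
  shows "arr (Ident \<C> A)" "src (Ident \<C> A) = A" "trg (Ident \<C> A) = A"
  using assms Ident_mor[OF assms] in_mor[OF assms assms, of "Ident \<C> A"] by auto

lemma comp_ident [simp]: "\<lbrakk>arr f; src f = A\<rbrakk> \<Longrightarrow> f \<cdot> Ident \<C> A = f"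
  using Comp_Ident in_hom_src_trg in_hom_iff by blast

lemma ident_comp [simp]: "\<lbrakk>arr f; trg f = A\<rbrakk> \<Longrightarrow> Ident \<C> A \<cdot> f = f"
  using Ident_Comp in_hom_src_trg in_hom_iff by blast

lemma null_simps [simp]:
  assumes "A \<in> Obj \<C>" "B \<in> Obj \<C>"
  shows "arr \<zero>[A, B]" "src \<zero>[A, B] = A" "trg \<zero>[A, B] = B"
proof -
  interpret comm_group "Hom \<C> A B" using Hom_comm_group assms .
  have "\<guillemotleft>\<zero>[A, B] : A \<rightarrow> B\<guillemotright>" using assms unfolding in_hom_iff by simp
  then show "arr \<zero>[A, B]" "src \<zero>[A, B] = A" "trg \<zero>[A, B] = B" by auto
qed

lemma add_simps [simp]:
  assumes "\<guillemotleft>f : A \<rightarrow> B\<guillemotright>" "\<guillemotleft>g : A \<rightarrow> B\<guillemotright>"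
  shows "arr (f \<otimes>\<^bsub>Hom \<C> A B\<^esub> g)" "src (f \<otimes>\<^bsub>Hom \<C> A B\<^esub> g) = A" "trg (f \<otimes>\<^bsub>Hom \<C> A B\<^esub> g) = B"
proof -
  interpret comm_group "Hom \<C> A B" using Hom_comm_group assms by simp
  have "\<guillemotleft>f \<otimes>\<^bsub>Hom \<C> A B\<^esub> g : A \<rightarrow> B\<guillemotright>" using assms unfolding in_hom_iff by simp
  then show "arr (f \<otimes>\<^bsub>Hom \<C> A B\<^esub> g)" "src (f \<otimes>\<^bsub>Hom \<C> A B\<^esub> g) = A" "trg (f \<otimes>\<^bsub>Hom \<C> A B\<^esub> g) = B"
    by auto
qed

lemma add_null [simp]:
  assumes "\<guillemotleft>f : A \<rightarrow> B\<guillemotright>"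
  shows "f \<otimes>\<^bsub>Hom \<C> A B\<^esub> \<zero>[A, B] = f" "\<zero>[A, B] \<otimes>\<^bsub>Hom \<C> A B\<^esub> f = f"
proof -
  interpret comm_group "Hom \<C> A B" using Hom_comm_group assms by simp
  show "f \<otimes>\<^bsub>Hom \<C> A B\<^esub> \<zero>[A, B] = f" "\<zero>[A, B] \<otimes>\<^bsub>Hom \<C> A B\<^esub> f = f"
    using assms unfolding in_hom_iff by simp_all
qed

lemma add_commute:
  assumes "\<guillemotleft>f : A \<rightarrow> B\<guillemotright>" "\<guillemotleft>g : A \<rightarrow> B\<guillemotright>"
  shows "f \<otimes>\<^bsub>Hom \<C> A B\<^esub> g = g \<otimes>\<^bsub>Hom \<C> A B\<^esub> f"
proof -
  interpret comm_group "Hom \<C> A B" using Hom_comm_group assms by simp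
  show ?thesis using assms unfolding in_hom_iff by (simp add: m_comm)
qed

lemma comp_add [simp]:
  assumes "\<guillemotleft>f : A \<rightarrow> B\<guillemotright>" "\<guillemotleft>g : A \<rightarrow> B\<guillemotright>" "arr h" "src h = B"
  shows "h \<cdot> (f \<otimes>\<^bsub>Hom \<C> A B\<^esub> g) = (h \<cdot> f) \<otimes>\<^bsub>Hom \<C> A (trg h)\<^esub> (h \<cdot> g)"
proof -
  have "(\<lambda>f. h \<cdot> f) \<in> hom (Hom \<C> A B) (Hom \<C> A (trg h))"
    using Comp_hom_left in_hom_src_trg[OF assms(3)] assms unfolding in_hom_iff by blast
  then show ?thesis using assms(1,2) unfolding in_hom_iff hom_def by blast
qed

lemma add_comp [simp]:
  assumes "\<guillemotleft>f : A \<rightarrow> B\<guillemotright>" "\<guillemotleft>g : A \<rightarrow> B\<guillemotright>" "arr h" "trg h = A"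
  shows "(f \<otimes>\<^bsub>Hom \<C> A B\<^esub> g) \<cdot> h = (f \<cdot> h) \<otimes>\<^bsub>Hom \<C> (src h) B\<^esub> (g \<cdot> h)"
proof -
  have "(\<lambda>f. f \<cdot> h) \<in> hom (Hom \<C> A B) (Hom \<C> (src h) B)"
    using Comp_hom_right in_hom_src_trg[OF assms(3)] assms unfolding in_hom_iff by blast
  then show ?thesis using assms(1,2) unfolding in_hom_iff hom_def by blast
qed

lemma comp_null [simp]:
  assumes "A \<in> Obj \<C>" "arr h" "src h = B"
  shows "h \<cdot> \<zero>[A, B] = \<zero>[A, trg h]"
proof -
  have "(\<lambda>f. h \<cdot> f) \<in> hom (Hom \<C> A B) (Hom \<C> A (trg h))"
    using Comp_hom_left in_hom_src_trg[OF assms(2)] assms unfolding in_hom_iff by blast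
  then show ?thesis using hom_one Hom_comm_group comm_group.axioms(2) assms src_trg_Obj by metis
qed

lemma null_comp [simp]:
  assumes "B \<in> Obj \<C>" "arr h" "trg h = A"
  shows "\<zero>[A, B] \<cdot> h = \<zero>[src h, B]"
proof -
  have "(\<lambda>f. f \<cdot> h) \<in> hom (Hom \<C> A B) (Hom \<C> (src h) B)"
    using Comp_hom_right in_hom_src_trg[OF assms(2)] assms unfolding in_hom_iff by blast
  then show ?thesis using hom_one Hom_comm_group comm_group.axioms(2) assms src_trg_Obj by metis
qed

text \<open>Subtraction enters all later arguments only in this form, which avoids signs.\<close>

lemma difference_exists:
  assumes "\<guillemotleft>f : A \<rightarrow> B\<guillemotright>" "\<guillemotleft>g : A \<rightarrow> B\<guillemotright>"
  obtains d where "\<guillemotleft>d : A \<rightarrow> B\<guillemotright>" "f = g \<otimes>\<^bsub>Hom \<C> A B\<^esub> d"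
proof
  interpret comm_group "Hom \<C> A B" using Hom_comm_group assms by simp
  show "\<guillemotleft>inv\<^bsub>Hom \<C> A B\<^esub> g \<otimes>\<^bsub>Hom \<C> A B\<^esub> f : A \<rightarrow> B\<guillemotright>"
    using assms unfolding in_hom_iff by simp
  show "f = g \<otimes>\<^bsub>Hom \<C> A B\<^esub> (inv\<^bsub>Hom \<C> A B\<^esub> g \<otimes>\<^bsub>Hom \<C> A B\<^esub> f)"
    using assms unfolding in_hom_iff by (simp flip: m_assoc)
qed

lemma add_eq_left_iff:
  assumes "\<guillemotleft>f : A \<rightarrow> B\<guillemotright>" "\<guillemotleft>d : A \<rightarrow> B\<guillemotright>"
  shows "f = f \<otimes>\<^bsub>Hom \<C> A B\<^esub> d \<longleftrightarrow> d = \<zero>[A, B]"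
proof -
  interpret comm_group "Hom \<C> A B" using Hom_comm_group assms by simp
  show ?thesis using assms unfolding in_hom_iff by simp
qed

lemma zero_objectD:
  assumes "zero_object \<C> Z"
  shows "Z \<in> Obj \<C>"
    and "\<guillemotleft>f : A \<rightarrow> Z\<guillemotright> \<Longrightarrow> f = \<zero>[A, Z]"
    and "\<guillemotleft>f : Z \<rightarrow> A\<guillemotright> \<Longrightarrow> f = \<zero>[Z, A]"
  using assms unfolding zero_object_def in_hom_iff by auto

lemma biproductD:
  assumes "(S, i, j, p, q) \<in> biproducts \<C> A B" "A \<in> Obj \<C>" "B \<in> Obj \<C>"
  shows "S \<in> Obj \<C>" "\<guillemotleft>i : A \<rightarrow> S\<guillemotright>" "\<guillemotleft>j : B \<rightarrow> S\<guillemotright>" "\<guillemotleft>p : S \<rightarrow> A\<guillemotright>" "\<guillemotleft>q : S \<rightarrow> B\<guillemotright>"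
    "p \<cdot> i = Ident \<C> A" "q \<cdot> j = Ident \<C> B" "q \<cdot> i = \<zero>[A, B]" "p \<cdot> j = \<zero>[B, A]"
    "(i \<cdot> p) \<otimes>\<^bsub>Hom \<C> S S\<^esub> (j \<cdot> q) = Ident \<C> S"
  using assms unfolding biproducts_def by (auto simp only: mem_Collect_eq case_prod_conv in_hom_iff)

lemma biproductI:
  assumes "\<guillemotleft>i : A \<rightarrow> S\<guillemotright>" "\<guillemotleft>j : B \<rightarrow> S\<guillemotright>" "\<guillemotleft>p : S \<rightarrow> A\<guillemotright>" "\<guillemotleft>q : S \<rightarrow> B\<guillemotright>"
    "p \<cdot> i = Ident \<C> A" "q \<cdot> j = Ident \<C> B" "q \<cdot> i = \<zero>[A, B]" "p \<cdot> j = \<zero>[B, A]"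
    "(i \<cdot> p) \<otimes>\<^bsub>Hom \<C> S S\<^esub> (j \<cdot> q) = Ident \<C> S"
  shows "(S, i, j, p, q) \<in> biproducts \<C> A B"
  using assms unfolding biproducts_def by (auto simp only: mem_Collect_eq case_prod_conv in_hom_iff)

lemma biproduct_swap:
  assumes "(S, i, j, p, q) \<in> biproducts \<C> A B" "A \<in> Obj \<C>" "B \<in> Obj \<C>"
  shows "(S, j, i, q, p) \<in> biproducts \<C> B A"
  using biproductD[OF assms] add_commute[of "i \<cdot> p" S S "j \<cdot> q"]
  by (intro biproductI) auto

lemma biproduct_joint_epi:
  assumes "(S, i, j, p, q) \<in> biproducts \<C> A B" "A \<in> Obj \<C>" "B \<in> Obj \<C>"
    and f: "\<guillemotleft>f : S \<rightarrow> X\<guillemotright>" and "f \<cdot> i = \<zero>[A, X]" "f \<cdot> j = \<zero>[B, X]"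
  shows "f = \<zero>[S, X]"
proof -
  note S = biproductD[OF assms(1-3)]
  have "f = f \<cdot> Ident \<C> S"
    using S f by simp
  also have "Ident \<C> S = (i \<cdot> p) \<otimes>\<^bsub>Hom \<C> S S\<^esub> (j \<cdot> q)"
    using S(10) by simp
  also have "f \<cdot> \<dots> = (f \<cdot> (i \<cdot> p)) \<otimes>\<^bsub>Hom \<C> S X\<^esub> (f \<cdot> (j \<cdot> q))"
    using S(1-5) f by simp
  also have "f \<cdot> (i \<cdot> p) = (f \<cdot> i) \<cdot> p"
    using S f by simp
  also have "f \<cdot> (j \<cdot> q) = (f \<cdot> j) \<cdot> q"
    using S f by simp
  finally show ?thesis
    using S f assms(5,6) by simp
qed

lemma zero_biproduct_right:
  assumes "zero_object \<C> Z" "A \<in> Obj \<C>"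
  shows "(A, Ident \<C> A, \<zero>[Z, A], Ident \<C> A, \<zero>[A, Z]) \<in> biproducts \<C> A Z"
  using zero_objectD(1)[OF assms(1)] assms(2) zero_objectD(2)[OF assms(1), of "Ident \<C> Z" Z]
  by (intro biproductI) auto

lemma zero_biproduct_left:
  assumes "zero_object \<C> Z" "A \<in> Obj \<C>"
  shows "(A, \<zero>[Z, A], Ident \<C> A, \<zero>[A, Z], Ident \<C> A) \<in> biproducts \<C> Z A"
  using biproduct_swap zero_biproduct_right[OF assms] zero_objectD(1)[OF assms(1)] assms(2) by metis

lemma isomorphism_iff:
  assumes "A \<in> Obj \<C>" "B \<in> Obj \<C>"
  shows "f \<in> isomorphisms \<C> A B \<longleftrightarrow> \<guillemotleft>f : A \<rightarrow> B\<guillemotright> \<and>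
    (\<exists>g. \<guillemotleft>g : B \<rightarrow> A\<guillemotright> \<and> g \<cdot> f = Ident \<C> A \<and> f \<cdot> g = Ident \<C> B)"
  using assms unfolding isomorphisms_def mem_Collect_eq by (metis in_mor)

lemma isomorphism_ident: "A \<in> Obj \<C> \<Longrightarrow> Ident \<C> A \<in> isomorphisms \<C> A A"
  unfolding isomorphism_iff by (auto intro!: exI[of _ "Ident \<C> A"])

lemma isomorphism_comp:
  assumes "A \<in> Obj \<C>" "B \<in> Obj \<C>" "C \<in> Obj \<C>" "f \<in> isomorphisms \<C> A B" "g \<in> isomorphisms \<C> B C"
  shows "g \<cdot> f \<in> isomorphisms \<C> A C"
proof -
  obtain f' g' where f: "\<guillemotleft>f : A \<rightarrow> B\<guillemotright>" "\<guillemotleft>f' : B \<rightarrow> A\<guillemotright>" "f' \<cdot> f = Ident \<C> A" "f \<cdot> f' = Ident \<C> B"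
    and g: "\<guillemotleft>g : B \<rightarrow> C\<guillemotright>" "\<guillemotleft>g' : C \<rightarrow> B\<guillemotright>" "g' \<cdot> g = Ident \<C> B" "g \<cdot> g' = Ident \<C> C"
    using assms isomorphism_iff by auto
  have "(f' \<cdot> g') \<cdot> (g \<cdot> f) = f' \<cdot> ((g' \<cdot> g) \<cdot> f)" "(g \<cdot> f) \<cdot> (f' \<cdot> g') = g \<cdot> ((f \<cdot> f') \<cdot> g')"
    using f(1,2) g(1,2) by simp_all
  then have "(f' \<cdot> g') \<cdot> (g \<cdot> f) = Ident \<C> A" "(g \<cdot> f) \<cdot> (f' \<cdot> g') = Ident \<C> C"
    using f g by simp_all
  then show ?thesis
    using f(1,2) g(1,2) assms(1,3) isomorphism_iff[of A C] comp_in_hom by metis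
qed

lemma isomorphism_inverse:
  assumes "A \<in> Obj \<C>" "B \<in> Obj \<C>" "f \<in> isomorphisms \<C> A B"
  obtains g where "g \<in> isomorphisms \<C> B A" "g \<cdot> f = Ident \<C> A" "f \<cdot> g = Ident \<C> B"
  using assms isomorphism_iff by metis

end


section \<open>The long exact sequences of an E-triangle\<close>

context extriangulated_category
begin

lemma Ext_group: "\<lbrakk>C \<in> Obj \<C>; A \<in> Obj \<C>\<rbrakk> \<Longrightarrow> group (Ext \<C> C A)"
  using Ext_comm_group comm_group.axioms(2) by blast

lemma Ext_one [simp]: "\<lbrakk>C \<in> Obj \<C>; A \<in> Obj \<C>\<rbrakk> \<Longrightarrow> \<one>\<^bsub>Ext \<C> C A\<^esub> \<in> carrier (Ext \<C> C A)"
  using Ext_group group.is_monoid monoid.one_closed by blast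

lemma Ext_mult [simp]:
  assumes "C \<in> Obj \<C>" "A \<in> Obj \<C>" "\<delta> \<in> carrier (Ext \<C> C A)" "\<epsilon> \<in> carrier (Ext \<C> C A)"
  shows "\<delta> \<otimes>\<^bsub>Ext \<C> C A\<^esub> \<epsilon> \<in> carrier (Ext \<C> C A)"
  using assms Ext_group group.is_monoid monoid.m_closed by meson

lemma Ext_mult_one [simp]:
  assumes "C \<in> Obj \<C>" "A \<in> Obj \<C>" "\<delta> \<in> carrier (Ext \<C> C A)"
  shows "\<delta> \<otimes>\<^bsub>Ext \<C> C A\<^esub> \<one>\<^bsub>Ext \<C> C A\<^esub> = \<delta>" "\<one>\<^bsub>Ext \<C> C A\<^esub> \<otimes>\<^bsub>Ext \<C> C A\<^esub> \<delta> = \<delta>"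
  using assms Ext_group group.is_monoid monoid.r_one monoid.l_one by metis+

lemma push_hom:
  assumes "C \<in> Obj \<C>" "\<guillemotleft>a : A \<rightarrow> A'\<guillemotright>"
  shows "push \<C> C a \<in> hom (Ext \<C> C A) (Ext \<C> C A')"
  using assms EMap_hom[of A A' C C "Ident \<C> C" a] Ident_mor unfolding push_def in_hom_iff by (auto simp: hom_def)

lemma pull_hom:
  assumes "A \<in> Obj \<C>" "\<guillemotleft>c : C' \<rightarrow> C\<guillemotright>"
  shows "pull \<C> A c \<in> hom (Ext \<C> C A) (Ext \<C> C' A)"
  using assms EMap_hom[of A A C C' c "Ident \<C> A"] Ident_mor unfolding pull_def in_hom_iff by (auto simp: hom_def)

lemma push_in: "\<lbrakk>C \<in> Obj \<C>; \<guillemotleft>a : A \<rightarrow> A'\<guillemotright>; \<delta> \<in> carrier (Ext \<C> C A)\<rbrakk> \<Longrightarrow> push \<C> C a \<delta> \<in> carrier (Ext \<C> C A')"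
  using push_hom unfolding hom_def by blast

lemma pull_in: "\<lbrakk>A \<in> Obj \<C>; \<guillemotleft>c : C' \<rightarrow> C\<guillemotright>; \<delta> \<in> carrier (Ext \<C> C A)\<rbrakk> \<Longrightarrow> pull \<C> A c \<delta> \<in> carrier (Ext \<C> C' A)"
  using pull_hom unfolding hom_def by blast

lemma push_mult:
  "\<lbrakk>C \<in> Obj \<C>; \<guillemotleft>a : A \<rightarrow> A'\<guillemotright>; \<delta> \<in> carrier (Ext \<C> C A); \<epsilon> \<in> carrier (Ext \<C> C A)\<rbrakk>
    \<Longrightarrow> push \<C> C a (\<delta> \<otimes>\<^bsub>Ext \<C> C A\<^esub> \<epsilon>) = push \<C> C a \<delta> \<otimes>\<^bsub>Ext \<C> C A'\<^esub> push \<C> C a \<epsilon>"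
  using push_hom unfolding hom_def by blast

lemma pull_mult:
  "\<lbrakk>A \<in> Obj \<C>; \<guillemotleft>c : C' \<rightarrow> C\<guillemotright>; \<delta> \<in> carrier (Ext \<C> C A); \<epsilon> \<in> carrier (Ext \<C> C A)\<rbrakk>
    \<Longrightarrow> pull \<C> A c (\<delta> \<otimes>\<^bsub>Ext \<C> C A\<^esub> \<epsilon>) = pull \<C> A c \<delta> \<otimes>\<^bsub>Ext \<C> C' A\<^esub> pull \<C> A c \<epsilon>"
  using pull_hom unfolding hom_def by blast

lemma push_one:
  assumes "C \<in> Obj \<C>" "\<guillemotleft>a : A \<rightarrow> A'\<guillemotright>"
  shows "push \<C> C a \<one>\<^bsub>Ext \<C> C A\<^esub> = \<one>\<^bsub>Ext \<C> C A'\<^esub>"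
  using push_hom[OF assms] hom_one Ext_group assms by (metis in_hom_simp)

lemma pull_one:
  assumes "A \<in> Obj \<C>" "\<guillemotleft>c : C' \<rightarrow> C\<guillemotright>"
  shows "pull \<C> A c \<one>\<^bsub>Ext \<C> C A\<^esub> = \<one>\<^bsub>Ext \<C> C' A\<^esub>"
  using pull_hom[OF assms] hom_one Ext_group assms by (metis in_hom_simp)

lemma push_ident: "\<lbrakk>C \<in> Obj \<C>; A \<in> Obj \<C>; \<delta> \<in> carrier (Ext \<C> C A)\<rbrakk> \<Longrightarrow> push \<C> C (Ident \<C> A) \<delta> = \<delta>"
  unfolding push_def using EMap_Ident by blast

lemma pull_ident: "\<lbrakk>C \<in> Obj \<C>; A \<in> Obj \<C>; \<delta> \<in> carrier (Ext \<C> C A)\<rbrakk> \<Longrightarrow> pull \<C> A (Ident \<C> C) \<delta> = \<delta>"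
  unfolding pull_def using EMap_Ident by blast

lemma push_comp:
  assumes "C \<in> Obj \<C>" "\<guillemotleft>a : A \<rightarrow> A'\<guillemotright>" "\<guillemotleft>a' : A' \<rightarrow> A''\<guillemotright>" "\<delta> \<in> carrier (Ext \<C> C A)"
  shows "push \<C> C (a' \<cdot> a) \<delta> = push \<C> C a' (push \<C> C a \<delta>)"
proof -
  have "push \<C> C (a' \<cdot> a) \<delta> = EMap \<C> (Ident \<C> C \<cdot> Ident \<C> C) (a' \<cdot> a) \<delta>"
    using assms(1) by (simp add: push_def)
  then show ?thesis
    using EMap_Comp[of A A' A'' C C C a a' "Ident \<C> C" "Ident \<C> C" \<delta>] assms Ident_mor
    unfolding push_def in_hom_iff by simp
qed

lemma pull_comp:
  assumes "A \<in> Obj \<C>" "\<guillemotleft>c : C' \<rightarrow> C\<guillemotright>" "\<guillemotleft>c' : C'' \<rightarrow> C'\<guillemotright>" "\<delta> \<in> carrier (Ext \<C> C A)"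
  shows "pull \<C> A (c \<cdot> c') \<delta> = pull \<C> A c' (pull \<C> A c \<delta>)"
proof -
  have "pull \<C> A (c \<cdot> c') \<delta> = EMap \<C> (c \<cdot> c') (Ident \<C> A \<cdot> Ident \<C> A) \<delta>"
    using assms(1) by (simp add: pull_def)
  then show ?thesis
    using EMap_Comp[of A A A C C' C'' "Ident \<C> A" "Ident \<C> A" c c' \<delta>] assms Ident_mor
    unfolding pull_def in_hom_iff by simp
qed

lemma EMap_pull_push:
  assumes "\<guillemotleft>a : A \<rightarrow> A'\<guillemotright>" "\<guillemotleft>c : C' \<rightarrow> C\<guillemotright>" "\<delta> \<in> carrier (Ext \<C> C A)"
  shows "EMap \<C> c a \<delta> = push \<C> C' a (pull \<C> A c \<delta>)"
    and "EMap \<C> c a \<delta> = pull \<C> A' c (push \<C> C a \<delta>)"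
proof -
  show "EMap \<C> c a \<delta> = push \<C> C' a (pull \<C> A c \<delta>)"
    using EMap_Comp[of A A A' C C' C' "Ident \<C> A" a c "Ident \<C> C'" \<delta>] Ident_mor assms
      comp_ident[of a A] comp_ident[of c C']
    unfolding pull_def push_def by (simp add: in_mor del: comp_ident)
  show "EMap \<C> c a \<delta> = pull \<C> A' c (push \<C> C a \<delta>)"
    using EMap_Comp[of A A' A' C C C' a "Ident \<C> A'" "Ident \<C> C" c \<delta>] Ident_mor assms
      ident_comp[of a A'] ident_comp[of c C]
    unfolding pull_def push_def by (simp add: in_mor del: ident_comp)
qed

lemma push_pull:
  assumes "\<guillemotleft>a : A \<rightarrow> A'\<guillemotright>" "\<guillemotleft>c : C' \<rightarrow> C\<guillemotright>" "\<delta> \<in> carrier (Ext \<C> C A)"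
  shows "push \<C> C' a (pull \<C> A c \<delta>) = pull \<C> A' c (push \<C> C a \<delta>)"
  using EMap_pull_push[OF assms] by simp

lemma push_null:
  assumes "C \<in> Obj \<C>" "A \<in> Obj \<C>" "A' \<in> Obj \<C>" "\<delta> \<in> carrier (Ext \<C> C A)"
  shows "push \<C> C \<zero>[A, A'] \<delta> = \<one>\<^bsub>Ext \<C> C A'\<^esub>"
proof -
  interpret group "Ext \<C> C A'" using Ext_group assms by simp
  have "push \<C> C (\<zero>[A, A'] \<otimes>\<^bsub>Hom \<C> A A'\<^esub> \<zero>[A, A']) \<delta>
      = push \<C> C \<zero>[A, A'] \<delta> \<otimes>\<^bsub>Ext \<C> C A'\<^esub> push \<C> C \<zero>[A, A'] \<delta>"
    unfolding push_def using assms by (intro EMap_add_right) (auto simp: in_mor)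
  moreover have "push \<C> C \<zero>[A, A'] \<delta> \<in> carrier (Ext \<C> C A')"
    using assms by (intro push_in) auto
  ultimately show ?thesis
    using assms by simp
qed

lemma pull_null:
  assumes "C \<in> Obj \<C>" "A \<in> Obj \<C>" "C' \<in> Obj \<C>" "\<delta> \<in> carrier (Ext \<C> C A)"
  shows "pull \<C> A \<zero>[C', C] \<delta> = \<one>\<^bsub>Ext \<C> C' A\<^esub>"
proof -
  interpret group "Ext \<C> C' A" using Ext_group assms by simp
  have "pull \<C> A (\<zero>[C', C] \<otimes>\<^bsub>Hom \<C> C' C\<^esub> \<zero>[C', C]) \<delta>
      = pull \<C> A \<zero>[C', C] \<delta> \<otimes>\<^bsub>Ext \<C> C' A\<^esub> pull \<C> A \<zero>[C', C] \<delta>"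
    unfolding pull_def using assms by (intro EMap_add_left) (auto simp: in_mor)
  moreover have "pull \<C> A \<zero>[C', C] \<delta> \<in> carrier (Ext \<C> C' A)"
    using assms by (intro pull_in) auto
  ultimately show ?thesis
    using assms by simp
qed

lemma E_triangleD:
  assumes "(A, B, C, x, y, \<delta>) \<in> E_triangles \<C>"
  shows "\<guillemotleft>x : A \<rightarrow> B\<guillemotright>" "\<guillemotleft>y : B \<rightarrow> C\<guillemotright>" "\<delta> \<in> carrier (Ext \<C> C A)"
    "A \<in> Obj \<C>" "B \<in> Obj \<C>" "C \<in> Obj \<C>"
proof -
  have *: "A \<in> Obj \<C>" "C \<in> Obj \<C>" "\<delta> \<in> carrier (Ext \<C> C A)" "(B, x, y) \<in> Rlz \<C> C A \<delta>"
    using assms unfolding E_triangles_def by auto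
  then have "(B, x, y) \<in> sequences \<C> A C"
    using Rlz_class[of A C \<delta>] unfolding quotient_def seq_equiv_def by auto
  then show "\<guillemotleft>x : A \<rightarrow> B\<guillemotright>" "\<guillemotleft>y : B \<rightarrow> C\<guillemotright>" "\<delta> \<in> carrier (Ext \<C> C A)"
    "A \<in> Obj \<C>" "B \<in> Obj \<C>" "C \<in> Obj \<C>"
    using * unfolding sequences_def by (auto simp: in_mor simp del: in_hom_simp)
qed

lemma equiv_seq_equiv:
  assumes "A \<in> Obj \<C>" "C \<in> Obj \<C>"
  shows "equiv (sequences \<C> A C) (seq_equiv \<C> A C)"
proof (rule equivI)
  have seq: "(B, x, y) \<in> sequences \<C> A C \<longleftrightarrow> B \<in> Obj \<C> \<and> \<guillemotleft>x : A \<rightarrow> B\<guillemotright> \<and> \<guillemotleft>y : B \<rightarrow> C\<guillemotright>" for B x y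
    unfolding sequences_def using assms by (auto simp: in_mor)
  show "seq_equiv \<C> A C \<subseteq> sequences \<C> A C \<times> sequences \<C> A C"
    unfolding seq_equiv_def by auto
  show "refl_on (sequences \<C> A C) (seq_equiv \<C> A C)"
  proof (rule refl_onI, clarify)
    fix B x y
    assume s: "(B, x, y) \<in> sequences \<C> A C"
    then have "Ident \<C> B \<in> isomorphisms \<C> B B" "Ident \<C> B \<cdot> x = x" "y \<cdot> Ident \<C> B = y"
      using isomorphism_ident by (auto simp: seq)
    with s show "((B, x, y), (B, x, y)) \<in> seq_equiv \<C> A C"
      unfolding seq_equiv_def by auto
  qed
  show "sym (seq_equiv \<C> A C)"
  proof (rule symI, clarify)
    fix B x y B' x' y'
    assume "((B, x, y), (B', x', y')) \<in> seq_equiv \<C> A C"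
    then obtain b where b: "b \<in> isomorphisms \<C> B B'" "b \<cdot> x = x'" "y' \<cdot> b = y"
      and s: "(B, x, y) \<in> sequences \<C> A C" "(B', x', y') \<in> sequences \<C> A C"
      unfolding seq_equiv_def by auto
    obtain c where c: "c \<in> isomorphisms \<C> B' B" "c \<cdot> b = Ident \<C> B" "b \<cdot> c = Ident \<C> B'"
      using isomorphism_inverse b s seq by metis
    have *: "\<guillemotleft>c : B' \<rightarrow> B\<guillemotright>" "\<guillemotleft>b : B \<rightarrow> B'\<guillemotright>"
      using b(1) c(1) s isomorphism_iff seq by auto
    have "c \<cdot> x' = (c \<cdot> b) \<cdot> x" "y \<cdot> c = y' \<cdot> (b \<cdot> c)"
      using * s b(2,3)[symmetric] by (simp_all add: seq del: comp_ident ident_comp)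
    then have "c \<cdot> x' = x" "y \<cdot> c = y'"
      using c s by (simp_all add: seq)
    then show "((B', x', y'), (B, x, y)) \<in> seq_equiv \<C> A C"
      unfolding seq_equiv_def using s c(1) by auto
  qed
  show "trans (seq_equiv \<C> A C)"
  proof (rule transI, clarify)
    fix B x y B' x' y' B'' x'' y''
    assume "((B, x, y), (B', x', y')) \<in> seq_equiv \<C> A C" "((B', x', y'), (B'', x'', y'')) \<in> seq_equiv \<C> A C"
    then obtain b c where b: "b \<in> isomorphisms \<C> B B'" "b \<cdot> x = x'" "y' \<cdot> b = y"
      and c: "c \<in> isomorphisms \<C> B' B''" "c \<cdot> x' = x''" "y'' \<cdot> c = y'"
      and s: "(B, x, y) \<in> sequences \<C> A C" "(B', x', y') \<in> sequences \<C> A C" "(B'', x'', y'') \<in> sequences \<C> A C"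
      unfolding seq_equiv_def by auto
    have "c \<cdot> b \<in> isomorphisms \<C> B B''"
      using isomorphism_comp b c s seq by metis
    moreover have "(c \<cdot> b) \<cdot> x = x''" "y'' \<cdot> (c \<cdot> b) = y"
    proof -
      have *: "\<guillemotleft>b : B \<rightarrow> B'\<guillemotright>" "\<guillemotleft>c : B' \<rightarrow> B''\<guillemotright>"
        using b(1) c(1) s isomorphism_iff seq by auto
      have "(c \<cdot> b) \<cdot> x = c \<cdot> (b \<cdot> x)" "y'' \<cdot> (c \<cdot> b) = (y'' \<cdot> c) \<cdot> b"
        using s * by (simp_all add: seq)
      then show "(c \<cdot> b) \<cdot> x = x''" "y'' \<cdot> (c \<cdot> b) = y"
        using b c by simp_all
    qed
    ultimately show "((B, x, y), (B'', x'', y'')) \<in> seq_equiv \<C> A C"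
      unfolding seq_equiv_def using s by auto
  qed
qed

lemma realization_exists:
  assumes "A \<in> Obj \<C>" "C \<in> Obj \<C>" "\<delta> \<in> carrier (Ext \<C> C A)"
  obtains B x y where "(A, B, C, x, y, \<delta>) \<in> E_triangles \<C>"
proof -
  obtain s where "s \<in> Rlz \<C> C A \<delta>"
    using Rlz_class[OF assms] in_quotient_imp_non_empty[OF equiv_seq_equiv[OF assms(1,2)]] by blast
  then show ?thesis
    using assms that unfolding E_triangles_def by (cases s) auto
qed

lemma realization_unique:
  assumes "(A, B, C, x, y, \<delta>) \<in> E_triangles \<C>" "(A, B', C, x', y', \<delta>) \<in> E_triangles \<C>"
  obtains b where "b \<in> isomorphisms \<C> B B'" "b \<cdot> x = x'" "y' \<cdot> b = y"
proof -
  have *: "A \<in> Obj \<C>" "C \<in> Obj \<C>" "\<delta> \<in> carrier (Ext \<C> C A)" "(B, x, y) \<in> Rlz \<C> C A \<delta>" "(B', x', y') \<in> Rlz \<C> C A \<delta>"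
    using assms unfolding E_triangles_def by auto
  have "((B, x, y), (B', x', y')) \<in> seq_equiv \<C> A C"
    using in_quotient_imp_in_rel[OF equiv_seq_equiv[OF *(1,2)] Rlz_class[OF *(1-3)]] *(4,5) by blast
  then show ?thesis
    using that unfolding seq_equiv_def by auto
qed

lemma realization_transport:
  assumes T: "(A, B, C, x, y, \<delta>) \<in> E_triangles \<C>" and b: "b \<in> isomorphisms \<C> B' B"
    and B': "B' \<in> Obj \<C>" "\<guillemotleft>x' : A \<rightarrow> B'\<guillemotright>" and y: "b \<cdot> x' = x" "y \<cdot> b = y'"
  shows "(A, B', C, x', y', \<delta>) \<in> E_triangles \<C>"
proof -
  note T' = E_triangleD[OF T]
  have "(B, x, y) \<in> Rlz \<C> C A \<delta>"
    using T unfolding E_triangles_def by auto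
  moreover have "((B', x', y'), (B, x, y)) \<in> seq_equiv \<C> A C"
  proof -
    have "\<guillemotleft>b : B' \<rightarrow> B\<guillemotright>"
      using b isomorphism_iff[OF B'(1) T'(5)] by blast
    then have "\<guillemotleft>y' : B' \<rightarrow> C\<guillemotright>"
      using T' y by auto
    then have "(B', x', y') \<in> sequences \<C> A C" "(B, x, y) \<in> sequences \<C> A C"
      using T' B' unfolding sequences_def by (auto simp: in_mor)
    then show ?thesis
      unfolding seq_equiv_def using b y by auto
  qed
  then have "((B, x, y), (B', x', y')) \<in> seq_equiv \<C> A C"
    using equiv_seq_equiv[OF T'(4,6)] by (meson equivE symE)
  ultimately have "(B', x', y') \<in> Rlz \<C> C A \<delta>"
    using in_quotient_imp_closed[OF equiv_seq_equiv[OF T'(4,6)] Rlz_class[OF T'(4,6,3)]] by blast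
  then show ?thesis
    using T' unfolding E_triangles_def by auto
qed

text \<open>
  The long exact sequences below all come from comparing a triangle with these two.
\<close>

lemma identity_triangle_left:
  assumes "zero_object \<C> Z" "A \<in> Obj \<C>"
  shows "(A, A, Z, Ident \<C> A, \<zero>[A, Z], \<one>\<^bsub>Ext \<C> Z A\<^esub>) \<in> E_triangles \<C>"
  using Rlz_zero zero_biproduct_right assms zero_objectD(1) by blast

lemma identity_triangle_right:
  assumes "zero_object \<C> Z" "A \<in> Obj \<C>"
  shows "(Z, A, A, \<zero>[Z, A], Ident \<C> A, \<one>\<^bsub>Ext \<C> A Z\<^esub>) \<in> E_triangles \<C>"
  using Rlz_zero zero_biproduct_left assms zero_objectD(1) by blast

text \<open>
  The realization axiom and the two halves of (ET3), restated for \<open>in_hom\<close> as elimination rules.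
\<close>

lemma middle_map_exists:
  assumes T: "(A, B, C, x, y, \<delta>) \<in> E_triangles \<C>" "(A', B', C', x', y', \<delta>') \<in> E_triangles \<C>"
    and ac: "\<guillemotleft>a : A \<rightarrow> A'\<guillemotright>" "\<guillemotleft>c : C \<rightarrow> C'\<guillemotright>" "push \<C> C a \<delta> = pull \<C> A' c \<delta>'"
  obtains b where "\<guillemotleft>b : B \<rightarrow> B'\<guillemotright>" "b \<cdot> x = x' \<cdot> a" "y' \<cdot> b = c \<cdot> y"
  using Rlz_morphism[OF T _ _ ac(3)] ac(1,2) E_triangleD(5)[OF T(1)] E_triangleD(5)[OF T(2)] in_hom_iff
  by metis

lemma right_map_exists:
  assumes T: "(A, B, C, x, y, \<delta>) \<in> E_triangles \<C>" "(A', B', C', x', y', \<delta>') \<in> E_triangles \<C>"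
    and ab: "\<guillemotleft>a : A \<rightarrow> A'\<guillemotright>" "\<guillemotleft>b : B \<rightarrow> B'\<guillemotright>" "b \<cdot> x = x' \<cdot> a"
  obtains c where "\<guillemotleft>c : C \<rightarrow> C'\<guillemotright>" "y' \<cdot> b = c \<cdot> y" "push \<C> C a \<delta> = pull \<C> A' c \<delta>'"
  using ET3[OF T _ _ ab(3)] ab(1,2) E_triangleD(6)[OF T(1)] E_triangleD(6)[OF T(2)] in_hom_iff
  by metis

lemma left_map_exists:
  assumes T: "(A, B, C, x, y, \<delta>) \<in> E_triangles \<C>" "(A', B', C', x', y', \<delta>') \<in> E_triangles \<C>"
    and bc: "\<guillemotleft>b : B \<rightarrow> B'\<guillemotright>" "\<guillemotleft>c : C \<rightarrow> C'\<guillemotright>" "y' \<cdot> b = c \<cdot> y"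
  obtains a where "\<guillemotleft>a : A \<rightarrow> A'\<guillemotright>" "b \<cdot> x = x' \<cdot> a" "push \<C> C a \<delta> = pull \<C> A' c \<delta>'"
  using ET3_op[OF T _ _ bc(3)] bc(1,2) E_triangleD(4)[OF T(1)] E_triangleD(4)[OF T(2)] in_hom_iff
  by metis

lemma deflation_comp_inflation:
  assumes T: "(A, B, C, x, y, \<delta>) \<in> E_triangles \<C>"
  shows "y \<cdot> x = \<zero>[A, C]"
proof -
  note T' = E_triangleD[OF T]
  obtain Z where Z: "zero_object \<C> Z" using zero_object_exists ..
  obtain c where "\<guillemotleft>c : Z \<rightarrow> C\<guillemotright>" "y \<cdot> x = c \<cdot> \<zero>[A, Z]"
    using right_map_exists[OF identity_triangle_left[OF Z T'(4)] T, of "Ident \<C> A" x] T' by auto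
  then show ?thesis
    using T' by simp
qed

lemma push_inflation:
  assumes T: "(A, B, C, x, y, \<delta>) \<in> E_triangles \<C>"
  shows "push \<C> C x \<delta> = \<one>\<^bsub>Ext \<C> C B\<^esub>"
proof -
  note T' = E_triangleD[OF T]
  obtain Z where Z: "zero_object \<C> Z" using zero_object_exists ..
  obtain c where "\<guillemotleft>c : C \<rightarrow> Z\<guillemotright>" "push \<C> C x \<delta> = pull \<C> B c \<one>\<^bsub>Ext \<C> Z B\<^esub>"
    using right_map_exists[OF T identity_triangle_left[OF Z T'(5)], of x "Ident \<C> B"] T' by auto
  then show ?thesis
    using T' pull_one by metis
qed

lemma pull_deflation:
  assumes T: "(A, B, C, x, y, \<delta>) \<in> E_triangles \<C>"
  shows "pull \<C> A y \<delta> = \<one>\<^bsub>Ext \<C> B A\<^esub>"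
proof -
  note T' = E_triangleD[OF T]
  obtain Z where Z: "zero_object \<C> Z" using zero_object_exists ..
  obtain a where "\<guillemotleft>a : Z \<rightarrow> A\<guillemotright>" "push \<C> B a \<one>\<^bsub>Ext \<C> B Z\<^esub> = pull \<C> A y \<delta>"
    using left_map_exists[OF identity_triangle_right[OF Z T'(5)] T, of "Ident \<C> B" y] T' by auto
  then show ?thesis
    using T' push_one by metis
qed

lemma factor_through_inflation:
  assumes T: "(A, B, C, x, y, \<delta>) \<in> E_triangles \<C>" and f: "\<guillemotleft>f : W \<rightarrow> B\<guillemotright>" "y \<cdot> f = \<zero>[W, C]"
  obtains k where "\<guillemotleft>k : W \<rightarrow> A\<guillemotright>" "f = x \<cdot> k"
proof -
  note T' = E_triangleD[OF T]
  obtain Z where Z: "zero_object \<C> Z" using zero_object_exists ..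
  have W: "W \<in> Obj \<C>" using f by auto
  show ?thesis
    using left_map_exists[OF identity_triangle_left[OF Z W] T, of f "\<zero>[Z, C]"] T' f W zero_objectD(1)[OF Z] that
    by auto
qed

lemma factor_through_deflation:
  assumes T: "(A, B, C, x, y, \<delta>) \<in> E_triangles \<C>" and f: "\<guillemotleft>f : B \<rightarrow> W\<guillemotright>" "f \<cdot> x = \<zero>[A, W]"
  obtains k where "\<guillemotleft>k : C \<rightarrow> W\<guillemotright>" "f = k \<cdot> y"
proof -
  note T' = E_triangleD[OF T]
  obtain Z where Z: "zero_object \<C> Z" using zero_object_exists ..
  have W: "W \<in> Obj \<C>" using f by auto
  show ?thesis
    using right_map_exists[OF T identity_triangle_right[OF Z W], of "\<zero>[A, Z]" f] T' f W zero_objectD(1)[OF Z] that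
    by auto
qed

lemma difference_through_inflation:
  assumes T: "(A, B, C, x, y, \<delta>) \<in> E_triangles \<C>" and f: "\<guillemotleft>f : W \<rightarrow> B\<guillemotright>" "\<guillemotleft>g : W \<rightarrow> B\<guillemotright>" "y \<cdot> f = y \<cdot> g"
  obtains k where "\<guillemotleft>k : W \<rightarrow> A\<guillemotright>" "f = g \<otimes>\<^bsub>Hom \<C> W B\<^esub> (x \<cdot> k)"
proof -
  note T' = E_triangleD[OF T]
  obtain d where d: "\<guillemotleft>d : W \<rightarrow> B\<guillemotright>" "f = g \<otimes>\<^bsub>Hom \<C> W B\<^esub> d"
    using difference_exists[OF f(1,2)] .
  have "y \<cdot> g = (y \<cdot> g) \<otimes>\<^bsub>Hom \<C> W C\<^esub> (y \<cdot> d)"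
    using f d T' by simp
  then have "y \<cdot> d = \<zero>[W, C]"
    using add_eq_left_iff[of "y \<cdot> g" W C "y \<cdot> d"] f d T' by simp
  then show ?thesis
    using factor_through_inflation[OF T d(1)] d(2) that by blast
qed

lemma difference_through_deflation:
  assumes T: "(A, B, C, x, y, \<delta>) \<in> E_triangles \<C>" and f: "\<guillemotleft>f : B \<rightarrow> W\<guillemotright>" "\<guillemotleft>g : B \<rightarrow> W\<guillemotright>" "f \<cdot> x = g \<cdot> x"
  obtains k where "\<guillemotleft>k : C \<rightarrow> W\<guillemotright>" "f = g \<otimes>\<^bsub>Hom \<C> B W\<^esub> (k \<cdot> y)"
proof -
  note T' = E_triangleD[OF T]
  obtain d where d: "\<guillemotleft>d : B \<rightarrow> W\<guillemotright>" "f = g \<otimes>\<^bsub>Hom \<C> B W\<^esub> d"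
    using difference_exists[OF f(1,2)] .
  have "g \<cdot> x = (g \<cdot> x) \<otimes>\<^bsub>Hom \<C> A W\<^esub> (d \<cdot> x)"
    using f d T' by simp
  then have "d \<cdot> x = \<zero>[A, W]"
    using add_eq_left_iff[of "g \<cdot> x" A W "d \<cdot> x"] f d T' by simp
  then show ?thesis
    using factor_through_deflation[OF T d(1)] d(2) that by blast
qed

lemma push_eq_one_iff:
  assumes T: "(A, B, C, x, y, \<delta>) \<in> E_triangles \<C>" and f: "\<guillemotleft>f : A \<rightarrow> W\<guillemotright>"
  shows "push \<C> C f \<delta> = \<one>\<^bsub>Ext \<C> C W\<^esub> \<longleftrightarrow> (\<exists>h. \<guillemotleft>h : B \<rightarrow> W\<guillemotright> \<and> h \<cdot> x = f)"
proof
  note T' = E_triangleD[OF T]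
  have W: "W \<in> Obj \<C>" using f by auto
  {
    obtain Z where Z: "zero_object \<C> Z" using zero_object_exists ..
    have z: "\<guillemotleft>\<zero>[C, Z] : C \<rightarrow> Z\<guillemotright>"
      using T' zero_objectD(1)[OF Z] by simp
    assume "push \<C> C f \<delta> = \<one>\<^bsub>Ext \<C> C W\<^esub>"
    then have "push \<C> C f \<delta> = pull \<C> W \<zero>[C, Z] \<one>\<^bsub>Ext \<C> Z W\<^esub>"
      using pull_one[OF W z] by simp
    then obtain b where "\<guillemotleft>b : B \<rightarrow> W\<guillemotright>" "b \<cdot> x = Ident \<C> W \<cdot> f"
      using middle_map_exists[OF T identity_triangle_left[OF Z W] f z] by metis
    moreover have "Ident \<C> W \<cdot> f = f"
      using f by simp
    ultimately show "\<exists>h. \<guillemotleft>h : B \<rightarrow> W\<guillemotright> \<and> h \<cdot> x = f"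
      by metis
  }
  {
    assume "\<exists>h. \<guillemotleft>h : B \<rightarrow> W\<guillemotright> \<and> h \<cdot> x = f"
    then obtain h where h: "\<guillemotleft>h : B \<rightarrow> W\<guillemotright>" "h \<cdot> x = f" by blast
    show "push \<C> C f \<delta> = \<one>\<^bsub>Ext \<C> C W\<^esub>"
      using push_comp[OF T'(6,1) h(1) T'(3)] push_inflation[OF T] push_one[OF T'(6) h(1)] h(2) by simp
  }
qed

lemma pull_eq_one_iff:
  assumes T: "(A, B, C, x, y, \<delta>) \<in> E_triangles \<C>" and p: "\<guillemotleft>p : W \<rightarrow> C\<guillemotright>"
  shows "pull \<C> A p \<delta> = \<one>\<^bsub>Ext \<C> W A\<^esub> \<longleftrightarrow> (\<exists>q. \<guillemotleft>q : W \<rightarrow> B\<guillemotright> \<and> y \<cdot> q = p)"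
proof
  note T' = E_triangleD[OF T]
  have W: "W \<in> Obj \<C>" using p by auto
  {
    obtain Z where Z: "zero_object \<C> Z" using zero_object_exists ..
    have z: "\<guillemotleft>\<zero>[Z, A] : Z \<rightarrow> A\<guillemotright>"
      using T' zero_objectD(1)[OF Z] by simp
    assume "pull \<C> A p \<delta> = \<one>\<^bsub>Ext \<C> W A\<^esub>"
    then have "push \<C> W \<zero>[Z, A] \<one>\<^bsub>Ext \<C> W Z\<^esub> = pull \<C> A p \<delta>"
      using push_one[OF W z] by simp
    then obtain b where "\<guillemotleft>b : W \<rightarrow> B\<guillemotright>" "y \<cdot> b = p \<cdot> Ident \<C> W"
      using middle_map_exists[OF identity_triangle_right[OF Z W] T z p] by metis
    moreover have "p \<cdot> Ident \<C> W = p"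
      using p by simp
    ultimately show "\<exists>q. \<guillemotleft>q : W \<rightarrow> B\<guillemotright> \<and> y \<cdot> q = p"
      by metis
  }
  {
    assume "\<exists>q. \<guillemotleft>q : W \<rightarrow> B\<guillemotright> \<and> y \<cdot> q = p"
    then obtain q where q: "\<guillemotleft>q : W \<rightarrow> B\<guillemotright>" "y \<cdot> q = p" by blast
    show "pull \<C> A p \<delta> = \<one>\<^bsub>Ext \<C> W A\<^esub>"
      using pull_comp[OF T'(4,2) q(1) T'(3)] pull_deflation[OF T] pull_one[OF T'(4) q(1)] q(2) by simp
  }
qed

end


section \<open>Isomorphisms, pullbacks and pushouts of E-triangles\<close>

context extriangulated_category
begin

text \<open>
  Write \<open>e = 1 - d\<close>. Then \<open>d \<cdot> x = 0\<close>, so \<open>d\<close> factors through \<open>y\<close>, and \<open>y \<cdot> d = 0\<close>. Hence \<open>d\<close> has square zero, and \<open>1 + d\<close> inverts \<open>e\<close>.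
\<close>

lemma triangle_endomorphism_iso:
  assumes T: "(A, B, C, x, y, \<delta>) \<in> E_triangles \<C>"
    and e: "\<guillemotleft>e : B \<rightarrow> B\<guillemotright>" "e \<cdot> x = x" "y \<cdot> e = y"
  shows "e \<in> isomorphisms \<C> B B"
proof -
  note T' = E_triangleD[OF T]
  obtain d where d: "\<guillemotleft>d : B \<rightarrow> B\<guillemotright>" and ed: "Ident \<C> B = e \<otimes>\<^bsub>Hom \<C> B B\<^esub> d"
    using difference_exists[of "Ident \<C> B" B B e] e T' by auto
  have "x = Ident \<C> B \<cdot> x" "y = y \<cdot> Ident \<C> B"
    using T' by simp_all
  then have "x = x \<otimes>\<^bsub>Hom \<C> A B\<^esub> (d \<cdot> x)" "y = y \<otimes>\<^bsub>Hom \<C> B C\<^esub> (y \<cdot> d)"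
    unfolding ed using d e T' by simp_all
  then have dx: "d \<cdot> x = \<zero>[A, B]" and yd: "y \<cdot> d = \<zero>[B, C]"
    using add_eq_left_iff[of x A B "d \<cdot> x"] add_eq_left_iff[of y B C "y \<cdot> d"] d T' by simp_all
  obtain h where h: "\<guillemotleft>h : C \<rightarrow> B\<guillemotright>" "d = h \<cdot> y"
    using factor_through_deflation[OF T d dx] .
  have dd: "d \<cdot> d = \<zero>[B, B]"
  proof -
    have "d \<cdot> d = h \<cdot> (y \<cdot> d)" using h T' d by simp
    then show ?thesis using yd h d by simp
  qed
  have "d = Ident \<C> B \<cdot> d" "d = d \<cdot> Ident \<C> B"
    using d by simp_all
  then have "e \<cdot> d = d" "d \<cdot> e = d"
    unfolding ed using d e dd by simp_all
  then have "(Ident \<C> B \<otimes>\<^bsub>Hom \<C> B B\<^esub> d) \<cdot> e = Ident \<C> B" "e \<cdot> (Ident \<C> B \<otimes>\<^bsub>Hom \<C> B B\<^esub> d) = Ident \<C> B"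
    using d e by (simp_all add: ed[symmetric])
  moreover have "\<guillemotleft>Ident \<C> B \<otimes>\<^bsub>Hom \<C> B B\<^esub> d : B \<rightarrow> B\<guillemotright>"
    using d by auto
  ultimately show ?thesis
    using e(1) T'(5) isomorphism_iff by metis
qed

text \<open>
  The class of E-triangles is stable under isomorphisms of the outer terms. To see this, realize the
  transported extension and map it back and forth to the given triangle. Both composites fix the outer
  maps, so by the previous lemma they are invertible, and the comparison map is an isomorphism.
\<close>

lemma E_triangle_transport:
  assumes T: "(A, B, C, x, y, \<delta>) \<in> E_triangles \<C>"
    and a: "a \<in> isomorphisms \<C> A A'" and c: "c \<in> isomorphisms \<C> C C'"
    and A': "A' \<in> Obj \<C>" and C': "C' \<in> Obj \<C>" and x': "\<guillemotleft>x' : A' \<rightarrow> B\<guillemotright>" "x' \<cdot> a = x"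
    and \<delta>': "\<delta>' \<in> carrier (Ext \<C> C' A')" "push \<C> C a \<delta> = pull \<C> A' c \<delta>'"
  shows "(A', B, C', x', c \<cdot> y, \<delta>') \<in> E_triangles \<C>"
proof -
  note T' = E_triangleD[OF T]
  obtain B'' x'' y'' where S: "(A', B'', C', x'', y'', \<delta>') \<in> E_triangles \<C>"
    using realization_exists[OF A' C' \<delta>'(1)] .
  note S' = E_triangleD[OF S]
  obtain a' where a': "\<guillemotleft>a : A \<rightarrow> A'\<guillemotright>" "\<guillemotleft>a' : A' \<rightarrow> A\<guillemotright>" "a' \<cdot> a = Ident \<C> A" "a \<cdot> a' = Ident \<C> A'"
    using a isomorphism_iff[OF T'(4) A'] by blast
  obtain c' where c': "\<guillemotleft>c : C \<rightarrow> C'\<guillemotright>" "\<guillemotleft>c' : C' \<rightarrow> C\<guillemotright>" "c' \<cdot> c = Ident \<C> C" "c \<cdot> c' = Ident \<C> C'"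
    using c isomorphism_iff[OF T'(6) C'] by blast
  have "push \<C> C' a' \<delta>' = push \<C> C' a' (pull \<C> A' (c \<cdot> c') \<delta>')"
    using pull_ident[OF C' A' \<delta>'(1)] c' by simp
  also have "\<dots> = push \<C> C' a' (pull \<C> A' c' (push \<C> C a \<delta>))"
    using pull_comp[OF A' c'(1,2) \<delta>'(1)] \<delta>'(2) by simp
  also have "\<dots> = pull \<C> A c' (push \<C> C a' (push \<C> C a \<delta>))"
    using push_pull[OF a'(2) c'(2)] push_in[OF T'(6) a'(1) T'(3)] by simp
  also have "\<dots> = pull \<C> A c' \<delta>"
    using push_comp[OF T'(6) a'(1,2) T'(3)] a'(3) push_ident T' by simp
  finally have \<delta>'_back: "push \<C> C' a' \<delta>' = pull \<C> A c' \<delta>" .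
  obtain b where b: "\<guillemotleft>b : B \<rightarrow> B''\<guillemotright>" "b \<cdot> x = x'' \<cdot> a" "y'' \<cdot> b = c \<cdot> y"
    using middle_map_exists[OF T S a'(1) c'(1) \<delta>'(2)] .
  obtain b' where b': "\<guillemotleft>b' : B'' \<rightarrow> B\<guillemotright>" "b' \<cdot> x'' = x \<cdot> a'" "y \<cdot> b' = c' \<cdot> y''"
    using middle_map_exists[OF S T a'(2) c'(2) \<delta>'_back] .
  have "(b' \<cdot> b) \<cdot> x = x"
  proof -
    have "(b' \<cdot> b) \<cdot> x = b' \<cdot> (x'' \<cdot> a)" using b b'(1) T' by simp
    also have "\<dots> = (b' \<cdot> x'') \<cdot> a" using b'(1) a' S' by simp
    also have "\<dots> = x \<cdot> (a' \<cdot> a)" unfolding b'(2) using a'(1,2) T' by simp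
    finally show ?thesis using a' T' by simp
  qed
  moreover have "y \<cdot> (b' \<cdot> b) = y"
  proof -
    have "y \<cdot> (b' \<cdot> b) = (y \<cdot> b') \<cdot> b" using b(1) b'(1) T' by simp
    also have "\<dots> = c' \<cdot> (y'' \<cdot> b)" unfolding b'(3) using b(1) c' S' by simp
    also have "\<dots> = (c' \<cdot> c) \<cdot> y" unfolding b(3) using c'(1,2) T' by simp
    finally show ?thesis using c' T' by simp
  qed
  ultimately have l: "b' \<cdot> b \<in> isomorphisms \<C> B B"
    using triangle_endomorphism_iso[OF T] b b' by simp
  have "(b \<cdot> b') \<cdot> x'' = x''"
  proof -
    have "(b \<cdot> b') \<cdot> x'' = b \<cdot> (x \<cdot> a')" using b b' S' by simp
    also have "\<dots> = (b \<cdot> x) \<cdot> a'" using b(1) a' T' by simp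
    also have "\<dots> = x'' \<cdot> (a \<cdot> a')" unfolding b(2) using a'(1,2) S' by simp
    finally show ?thesis using a' S' by simp
  qed
  moreover have "y'' \<cdot> (b \<cdot> b') = y''"
  proof -
    have "y'' \<cdot> (b \<cdot> b') = (y'' \<cdot> b) \<cdot> b'" using b(1) b'(1) S' by simp
    also have "\<dots> = c \<cdot> (y \<cdot> b')" unfolding b(3) using b'(1) c' T' by simp
    also have "\<dots> = (c \<cdot> c') \<cdot> y''" unfolding b'(3) using c'(1,2) S' by simp
    finally show ?thesis using c' S' by simp
  qed
  ultimately have r: "b \<cdot> b' \<in> isomorphisms \<C> B'' B''"
    using triangle_endomorphism_iso[OF S] b b' by simp
  have b_iso: "b \<in> isomorphisms \<C> B B''"
  proof -
    obtain u v where u: "\<guillemotleft>u : B \<rightarrow> B\<guillemotright>" "u \<cdot> (b' \<cdot> b) = Ident \<C> B"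
      and v: "\<guillemotleft>v : B'' \<rightarrow> B''\<guillemotright>" "(b \<cdot> b') \<cdot> v = Ident \<C> B''"
      using l r isomorphism_iff T'(5) S'(5) by blast
    have ub: "(u \<cdot> b') \<cdot> b = Ident \<C> B" and bv: "b \<cdot> (b' \<cdot> v) = Ident \<C> B''"
      using u v b(1) b'(1) by simp_all
    have "u \<cdot> b' = (u \<cdot> b') \<cdot> (b \<cdot> (b' \<cdot> v))"
      using bv u(1) b'(1) by simp
    also have "\<dots> = ((u \<cdot> b') \<cdot> b) \<cdot> (b' \<cdot> v)"
      using u(1) v(1) b(1) b'(1) by simp
    also have "\<dots> = b' \<cdot> v"
      unfolding ub using v(1) b'(1) by simp
    finally have "b \<cdot> (u \<cdot> b') = Ident \<C> B''"
      using bv by simp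
    then show ?thesis
      using ub b(1) u(1) b'(1) isomorphism_iff[OF T'(5) S'(5), of b] comp_in_hom by metis
  qed
  have "b \<cdot> x' = x''"
  proof -
    have "b \<cdot> x' = (b \<cdot> (x' \<cdot> a)) \<cdot> a'"
      using b(1) x'(1) a' by simp
    also have "\<dots> = (x'' \<cdot> a) \<cdot> a'"
      unfolding x'(2) b(2) ..
    also have "\<dots> = x''"
      using a' S' by simp
    finally show ?thesis .
  qed
  then show ?thesis
    using realization_transport[OF S b_iso T'(5) x'(1) _ b(3)] by simp
qed

lemma split_triangle:
  assumes "(S, i, j, p, q) \<in> biproducts \<C> A B" "A \<in> Obj \<C>" "B \<in> Obj \<C>"
  shows "(A, S, B, i, q, \<one>\<^bsub>Ext \<C> B A\<^esub>) \<in> E_triangles \<C>"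
  using Rlz_zero assms by blast

lemma split_triangle_biproduct:
  assumes T: "(A, M, C, m, e, \<one>\<^bsub>Ext \<C> C A\<^esub>) \<in> E_triangles \<C>"
  obtains j p where "(M, m, j, p, e) \<in> biproducts \<C> A C"
proof -
  note T' = E_triangleD[OF T]
  obtain S i j p q where S: "(S, i, j, p, q) \<in> biproducts \<C> A C"
    using biproduct_exists[OF T'(4,6)] by fast
  note S' = biproductD[OF S T'(4,6)]
  obtain b where b: "b \<in> isomorphisms \<C> S M" "b \<cdot> i = m" "e \<cdot> b = q"
    using realization_unique[OF split_triangle[OF S T'(4,6)] T] .
  obtain b' where b': "\<guillemotleft>b : S \<rightarrow> M\<guillemotright>" "\<guillemotleft>b' : M \<rightarrow> S\<guillemotright>" "b' \<cdot> b = Ident \<C> S" "b \<cdot> b' = Ident \<C> M"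
    using b(1) isomorphism_iff[OF S'(1) T'(5)] by blast
  have e: "q \<cdot> b' = e"
    using b'(1,2) T' b'(4) unfolding b(3)[symmetric] by simp
  have "(M, m, b \<cdot> j, p \<cdot> b', e) \<in> biproducts \<C> A C"
  proof (rule biproductI)
    have "(p \<cdot> b') \<cdot> m = p \<cdot> ((b' \<cdot> b) \<cdot> i)"
      unfolding b(2)[symmetric] using b'(1,2) S' by simp
    then show "(p \<cdot> b') \<cdot> m = Ident \<C> A"
      using b'(3) S' by simp
    have "e \<cdot> (b \<cdot> j) = (e \<cdot> b) \<cdot> j"
      using b'(1) T' S' by simp
    then show "e \<cdot> (b \<cdot> j) = Ident \<C> C"
      using b S' by simp
    show "e \<cdot> m = \<zero>[A, C]"
      using deflation_comp_inflation[OF T] .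
    have "(p \<cdot> b') \<cdot> (b \<cdot> j) = p \<cdot> ((b' \<cdot> b) \<cdot> j)"
      using b'(1,2) S' by simp
    then show "(p \<cdot> b') \<cdot> (b \<cdot> j) = \<zero>[C, A]"
      using b'(3) S' by simp
    have "(m \<cdot> (p \<cdot> b')) \<otimes>\<^bsub>Hom \<C> M M\<^esub> ((b \<cdot> j) \<cdot> e)
        = (b \<cdot> ((i \<cdot> p) \<otimes>\<^bsub>Hom \<C> S S\<^esub> (j \<cdot> q))) \<cdot> b'"
      unfolding b(2)[symmetric] e[symmetric] using b'(1,2) S'(1-5) by simp
    then show "(m \<cdot> (p \<cdot> b')) \<otimes>\<^bsub>Hom \<C> M M\<^esub> ((b \<cdot> j) \<cdot> e) = Ident \<C> M"
      unfolding S'(10) using b' by simp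
  qed (use T' S' b' in auto)
  then show ?thesis
    using that by blast
qed

text \<open>
  Apply (ET4) to the composite of the split inflation \<open>A\<^sub>1 \<rightarrow> S\<close> with \<open>S \<rightarrow> M\<close>: its cokernel is
  the middle term of a realization of \<open>q\<^sub>*\<mu>\<close>, so up to isomorphism it is \<open>B\<^sub>2\<close>.
\<close>

lemma pullback_square_half:
  assumes S: "(S, i, j, p, q) \<in> biproducts \<C> A\<^sub>1 A\<^sub>2" and A: "A\<^sub>1 \<in> Obj \<C>" "A\<^sub>2 \<in> Obj \<C>"
    and M: "(S, M, C, g, g', \<mu>) \<in> E_triangles \<C>"
    and T: "(A\<^sub>2, B\<^sub>2, C, x\<^sub>2, y\<^sub>2, push \<C> C q \<mu>) \<in> E_triangles \<C>"
  obtains h where "(A\<^sub>1, M, B\<^sub>2, g \<cdot> i, h, pull \<C> A\<^sub>1 y\<^sub>2 (push \<C> C p \<mu>)) \<in> E_triangles \<C>"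
    "y\<^sub>2 \<cdot> h = g'" "h \<cdot> g = x\<^sub>2 \<cdot> q"
proof -
  note S' = biproductD[OF S A]
  note M' = E_triangleD[OF M]
  note T' = E_triangleD[OF T]
  obtain E h' d e \<epsilon> where E: "(A\<^sub>1, M, E, g \<cdot> i, h', \<epsilon>) \<in> E_triangles \<C>"
    and F: "(A\<^sub>2, E, C, d, e, push \<C> C q \<mu>) \<in> E_triangles \<C>"
    and h': "h' \<cdot> g = d \<cdot> q" "e \<cdot> h' = g'" and \<epsilon>: "push \<C> E i \<epsilon> = pull \<C> S e \<mu>"
    using ET4[OF split_triangle[OF S A] M] by blast
  note E' = E_triangleD[OF E]
  note F' = E_triangleD[OF F]
  obtain b where b: "b \<in> isomorphisms \<C> E B\<^sub>2" "b \<cdot> d = x\<^sub>2" "y\<^sub>2 \<cdot> b = e"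
    using realization_unique[OF F T] .
  have b': "\<guillemotleft>b : E \<rightarrow> B\<^sub>2\<guillemotright>"
    using b(1) isomorphism_iff[OF E'(6) T'(5)] by blast
  have p\<mu>: "push \<C> C p \<mu> \<in> carrier (Ext \<C> C A\<^sub>1)"
    using push_in[OF M'(6) S'(4) M'(3)] .
  have "pull \<C> A\<^sub>1 b (pull \<C> A\<^sub>1 y\<^sub>2 (push \<C> C p \<mu>)) = pull \<C> A\<^sub>1 e (push \<C> C p \<mu>)"
    using pull_comp[OF A(1) T'(2) b' p\<mu>] b(3) by simp
  also have "\<dots> = push \<C> E p (pull \<C> S e \<mu>)"
    using push_pull[OF S'(4) F'(2) M'(3)] by simp
  also have "\<dots> = push \<C> E (p \<cdot> i) \<epsilon>"
    using push_comp[OF E'(6) S'(2,4) E'(3)] \<epsilon> by simp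
  finally have "pull \<C> A\<^sub>1 b (pull \<C> A\<^sub>1 y\<^sub>2 (push \<C> C p \<mu>)) = push \<C> E (Ident \<C> A\<^sub>1) \<epsilon>"
    using S' by simp
  then have "(A\<^sub>1, M, B\<^sub>2, g \<cdot> i, b \<cdot> h', pull \<C> A\<^sub>1 y\<^sub>2 (push \<C> C p \<mu>)) \<in> E_triangles \<C>"
    using E' A S' M' T' pull_in[OF A(1) T'(2) p\<mu>]
    by (intro E_triangle_transport[OF E isomorphism_ident b(1)]) auto
  moreover have "y\<^sub>2 \<cdot> (b \<cdot> h') = g'"
  proof -
    have "y\<^sub>2 \<cdot> (b \<cdot> h') = (y\<^sub>2 \<cdot> b) \<cdot> h'" using b' T' E' by simp
    then show ?thesis using b(3) h'(2) by simp
  qed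
  moreover have "(b \<cdot> h') \<cdot> g = x\<^sub>2 \<cdot> q"
  proof -
    have "(b \<cdot> h') \<cdot> g = b \<cdot> (d \<cdot> q)" using b' E' M' h'(1) by simp
    also have "\<dots> = (b \<cdot> d) \<cdot> q" using b' F' S' by simp
    finally show ?thesis using b(2) by simp
  qed
  ultimately show ?thesis
    using that by blast
qed

text \<open>
  Two triangles with the same right end have a common pullback \<open>M\<close>, in which each of them is pulled back
  along the deflation of the other. It is the middle term of the extension of \<open>C\<close> by \<open>A\<^sub>1 \<oplus> A\<^sub>2\<close> with
  components \<open>\<delta>\<^sub>1\<close> and \<open>\<delta>\<^sub>2\<close>; the two triangles then come from the two halves by symmetry.
\<close>

lemma pullback_square:
  assumes T1: "(A\<^sub>1, B\<^sub>1, C, x\<^sub>1, y\<^sub>1, \<delta>\<^sub>1) \<in> E_triangles \<C>" and T2: "(A\<^sub>2, B\<^sub>2, C, x\<^sub>2, y\<^sub>2, \<delta>\<^sub>2) \<in> E_triangles \<C>"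
  obtains M m\<^sub>1 m\<^sub>2 e\<^sub>1 e\<^sub>2 where
    "(A\<^sub>1, M, B\<^sub>2, m\<^sub>1, e\<^sub>2, pull \<C> A\<^sub>1 y\<^sub>2 \<delta>\<^sub>1) \<in> E_triangles \<C>"
    "(A\<^sub>2, M, B\<^sub>1, m\<^sub>2, e\<^sub>1, pull \<C> A\<^sub>2 y\<^sub>1 \<delta>\<^sub>2) \<in> E_triangles \<C>"
    "e\<^sub>1 \<cdot> m\<^sub>1 = x\<^sub>1" "e\<^sub>2 \<cdot> m\<^sub>2 = x\<^sub>2" "y\<^sub>1 \<cdot> e\<^sub>1 = y\<^sub>2 \<cdot> e\<^sub>2"
proof -
  note T1' = E_triangleD[OF T1] and T2' = E_triangleD[OF T2]
  obtain S i j p q where S: "(S, i, j, p, q) \<in> biproducts \<C> A\<^sub>1 A\<^sub>2"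
    using biproduct_exists[OF T1'(4) T2'(4)] by fast
  note S' = biproductD[OF S T1'(4) T2'(4)]
  note swap = biproduct_swap[OF S T1'(4) T2'(4)]
  define \<mu> where "\<mu> = push \<C> C i \<delta>\<^sub>1 \<otimes>\<^bsub>Ext \<C> C S\<^esub> push \<C> C j \<delta>\<^sub>2"
  have i\<delta>: "push \<C> C i \<delta>\<^sub>1 \<in> carrier (Ext \<C> C S)" and j\<delta>: "push \<C> C j \<delta>\<^sub>2 \<in> carrier (Ext \<C> C S)"
    using push_in T1' T2' S' by blast+
  have "push \<C> C p \<mu> = push \<C> C (p \<cdot> i) \<delta>\<^sub>1 \<otimes>\<^bsub>Ext \<C> C A\<^sub>1\<^esub> push \<C> C (p \<cdot> j) \<delta>\<^sub>2"
    unfolding \<mu>_def using push_mult[OF T1'(6) S'(4) i\<delta> j\<delta>] push_comp[OF T1'(6) S'(2,4) T1'(3)]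
      push_comp[OF T1'(6) S'(3,4) T2'(3)] by simp
  then have p\<mu>: "push \<C> C p \<mu> = \<delta>\<^sub>1"
    using S' push_ident push_null T1' T2' by simp
  have "push \<C> C q \<mu> = push \<C> C (q \<cdot> i) \<delta>\<^sub>1 \<otimes>\<^bsub>Ext \<C> C A\<^sub>2\<^esub> push \<C> C (q \<cdot> j) \<delta>\<^sub>2"
    unfolding \<mu>_def using push_mult[OF T1'(6) S'(5) i\<delta> j\<delta>] push_comp[OF T1'(6) S'(2,5) T1'(3)]
      push_comp[OF T1'(6) S'(3,5) T2'(3)] by simp
  then have q\<mu>: "push \<C> C q \<mu> = \<delta>\<^sub>2"
    using S' push_ident push_null T1' T2' by simp
  obtain M g g' where M: "(S, M, C, g, g', \<mu>) \<in> E_triangles \<C>"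
    using realization_exists[of S C \<mu>] i\<delta> j\<delta> S' T1' \<mu>_def by auto
  note M' = E_triangleD[OF M]
  obtain e\<^sub>2 where e2: "(A\<^sub>1, M, B\<^sub>2, g \<cdot> i, e\<^sub>2, pull \<C> A\<^sub>1 y\<^sub>2 \<delta>\<^sub>1) \<in> E_triangles \<C>"
    "y\<^sub>2 \<cdot> e\<^sub>2 = g'" "e\<^sub>2 \<cdot> g = x\<^sub>2 \<cdot> q"
    using pullback_square_half[OF S T1'(4) T2'(4) M] T2 unfolding p\<mu> q\<mu> by blast
  obtain e\<^sub>1 where e1: "(A\<^sub>2, M, B\<^sub>1, g \<cdot> j, e\<^sub>1, pull \<C> A\<^sub>2 y\<^sub>1 \<delta>\<^sub>2) \<in> E_triangles \<C>"
    "y\<^sub>1 \<cdot> e\<^sub>1 = g'" "e\<^sub>1 \<cdot> g = x\<^sub>1 \<cdot> p"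
    using pullback_square_half[OF swap T2'(4) T1'(4) M] T1 unfolding p\<mu> q\<mu> by blast
  have "e\<^sub>1 \<cdot> (g \<cdot> i) = (e\<^sub>1 \<cdot> g) \<cdot> i"
    using E_triangleD[OF e1(1)] M' S' by simp
  then have "e\<^sub>1 \<cdot> (g \<cdot> i) = x\<^sub>1"
    unfolding e1(3) using S' T1' by simp
  moreover have "e\<^sub>2 \<cdot> (g \<cdot> j) = (e\<^sub>2 \<cdot> g) \<cdot> j"
    using E_triangleD[OF e2(1)] M' S' by simp
  then have "e\<^sub>2 \<cdot> (g \<cdot> j) = x\<^sub>2"
    unfolding e2(3) using S' T2' by simp
  ultimately show ?thesis
    using that[OF e2(1) e1(1)] e1(2) e2(2) by simp
qed

text \<open>
  The dual of \<open>pullback_square_half\<close>, from the dual of (ET4).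
\<close>

lemma pushout_square_half:
  assumes S: "(S, i, j, p, q) \<in> biproducts \<C> C\<^sub>1 C\<^sub>2" and C: "C\<^sub>1 \<in> Obj \<C>" "C\<^sub>2 \<in> Obj \<C>"
    and N: "(A, N, S, g', g, \<mu>) \<in> E_triangles \<C>"
    and T: "(A, B\<^sub>1, C\<^sub>1, x\<^sub>1, y\<^sub>1, pull \<C> A i \<mu>) \<in> E_triangles \<C>"
  obtains h where "(B\<^sub>1, N, C\<^sub>2, h, q \<cdot> g, push \<C> C\<^sub>2 x\<^sub>1 (pull \<C> A j \<mu>)) \<in> E_triangles \<C>"
proof -
  note S' = biproductD[OF S C]
  note N' = E_triangleD[OF N]
  note T' = E_triangleD[OF T]
  obtain E h' d e \<epsilon> where E: "(E, N, C\<^sub>2, h', q \<cdot> g, \<epsilon>) \<in> E_triangles \<C>"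
    and F: "(A, E, C\<^sub>1, d, e, pull \<C> A i \<mu>) \<in> E_triangles \<C>" and \<epsilon>: "pull \<C> E q \<epsilon> = push \<C> S d \<mu>"
    using ET4_op[OF N split_triangle[OF S C]] by blast
  note E' = E_triangleD[OF E]
  note F' = E_triangleD[OF F]
  obtain b where b: "b \<in> isomorphisms \<C> E B\<^sub>1" "b \<cdot> d = x\<^sub>1" "y\<^sub>1 \<cdot> b = e"
    using realization_unique[OF F T] .
  obtain b' where b': "\<guillemotleft>b : E \<rightarrow> B\<^sub>1\<guillemotright>" "\<guillemotleft>b' : B\<^sub>1 \<rightarrow> E\<guillemotright>" "b' \<cdot> b = Ident \<C> E"
    using b(1) isomorphism_iff[OF E'(4) T'(5)] by blast
  have j\<mu>: "pull \<C> A j \<mu> \<in> carrier (Ext \<C> C\<^sub>2 A)"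
    using pull_in[OF N'(4) S'(3) N'(3)] .
  have x\<mu>: "push \<C> C\<^sub>2 x\<^sub>1 (pull \<C> A j \<mu>) \<in> carrier (Ext \<C> C\<^sub>2 B\<^sub>1)"
    using push_in[OF C(2) T'(1) j\<mu>] .
  have "push \<C> C\<^sub>2 x\<^sub>1 (pull \<C> A j \<mu>) = push \<C> C\<^sub>2 b (push \<C> C\<^sub>2 d (pull \<C> A j \<mu>))"
    using push_comp[OF C(2) F'(1) b'(1) j\<mu>] b(2) by simp
  also have "\<dots> = push \<C> C\<^sub>2 b (pull \<C> E j (push \<C> S d \<mu>))"
    using push_pull[OF F'(1) S'(3) N'(3)] by simp
  also have "\<dots> = push \<C> C\<^sub>2 b (pull \<C> E (q \<cdot> j) \<epsilon>)"
    using pull_comp[OF E'(4) S'(5,3) E'(3)] \<epsilon> by simp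
  also have "\<dots> = push \<C> C\<^sub>2 b \<epsilon>"
    using S'(7) pull_ident[OF C(2) E'(4,3)] by simp
  also have "push \<C> C\<^sub>2 x\<^sub>1 (pull \<C> A j \<mu>) = pull \<C> B\<^sub>1 (Ident \<C> C\<^sub>2) (push \<C> C\<^sub>2 x\<^sub>1 (pull \<C> A j \<mu>))"
    using pull_ident[OF C(2) T'(5) x\<mu>] by simp
  finally have *: "push \<C> C\<^sub>2 b \<epsilon> = pull \<C> B\<^sub>1 (Ident \<C> C\<^sub>2) (push \<C> C\<^sub>2 x\<^sub>1 (pull \<C> A j \<mu>))" ..
  have "(B\<^sub>1, N, C\<^sub>2, h' \<cdot> b', Ident \<C> C\<^sub>2 \<cdot> (q \<cdot> g), push \<C> C\<^sub>2 x\<^sub>1 (pull \<C> A j \<mu>)) \<in> E_triangles \<C>"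
    using E' b' * x\<mu> T' C
    by (intro E_triangle_transport[OF E b(1) isomorphism_ident]) auto
  then show ?thesis
    using that S' N' by simp
qed

text \<open>
  The dual of \<open>pullback_square\<close>, reduced to the extensions of the two new triangles.
\<close>

lemma pushout_square:
  assumes T1: "(A, B\<^sub>1, C\<^sub>1, x\<^sub>1, y\<^sub>1, \<delta>\<^sub>1) \<in> E_triangles \<C>" and T2: "(A, B\<^sub>2, C\<^sub>2, x\<^sub>2, y\<^sub>2, \<delta>\<^sub>2) \<in> E_triangles \<C>"
  obtains N n\<^sub>1 n\<^sub>2 e\<^sub>1 e\<^sub>2 where
    "(B\<^sub>1, N, C\<^sub>2, n\<^sub>1, e\<^sub>2, push \<C> C\<^sub>2 x\<^sub>1 \<delta>\<^sub>2) \<in> E_triangles \<C>"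
    "(B\<^sub>2, N, C\<^sub>1, n\<^sub>2, e\<^sub>1, push \<C> C\<^sub>1 x\<^sub>2 \<delta>\<^sub>1) \<in> E_triangles \<C>"
proof -
  note T1' = E_triangleD[OF T1] and T2' = E_triangleD[OF T2]
  obtain S i j p q where S: "(S, i, j, p, q) \<in> biproducts \<C> C\<^sub>1 C\<^sub>2"
    using biproduct_exists[OF T1'(6) T2'(6)] by fast
  note S' = biproductD[OF S T1'(6) T2'(6)]
  note swap = biproduct_swap[OF S T1'(6) T2'(6)]
  define \<mu> where "\<mu> = pull \<C> A p \<delta>\<^sub>1 \<otimes>\<^bsub>Ext \<C> S A\<^esub> pull \<C> A q \<delta>\<^sub>2"
  have p\<delta>: "pull \<C> A p \<delta>\<^sub>1 \<in> carrier (Ext \<C> S A)" and q\<delta>: "pull \<C> A q \<delta>\<^sub>2 \<in> carrier (Ext \<C> S A)"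
    using pull_in T1' T2' S' by blast+
  have "pull \<C> A i \<mu> = pull \<C> A (p \<cdot> i) \<delta>\<^sub>1 \<otimes>\<^bsub>Ext \<C> C\<^sub>1 A\<^esub> pull \<C> A (q \<cdot> i) \<delta>\<^sub>2"
    unfolding \<mu>_def using pull_mult[OF T1'(4) S'(2) p\<delta> q\<delta>] pull_comp[OF T1'(4) S'(4,2) T1'(3)]
      pull_comp[OF T1'(4) S'(5,2) T2'(3)] by simp
  then have i\<mu>: "pull \<C> A i \<mu> = \<delta>\<^sub>1"
    using S' pull_ident pull_null T1' T2' by simp
  have "pull \<C> A j \<mu> = pull \<C> A (p \<cdot> j) \<delta>\<^sub>1 \<otimes>\<^bsub>Ext \<C> C\<^sub>2 A\<^esub> pull \<C> A (q \<cdot> j) \<delta>\<^sub>2"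
    unfolding \<mu>_def using pull_mult[OF T1'(4) S'(3) p\<delta> q\<delta>] pull_comp[OF T1'(4) S'(4,3) T1'(3)]
      pull_comp[OF T1'(4) S'(5,3) T2'(3)] by simp
  then have j\<mu>: "pull \<C> A j \<mu> = \<delta>\<^sub>2"
    using S' pull_ident pull_null T1' T2' by simp
  obtain N g' g where N: "(A, N, S, g', g, \<mu>) \<in> E_triangles \<C>"
    using realization_exists[of A S \<mu>] p\<delta> q\<delta> S' T1' \<mu>_def by auto
  obtain n\<^sub>1 where "(B\<^sub>1, N, C\<^sub>2, n\<^sub>1, q \<cdot> g, push \<C> C\<^sub>2 x\<^sub>1 \<delta>\<^sub>2) \<in> E_triangles \<C>"
    using pushout_square_half[OF S T1'(6) T2'(6) N] T1 unfolding i\<mu> j\<mu> by blast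
  moreover obtain n\<^sub>2 where "(B\<^sub>2, N, C\<^sub>1, n\<^sub>2, p \<cdot> g, push \<C> C\<^sub>1 x\<^sub>2 \<delta>\<^sub>1) \<in> E_triangles \<C>"
    using pushout_square_half[OF swap T2'(6) T1'(6) N] T2 unfolding i\<mu> j\<mu> by blast
  ultimately show ?thesis
    using that by blast
qed

end


section \<open>Exactness of Hom-sequences\<close>

context additive_category
begin

lemma Hom_group: "\<lbrakk>A \<in> Obj \<C>; B \<in> Obj \<C>\<rbrakk> \<Longrightarrow> group (Hom \<C> A B)"
  using Hom_comm_group comm_group.axioms(2) by blast

lemma epi_Hom_iff:
  assumes "h \<in> hom (Hom \<C> A B) (Hom \<C> A' B')"
    and "A \<in> Obj \<C>" "B \<in> Obj \<C>" "A' \<in> Obj \<C>" "B' \<in> Obj \<C>"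
  shows "h \<in> epi (Hom \<C> A B) (Hom \<C> A' B')
    \<longleftrightarrow> (\<forall>f. \<guillemotleft>f : A' \<rightarrow> B'\<guillemotright> \<longrightarrow> (\<exists>g. \<guillemotleft>g : A \<rightarrow> B\<guillemotright> \<and> h g = f))"
proof -
  have "h ` mor \<C> A B \<subseteq> mor \<C> A' B'"
    using assms(1) unfolding hom_def by blast
  then show ?thesis
    using assms unfolding epi_def mem_Collect_eq in_hom_iff by (auto simp del: in_hom_simp) (metis imageE)
qed

lemma mon_Hom_iff:
  assumes h: "h \<in> hom (Hom \<C> A B) (Hom \<C> A' B')"
    and O: "A \<in> Obj \<C>" "B \<in> Obj \<C>" "A' \<in> Obj \<C>" "B' \<in> Obj \<C>"
  shows "h \<in> mon (Hom \<C> A B) (Hom \<C> A' B')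
    \<longleftrightarrow> (\<forall>f. \<guillemotleft>f : A \<rightarrow> B\<guillemotright> \<longrightarrow> h f = \<zero>[A', B'] \<longrightarrow> f = \<zero>[A, B])"
proof -
  interpret group_hom "Hom \<C> A B" "Hom \<C> A' B'" h
    using h O Hom_group unfolding group_hom_def group_hom_axioms_def by blast
  show ?thesis
    using h O inj_on_one_iff unfolding mon_def mem_Collect_eq in_hom_iff by blast
qed

end

context extriangulated_category
begin

text \<open>
  Exactness in the middle holds for every E-triangle by the long exact sequences, so only surjectivity
  at one end and injectivity at the other are a condition.
\<close>

lemma contravariant_exact_iff:
  assumes T: "(A, B, C, x, y, \<delta>) \<in> E_triangles \<C>" and W: "W \<in> Obj \<C>"
  shows "short_exact_sequence (Hom \<C> A W) (Hom \<C> B W) (Hom \<C> C W) (\<lambda>g. g \<cdot> x) (\<lambda>f. f \<cdot> y) \<longleftrightarrow>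
    (\<forall>f. \<guillemotleft>f : A \<rightarrow> W\<guillemotright> \<longrightarrow> (\<exists>h. \<guillemotleft>h : B \<rightarrow> W\<guillemotright> \<and> h \<cdot> x = f)) \<and>
    (\<forall>f. \<guillemotleft>f : C \<rightarrow> W\<guillemotright> \<longrightarrow> f \<cdot> y = \<zero>[B, W] \<longrightarrow> f = \<zero>[C, W])"
proof -
  note T' = E_triangleD[OF T]
  have hx: "(\<lambda>g. g \<cdot> x) \<in> hom (Hom \<C> B W) (Hom \<C> A W)" and hy: "(\<lambda>g. g \<cdot> y) \<in> hom (Hom \<C> C W) (Hom \<C> B W)"
    using Comp_hom_right T'(1,2) W unfolding in_hom_iff by blast+
  have "kernel (Hom \<C> B W) (Hom \<C> A W) (\<lambda>g. g \<cdot> x) = (\<lambda>f. f \<cdot> y) ` mor \<C> C W"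
  proof (intro equalityI subsetI)
    fix f
    assume "f \<in> kernel (Hom \<C> B W) (Hom \<C> A W) (\<lambda>g. g \<cdot> x)"
    then have "\<guillemotleft>f : B \<rightarrow> W\<guillemotright>" "f \<cdot> x = \<zero>[A, W]"
      using T' W unfolding kernel_def by (auto simp: in_mor simp del: in_hom_simp)
    then obtain k where "\<guillemotleft>k : C \<rightarrow> W\<guillemotright>" "f = k \<cdot> y"
      using factor_through_deflation[OF T] by blast
    then show "f \<in> (\<lambda>f. f \<cdot> y) ` mor \<C> C W"
      unfolding in_hom_iff by blast
  next
    fix f
    assume "f \<in> (\<lambda>f. f \<cdot> y) ` mor \<C> C W"
    then obtain k where k: "\<guillemotleft>k : C \<rightarrow> W\<guillemotright>" "f = k \<cdot> y"
      using T' W in_mor by blast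
    then have "f \<cdot> x = k \<cdot> (y \<cdot> x)" "\<guillemotleft>f : B \<rightarrow> W\<guillemotright>"
      using T' by auto
    then show "f \<in> kernel (Hom \<C> B W) (Hom \<C> A W) (\<lambda>g. g \<cdot> x)"
      using k T' deflation_comp_inflation[OF T] W unfolding kernel_def by (simp add: in_mor)
  qed
  then have "exact_seq ([Hom \<C> A W, Hom \<C> B W, Hom \<C> C W], [\<lambda>g. g \<cdot> x, \<lambda>f. f \<cdot> y])"
    using hx hy T' W Hom_group
    by (simp add: group_hom_def group_hom_axioms_def)
  then show ?thesis
    unfolding short_exact_sequence_iff
    using epi_Hom_iff[OF hx T'(5) W T'(4) W] mon_Hom_iff[OF hy T'(6) W T'(5) W] by blast
qed

lemma covariant_exact_iff:
  assumes T: "(A, B, C, x, y, \<delta>) \<in> E_triangles \<C>" and W: "W \<in> Obj \<C>"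
  shows "short_exact_sequence (Hom \<C> W C) (Hom \<C> W B) (Hom \<C> W A) (\<lambda>g. y \<cdot> g) (\<lambda>f. x \<cdot> f) \<longleftrightarrow>
    (\<forall>f. \<guillemotleft>f : W \<rightarrow> C\<guillemotright> \<longrightarrow> (\<exists>h. \<guillemotleft>h : W \<rightarrow> B\<guillemotright> \<and> y \<cdot> h = f)) \<and>
    (\<forall>f. \<guillemotleft>f : W \<rightarrow> A\<guillemotright> \<longrightarrow> x \<cdot> f = \<zero>[W, B] \<longrightarrow> f = \<zero>[W, A])"
proof -
  note T' = E_triangleD[OF T]
  have hx: "(\<lambda>g. x \<cdot> g) \<in> hom (Hom \<C> W A) (Hom \<C> W B)" and hy: "(\<lambda>g. y \<cdot> g) \<in> hom (Hom \<C> W B) (Hom \<C> W C)"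
    using Comp_hom_left T'(1,2) W unfolding in_hom_iff by blast+
  have "kernel (Hom \<C> W B) (Hom \<C> W C) (\<lambda>g. y \<cdot> g) = (\<lambda>f. x \<cdot> f) ` mor \<C> W A"
  proof (intro equalityI subsetI)
    fix f
    assume "f \<in> kernel (Hom \<C> W B) (Hom \<C> W C) (\<lambda>g. y \<cdot> g)"
    then have "\<guillemotleft>f : W \<rightarrow> B\<guillemotright>" "y \<cdot> f = \<zero>[W, C]"
      using T' W unfolding kernel_def by (auto simp: in_mor simp del: in_hom_simp)
    then obtain k where "\<guillemotleft>k : W \<rightarrow> A\<guillemotright>" "f = x \<cdot> k"
      using factor_through_inflation[OF T] by blast
    then show "f \<in> (\<lambda>f. x \<cdot> f) ` mor \<C> W A"
      unfolding in_hom_iff by blast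
  next
    fix f
    assume "f \<in> (\<lambda>f. x \<cdot> f) ` mor \<C> W A"
    then obtain k where k: "\<guillemotleft>k : W \<rightarrow> A\<guillemotright>" "f = x \<cdot> k"
      using T' W in_mor by blast
    then have "y \<cdot> f = (y \<cdot> x) \<cdot> k" "\<guillemotleft>f : W \<rightarrow> B\<guillemotright>"
      using T' by auto
    then show "f \<in> kernel (Hom \<C> W B) (Hom \<C> W C) (\<lambda>g. y \<cdot> g)"
      using k T' deflation_comp_inflation[OF T] W unfolding kernel_def by (simp add: in_mor)
  qed
  then have "exact_seq ([Hom \<C> W C, Hom \<C> W B, Hom \<C> W A], [\<lambda>g. y \<cdot> g, \<lambda>f. x \<cdot> f])"
    using hx hy T' W Hom_group
    by (simp add: group_hom_def group_hom_axioms_def)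
  then show ?thesis
    unfolding short_exact_sequence_iff
    using epi_Hom_iff[OF hy W T'(5) W T'(6)] mon_Hom_iff[OF hx W T'(4) W T'(5)] by blast
qed

end


section \<open>Relative projectives\<close>

context proper_class
begin

lemma xi_E_triangle: "(A, B, C, x, y, \<delta>) \<in> \<xi> \<Longrightarrow> (A, B, C, x, y, \<delta>) \<in> E_triangles \<C>"
  using triangles by blast

lemma projective_iff:
  "P \<in> projectives \<C> \<xi> \<longleftrightarrow> P \<in> Obj \<C> \<and> (\<forall>A B C x y \<delta>. (A, B, C, x, y, \<delta>) \<in> \<xi> \<longrightarrow>
    (\<forall>f. \<guillemotleft>f : P \<rightarrow> C\<guillemotright> \<longrightarrow> (\<exists>h. \<guillemotleft>h : P \<rightarrow> B\<guillemotright> \<and> y \<cdot> h = f)) \<and>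
    (\<forall>f. \<guillemotleft>f : P \<rightarrow> A\<guillemotright> \<longrightarrow> x \<cdot> f = \<zero>[P, B] \<longrightarrow> f = \<zero>[P, A]))"
proof (cases "P \<in> Obj \<C>")
  case True
  then have "short_exact_sequence (Hom \<C> P C) (Hom \<C> P B) (Hom \<C> P A) (\<lambda>g. y \<cdot> g) (\<lambda>f. x \<cdot> f) \<longleftrightarrow>
    (\<forall>f. \<guillemotleft>f : P \<rightarrow> C\<guillemotright> \<longrightarrow> (\<exists>h. \<guillemotleft>h : P \<rightarrow> B\<guillemotright> \<and> y \<cdot> h = f)) \<and>
    (\<forall>f. \<guillemotleft>f : P \<rightarrow> A\<guillemotright> \<longrightarrow> x \<cdot> f = \<zero>[P, B] \<longrightarrow> f = \<zero>[P, A])"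
    if "(A, B, C, x, y, \<delta>) \<in> \<xi>" for A B C x y \<delta>
    using covariant_exact_iff[OF xi_E_triangle[OF that]] by blast
  with True show ?thesis
    unfolding projectives_def mem_Collect_eq by (fastforce simp del: in_hom_simp)
qed (simp add: projectives_def)

lemma projective_Obj: "P \<in> projectives \<C> \<xi> \<Longrightarrow> P \<in> Obj \<C>"
  unfolding projectives_def by simp

lemma projective_lift:
  assumes "P \<in> projectives \<C> \<xi>" "(A, B, C, x, y, \<delta>) \<in> \<xi>" "\<guillemotleft>f : P \<rightarrow> C\<guillemotright>"
  obtains h where "\<guillemotleft>h : P \<rightarrow> B\<guillemotright>" "y \<cdot> h = f"
  using assms projective_iff[of P] by blast

lemma projective_pull:
  assumes "P \<in> projectives \<C> \<xi>" "(A, B, C, x, y, \<delta>) \<in> \<xi>" "\<guillemotleft>f : P \<rightarrow> C\<guillemotright>"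
  shows "pull \<C> A f \<delta> = \<one>\<^bsub>Ext \<C> P A\<^esub>"
  using projective_lift[OF assms] pull_eq_one_iff[OF xi_E_triangle[OF assms(2)] assms(3)] by blast

lemma zero_object_projective:
  assumes Z: "zero_object \<C> Z"
  shows "Z \<in> projectives \<C> \<xi>"
  unfolding projective_iff
proof (intro conjI allI impI)
  show "Z \<in> Obj \<C>" using zero_objectD(1)[OF Z] .
  fix A B C x y \<delta>
  assume "(A, B, C, x, y, \<delta>) \<in> \<xi>"
  note T' = E_triangleD[OF xi_E_triangle[OF this]]
  show "\<exists>h. \<guillemotleft>h : Z \<rightarrow> B\<guillemotright> \<and> y \<cdot> h = f" if "\<guillemotleft>f : Z \<rightarrow> C\<guillemotright>" for f
  proof -
    have "f = \<zero>[Z, C]" using zero_objectD(3)[OF Z] that .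
    then show ?thesis
      using T' zero_objectD(1)[OF Z] by (intro exI[of _ "\<zero>[Z, B]"]) simp
  qed
  show "f = \<zero>[Z, A]" if "\<guillemotleft>f : Z \<rightarrow> A\<guillemotright>" for f
    using zero_objectD(3)[OF Z] that .
qed

lemma biproduct_projective:
  assumes S: "(S, i, j, p, q) \<in> biproducts \<C> P Q"
    and PQ: "P \<in> projectives \<C> \<xi>" "Q \<in> projectives \<C> \<xi>"
  shows "S \<in> projectives \<C> \<xi>"
  unfolding projective_iff
proof (intro conjI allI impI)
  note S' = biproductD[OF S projective_Obj[OF PQ(1)] projective_Obj[OF PQ(2)]]
  show "S \<in> Obj \<C>" using S'(1) .
  fix A B C x y \<delta>
  assume T: "(A, B, C, x, y, \<delta>) \<in> \<xi>"
  note T' = E_triangleD[OF xi_E_triangle[OF T]]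
  show "\<exists>h. \<guillemotleft>h : S \<rightarrow> B\<guillemotright> \<and> y \<cdot> h = f" if f: "\<guillemotleft>f : S \<rightarrow> C\<guillemotright>" for f
  proof -
    obtain u where u: "\<guillemotleft>u : P \<rightarrow> B\<guillemotright>" "y \<cdot> u = f \<cdot> i"
      using projective_lift[OF PQ(1) T comp_in_hom[OF S'(2) f]] .
    obtain v where v: "\<guillemotleft>v : Q \<rightarrow> B\<guillemotright>" "y \<cdot> v = f \<cdot> j"
      using projective_lift[OF PQ(2) T comp_in_hom[OF S'(3) f]] .
    have "y \<cdot> ((u \<cdot> p) \<otimes>\<^bsub>Hom \<C> S B\<^esub> (v \<cdot> q)) = ((y \<cdot> u) \<cdot> p) \<otimes>\<^bsub>Hom \<C> S C\<^esub> ((y \<cdot> v) \<cdot> q)"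
      using u(1) v(1) S'(1-5) T' by simp
    also have "\<dots> = f \<cdot> ((i \<cdot> p) \<otimes>\<^bsub>Hom \<C> S S\<^esub> (j \<cdot> q))"
      unfolding u(2) v(2) using f S'(1-5) by simp
    also have "\<dots> = f"
      using f S' by simp
    finally show ?thesis
      using u v S' by (intro exI[of _ "(u \<cdot> p) \<otimes>\<^bsub>Hom \<C> S B\<^esub> (v \<cdot> q)"]) auto
  qed
  show "f = \<zero>[S, A]" if f: "\<guillemotleft>f : S \<rightarrow> A\<guillemotright>" "x \<cdot> f = \<zero>[S, B]" for f
  proof (rule biproduct_joint_epi[OF S projective_Obj[OF PQ(1)] projective_Obj[OF PQ(2)] f(1)])
    have "x \<cdot> (f \<cdot> i) = (x \<cdot> f) \<cdot> i" "x \<cdot> (f \<cdot> j) = (x \<cdot> f) \<cdot> j"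
      using f(1) S' T' by simp_all
    then have "x \<cdot> (f \<cdot> i) = \<zero>[P, B]" "x \<cdot> (f \<cdot> j) = \<zero>[Q, B]"
      using f S' T' by simp_all
    then show "f \<cdot> i = \<zero>[P, A]" "f \<cdot> j = \<zero>[Q, A]"
      using PQ T comp_in_hom[OF S'(2) f(1)] comp_in_hom[OF S'(3) f(1)] projective_iff by blast+
  qed
qed

end

locale projective_proper_class = proper_class +
  assumes enough_projectives: "enough_projectives \<C> \<xi>"
begin

text \<open>
  With enough projectives, saturation turns membership in \<open>\<xi>\<close> into a lifting property: if a projective
  cover \<open>p\<close> of \<open>C\<close> lifts along \<open>y\<close>, then \<open>p\<^sup>*\<delta> = 0\<close> is split and so lies in \<open>\<xi>\<close>, whence \<open>\<delta>\<close> does too.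
  Closure of \<open>\<xi>\<close> under composition of inflations and of deflations then is a diagram chase.
\<close>

lemma xi_iff_projective_lift:
  assumes T: "(A, B, C, x, y, \<delta>) \<in> E_triangles \<C>"
  shows "(A, B, C, x, y, \<delta>) \<in> \<xi> \<longleftrightarrow>
    (\<forall>P \<in> projectives \<C> \<xi>. \<forall>f. \<guillemotleft>f : P \<rightarrow> C\<guillemotright> \<longrightarrow> (\<exists>h. \<guillemotleft>h : P \<rightarrow> B\<guillemotright> \<and> y \<cdot> h = f))"
proof
  assume "(A, B, C, x, y, \<delta>) \<in> \<xi>"
  then show "\<forall>P \<in> projectives \<C> \<xi>. \<forall>f. \<guillemotleft>f : P \<rightarrow> C\<guillemotright> \<longrightarrow> (\<exists>h. \<guillemotleft>h : P \<rightarrow> B\<guillemotright> \<and> y \<cdot> h = f)"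
    using projective_lift by blast
next
  note T' = E_triangleD[OF T]
  assume lift: "\<forall>P \<in> projectives \<C> \<xi>. \<forall>f. \<guillemotleft>f : P \<rightarrow> C\<guillemotright> \<longrightarrow> (\<exists>h. \<guillemotleft>h : P \<rightarrow> B\<guillemotright> \<and> y \<cdot> h = f)"
  obtain K P a p \<gamma> where P: "(K, P, C, a, p, \<gamma>) \<in> \<xi>" "P \<in> projectives \<C> \<xi>"
    using enough_projectives T'(6) unfolding enough_projectives_def by blast
  note P' = E_triangleD[OF xi_E_triangle[OF P(1)]]
  have "\<exists>h. \<guillemotleft>h : P \<rightarrow> B\<guillemotright> \<and> y \<cdot> h = p"
    using lift P(2) P'(2) by blast
  then have one: "pull \<C> A p \<delta> = \<one>\<^bsub>Ext \<C> P A\<^esub>"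
    using pull_eq_one_iff[OF T P'(2)] by blast
  obtain M m n where "(A, M, P, m, n, pull \<C> A p \<delta>) \<in> E_triangles \<C>"
    using realization_exists[OF T'(4) P'(5) pull_in[OF T'(4) P'(2) T'(3)]] .
  then have "(A, M, P, m, n, pull \<C> A p \<delta>) \<in> \<xi>"
    using split_closed unfolding one by blast
  then show "(A, B, C, x, y, \<delta>) \<in> \<xi>"
    using saturated[OF T P(1)] by blast
qed

end


section \<open>Hom-exact triangles\<close>

locale relative_proper_class = projective_proper_class +
  fixes \<X> :: "'a set"
  assumes subcategory: "\<X> \<subseteq> Obj \<C>"
begin

abbreviation \<tau> where "\<tau> \<equiv> hom_exact_triangles \<C> \<xi> \<X>"

text \<open>
  The form in which Hom-exactness is used: maps to \<open>\<X>\<close> extend along the inflation, and the deflation can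
  be cancelled from them.
\<close>

lemma hom_exact_iff:
  "(A, B, C, x, y, \<delta>) \<in> \<tau> \<longleftrightarrow> (A, B, C, x, y, \<delta>) \<in> \<xi> \<and> (\<forall>X \<in> \<X>.
    (\<forall>f. \<guillemotleft>f : A \<rightarrow> X\<guillemotright> \<longrightarrow> (\<exists>h. \<guillemotleft>h : B \<rightarrow> X\<guillemotright> \<and> h \<cdot> x = f)) \<and>
    (\<forall>f. \<guillemotleft>f : C \<rightarrow> X\<guillemotright> \<longrightarrow> f \<cdot> y = \<zero>[B, X] \<longrightarrow> f = \<zero>[C, X]))"
proof (cases "(A, B, C, x, y, \<delta>) \<in> \<xi>")
  case True
  then show ?thesis
    unfolding hom_exact_triangles_def
    using contravariant_exact_iff[OF xi_E_triangle[OF True] subsetD[OF subcategory]]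
    by (simp del: in_hom_simp cong: ball_cong)
qed (simp add: hom_exact_triangles_def)

lemma hom_exact_xi: "(A, B, C, x, y, \<delta>) \<in> \<tau> \<Longrightarrow> (A, B, C, x, y, \<delta>) \<in> \<xi>"
  using hom_exact_iff by blast

lemma hom_exact_E_triangle: "(A, B, C, x, y, \<delta>) \<in> \<tau> \<Longrightarrow> (A, B, C, x, y, \<delta>) \<in> E_triangles \<C>"
  using hom_exact_xi xi_E_triangle by blast

lemma hom_exact_extend:
  assumes "(A, B, C, x, y, \<delta>) \<in> \<tau>" "X \<in> \<X>" "\<guillemotleft>f : A \<rightarrow> X\<guillemotright>"
  obtains h where "\<guillemotleft>h : B \<rightarrow> X\<guillemotright>" "h \<cdot> x = f"
  using assms hom_exact_iff by blast

lemma hom_exact_cancel: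
  assumes "(A, B, C, x, y, \<delta>) \<in> \<tau>" "X \<in> \<X>" "\<guillemotleft>f : C \<rightarrow> X\<guillemotright>" "f \<cdot> y = \<zero>[B, X]"
  shows "f = \<zero>[C, X]"
  using assms hom_exact_iff by blast

lemma hom_exactI:
  assumes "(A, B, C, x, y, \<delta>) \<in> \<xi>"
    and "\<And>X f. X \<in> \<X> \<Longrightarrow> \<guillemotleft>f : A \<rightarrow> X\<guillemotright> \<Longrightarrow> \<exists>h. \<guillemotleft>h : B \<rightarrow> X\<guillemotright> \<and> h \<cdot> x = f"
    and "\<And>X f. X \<in> \<X> \<Longrightarrow> \<guillemotleft>f : C \<rightarrow> X\<guillemotright> \<Longrightarrow> f \<cdot> y = \<zero>[B, X] \<Longrightarrow> f = \<zero>[C, X]"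
  shows "(A, B, C, x, y, \<delta>) \<in> \<tau>"
  using assms hom_exact_iff by blast

lemma split_hom_exact:
  assumes T: "(A, B, C, x, y, \<one>\<^bsub>Ext \<C> C A\<^esub>) \<in> E_triangles \<C>"
  shows "(A, B, C, x, y, \<one>\<^bsub>Ext \<C> C A\<^esub>) \<in> \<tau>"
proof (rule hom_exactI)
  note T' = E_triangleD[OF T]
  show "(A, B, C, x, y, \<one>\<^bsub>Ext \<C> C A\<^esub>) \<in> \<xi>"
    using split_closed[OF T] .
  show "\<exists>h. \<guillemotleft>h : B \<rightarrow> X\<guillemotright> \<and> h \<cdot> x = f" if "\<guillemotleft>f : A \<rightarrow> X\<guillemotright>" for f X
    using push_eq_one_iff[OF T that] push_one[OF T'(6) that] by blast
  have "\<exists>s. \<guillemotleft>s : C \<rightarrow> B\<guillemotright> \<and> y \<cdot> s = Ident \<C> C"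
    using pull_eq_one_iff[OF T, of "Ident \<C> C" C] pull_one[OF T'(4), of "Ident \<C> C" C C] T' by simp
  then obtain s where s: "\<guillemotleft>s : C \<rightarrow> B\<guillemotright>" "y \<cdot> s = Ident \<C> C" by blast
  show "f = \<zero>[C, X]" if f: "\<guillemotleft>f : C \<rightarrow> X\<guillemotright>" "f \<cdot> y = \<zero>[B, X]" for f X
  proof -
    have "f = f \<cdot> (y \<cdot> s)" using f s by simp
    also have "\<dots> = (f \<cdot> y) \<cdot> s" using f(1) s(1) T' by simp
    finally show ?thesis using f s by simp
  qed
qed

lemma hom_exact_sum:
  assumes T: "(A, B, C, x, y, \<delta>) \<in> \<tau>" and T2: "(A', B', C', x', y', \<delta>') \<in> \<tau>"
    and SA: "(SA, iA, jA, pA, qA) \<in> biproducts \<C> A A'"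
    and SB: "(SB, iB, jB, pB, qB) \<in> biproducts \<C> B B'"
    and SC: "(SC, iC, jC, pC, qC) \<in> biproducts \<C> C C'"
  obtains x'' y'' \<epsilon> where "(SA, SB, SC, x'', y'', \<epsilon>) \<in> \<tau>"
proof -
  note T' = E_triangleD[OF hom_exact_E_triangle[OF T]]
  note T2' = E_triangleD[OF hom_exact_E_triangle[OF T2]]
  note SA' = biproductD[OF SA T'(4) T2'(4)]
  note SB' = biproductD[OF SB T'(5) T2'(5)]
  note SC' = biproductD[OF SC T'(6) T2'(6)]
  let ?x = "(iB \<cdot> x \<cdot> pA) \<otimes>\<^bsub>Hom \<C> SA SB\<^esub> (jB \<cdot> x' \<cdot> qA)"
  let ?y = "(iC \<cdot> y \<cdot> pB) \<otimes>\<^bsub>Hom \<C> SB SC\<^esub> (jC \<cdot> y' \<cdot> qB)"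
  let ?\<epsilon> = "EMap \<C> pC iA \<delta> \<otimes>\<^bsub>Ext \<C> SC SA\<^esub> EMap \<C> qC jA \<delta>'"
  have "(SA, SB, SC, ?x, ?y, ?\<epsilon>) \<in> triangle_sums \<C> (A, B, C, x, y, \<delta>) (A', B', C', x', y', \<delta>')"
    unfolding triangle_sums_def using SA SB SC by fast
  then have sum: "(SA, SB, SC, ?x, ?y, ?\<epsilon>) \<in> \<xi>"
    using sum_closed[OF hom_exact_xi[OF T] hom_exact_xi[OF T2]] by blast
  have "(SA, SB, SC, ?x, ?y, ?\<epsilon>) \<in> \<tau>"
  proof (rule hom_exactI[OF sum])
    fix X f
    assume X: "X \<in> \<X>" and f: "\<guillemotleft>f : SA \<rightarrow> X\<guillemotright>"
    obtain h where h: "\<guillemotleft>h : B \<rightarrow> X\<guillemotright>" "h \<cdot> x = f \<cdot> iA"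
      using hom_exact_extend[OF T X comp_in_hom[OF SA'(2) f]] .
    obtain k where k: "\<guillemotleft>k : B' \<rightarrow> X\<guillemotright>" "k \<cdot> x' = f \<cdot> jA"
      using hom_exact_extend[OF T2 X comp_in_hom[OF SA'(3) f]] .
    let ?h = "(h \<cdot> pB) \<otimes>\<^bsub>Hom \<C> SB X\<^esub> (k \<cdot> qB)"
    have hin: "\<guillemotleft>?h : SB \<rightarrow> X\<guillemotright>"
      using h k SB' by auto
    \<comment> \<open>The components of \<open>?h\<close> are isolated first: expanding the product of the two sums at once
      would leave four terms.\<close>
    have "?h \<cdot> iB = (h \<cdot> (pB \<cdot> iB)) \<otimes>\<^bsub>Hom \<C> B X\<^esub> (k \<cdot> (qB \<cdot> iB))"
      using h(1) k(1) SB'(1-5) by simp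
    then have hi: "?h \<cdot> iB = h"
      using h(1) k(1) T' SB' by simp
    have "?h \<cdot> jB = (h \<cdot> (pB \<cdot> jB)) \<otimes>\<^bsub>Hom \<C> B' X\<^esub> (k \<cdot> (qB \<cdot> jB))"
      using h(1) k(1) SB'(1-5) by simp
    then have hj: "?h \<cdot> jB = k"
      using h(1) k(1) T2' SB' by simp
    have "?h \<cdot> ?x = ((?h \<cdot> iB) \<cdot> x \<cdot> pA) \<otimes>\<^bsub>Hom \<C> SA X\<^esub> ((?h \<cdot> jB) \<cdot> x' \<cdot> qA)"
      using hin SB'(1-5) SA'(1-5) T' T2' by (simp del: add_comp)
    also have "\<dots> = f \<cdot> ((iA \<cdot> pA) \<otimes>\<^bsub>Hom \<C> SA SA\<^esub> (jA \<cdot> qA))"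
      unfolding hi hj h(2) k(2) using f SA'(1-5) by simp
    also have "\<dots> = f"
      using f SA' by simp
    finally show "\<exists>h. \<guillemotleft>h : SB \<rightarrow> X\<guillemotright> \<and> h \<cdot> ?x = f"
      using hin by blast
  next
    fix X f
    assume X: "X \<in> \<X>" and f: "\<guillemotleft>f : SC \<rightarrow> X\<guillemotright>" "f \<cdot> ?y = \<zero>[SB, X]"
    have XO: "X \<in> Obj \<C>" using f by auto
    have "?y \<cdot> iB = (iC \<cdot> y \<cdot> (pB \<cdot> iB)) \<otimes>\<^bsub>Hom \<C> B SC\<^esub> (jC \<cdot> y' \<cdot> (qB \<cdot> iB))"
      using SB'(1-5) SC'(1-5) T' T2' by simp
    then have yi: "?y \<cdot> iB = iC \<cdot> y"
      using SB' SC' T' T2' by simp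
    have "(f \<cdot> iC) \<cdot> y = (f \<cdot> ?y) \<cdot> iB"
      using yi f(1) SB'(1-5) SC'(1-5) T' T2' by (simp del: comp_add add_comp)
    then have i0: "f \<cdot> iC = \<zero>[C, X]"
      using hom_exact_cancel[OF T X comp_in_hom[OF SC'(2) f(1)]] f SB' XO by simp
    have "?y \<cdot> jB = (iC \<cdot> y \<cdot> (pB \<cdot> jB)) \<otimes>\<^bsub>Hom \<C> B' SC\<^esub> (jC \<cdot> y' \<cdot> (qB \<cdot> jB))"
      using SB'(1-5) SC'(1-5) T' T2' by simp
    then have yj: "?y \<cdot> jB = jC \<cdot> y'"
      using SB' SC' T' T2' by simp
    have "(f \<cdot> jC) \<cdot> y' = (f \<cdot> ?y) \<cdot> jB"
      using yj f(1) SB'(1-5) SC'(1-5) T' T2' by (simp del: comp_add add_comp)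
    then have "f \<cdot> jC = \<zero>[C', X]"
      using hom_exact_cancel[OF T2 X comp_in_hom[OF SC'(3) f(1)]] f SB' XO by simp
    with i0 show "f = \<zero>[SC, X]"
      using biproduct_joint_epi[OF SC T'(6) T2'(6) f(1)] by blast
  qed
  then show ?thesis
    using that by blast
qed

text \<open>
  Hom-exact deflations compose, and (ET4) describes the kernel of the composite as an extension of the
  two kernels. A map on that kernel is extended in two stages: first its restriction to \<open>D\<close> to all of
  \<open>A\<close>, then the remaining difference, which factors through \<open>F\<close>, to \<open>B\<close>.
\<close>

lemma hom_exact_comp_deflations:
  assumes T1: "(D, A, B, f', f, \<delta>) \<in> \<tau>" and T2: "(F, B, C, g', g, \<delta>') \<in> \<tau>"
  obtains E h d e \<epsilon> \<kappa> where "(E, A, C, h, g \<cdot> f, \<epsilon>) \<in> \<tau>" "(D, E, F, d, e, \<kappa>) \<in> \<xi>"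
proof -
  note T1' = E_triangleD[OF hom_exact_E_triangle[OF T1]]
  note T2' = E_triangleD[OF hom_exact_E_triangle[OF T2]]
  obtain E h d e \<epsilon> where E: "(E, A, C, h, g \<cdot> f, \<epsilon>) \<in> E_triangles \<C>"
    and F: "(D, E, F, d, e, pull \<C> D g' \<delta>) \<in> E_triangles \<C>" and h: "f \<cdot> h = g' \<cdot> e" "h \<cdot> d = f'"
    using ET4_op[OF hom_exact_E_triangle[OF T1] hom_exact_E_triangle[OF T2]] by blast
  note E' = E_triangleD[OF E]
  note F' = E_triangleD[OF F]
  have "g' \<in> mor \<C> F B"
    using T2'(1) in_hom_iff by blast
  then have F\<xi>: "(D, E, F, d, e, pull \<C> D g' \<delta>) \<in> \<xi>"
    using base_change[OF hom_exact_xi[OF T1] T2'(4) _ F] by blast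
  have "\<exists>u. \<guillemotleft>u : P \<rightarrow> A\<guillemotright> \<and> (g \<cdot> f) \<cdot> u = p" if P: "P \<in> projectives \<C> \<xi>" and p: "\<guillemotleft>p : P \<rightarrow> C\<guillemotright>" for P p
  proof -
    obtain v where v: "\<guillemotleft>v : P \<rightarrow> B\<guillemotright>" "g \<cdot> v = p"
      using projective_lift[OF P hom_exact_xi[OF T2] p] .
    obtain u where u: "\<guillemotleft>u : P \<rightarrow> A\<guillemotright>" "f \<cdot> u = v"
      using projective_lift[OF P hom_exact_xi[OF T1] v(1)] .
    have "(g \<cdot> f) \<cdot> u = p"
      using u v T1' T2' by simp
    with u show ?thesis by blast
  qed
  then have E\<xi>: "(E, A, C, h, g \<cdot> f, \<epsilon>) \<in> \<xi>"
    using xi_iff_projective_lift[OF E] by blast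
  have "(E, A, C, h, g \<cdot> f, \<epsilon>) \<in> \<tau>"
  proof (rule hom_exactI[OF E\<xi>])
    fix X u
    assume X: "X \<in> \<X>" and u: "\<guillemotleft>u : E \<rightarrow> X\<guillemotright>"
    obtain v where v: "\<guillemotleft>v : A \<rightarrow> X\<guillemotright>" "v \<cdot> f' = u \<cdot> d"
      using hom_exact_extend[OF T1 X comp_in_hom[OF F'(1) u]] .
    have "u \<cdot> d = (v \<cdot> h) \<cdot> d"
      using v E' F' h(2) by simp
    then obtain k where k: "\<guillemotleft>k : F \<rightarrow> X\<guillemotright>" "u = (v \<cdot> h) \<otimes>\<^bsub>Hom \<C> E X\<^esub> (k \<cdot> e)"
      using difference_through_deflation[OF F u comp_in_hom[OF E'(1) v(1)]] by blast
    obtain w where w: "\<guillemotleft>w : B \<rightarrow> X\<guillemotright>" "w \<cdot> g' = k"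
      using hom_exact_extend[OF T2 X k(1)] .
    have "k \<cdot> e = w \<cdot> (g' \<cdot> e)"
      unfolding w(2)[symmetric] using w(1) F' T2' by simp
    also have "\<dots> = (w \<cdot> f) \<cdot> h"
      unfolding h(1)[symmetric] using w(1) T1' E' by simp
    finally have "(v \<otimes>\<^bsub>Hom \<C> A X\<^esub> (w \<cdot> f)) \<cdot> h = u"
      unfolding k(2) using v(1) w(1) T1' E' by simp
    moreover have "\<guillemotleft>v \<otimes>\<^bsub>Hom \<C> A X\<^esub> (w \<cdot> f) : A \<rightarrow> X\<guillemotright>"
      using v(1) w(1) T1' by auto
    ultimately show "\<exists>v. \<guillemotleft>v : A \<rightarrow> X\<guillemotright> \<and> v \<cdot> h = u"
      by blast
  next
    fix X u
    assume X: "X \<in> \<X>" and u: "\<guillemotleft>u : C \<rightarrow> X\<guillemotright>" "u \<cdot> (g \<cdot> f) = \<zero>[A, X]"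
    have "(u \<cdot> g) \<cdot> f = \<zero>[A, X]"
      using u T1' T2' by simp
    then have "u \<cdot> g = \<zero>[B, X]"
      using hom_exact_cancel[OF T1 X comp_in_hom[OF T2'(2) u(1)]] by blast
    then show "u = \<zero>[C, X]"
      using hom_exact_cancel[OF T2 X u(1)] by blast
  qed
  then show ?thesis
    using that F\<xi> by blast
qed

text \<open>
  The counterpart for inflations. Here the work lies in lifting a map from a projective along
  \<open>h\<close>: a lift of its image in \<open>F\<close> is correct up to a map through \<open>D\<close>, which lifts in its turn.
\<close>

lemma hom_exact_comp_inflations:
  assumes T1: "(A, B, D, f, f', \<delta>) \<in> \<tau>" and T2: "(B, C, F, g, g', \<delta>') \<in> \<tau>"
  obtains E h d e \<epsilon> \<kappa> where "(A, C, E, g \<cdot> f, h, \<epsilon>) \<in> \<tau>" "(D, E, F, d, e, \<kappa>) \<in> \<xi>"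
proof -
  note T1' = E_triangleD[OF hom_exact_E_triangle[OF T1]]
  note T2' = E_triangleD[OF hom_exact_E_triangle[OF T2]]
  obtain E h d e \<epsilon> where E: "(A, C, E, g \<cdot> f, h, \<epsilon>) \<in> E_triangles \<C>"
    and F: "(D, E, F, d, e, push \<C> F f' \<delta>') \<in> E_triangles \<C>" and h: "h \<cdot> g = d \<cdot> f'" "e \<cdot> h = g'"
    using ET4[OF hom_exact_E_triangle[OF T1] hom_exact_E_triangle[OF T2]] by blast
  note E' = E_triangleD[OF E]
  note F' = E_triangleD[OF F]
  have "f' \<in> mor \<C> B D"
    using T1'(2) in_hom_iff by blast
  then have F\<xi>: "(D, E, F, d, e, push \<C> F f' \<delta>') \<in> \<xi>"
    using cobase_change[OF hom_exact_xi[OF T2] T1'(6) _ F] by blast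
  have "\<exists>u. \<guillemotleft>u : P \<rightarrow> C\<guillemotright> \<and> h \<cdot> u = p" if P: "P \<in> projectives \<C> \<xi>" and p: "\<guillemotleft>p : P \<rightarrow> E\<guillemotright>" for P p
  proof -
    obtain c where c: "\<guillemotleft>c : P \<rightarrow> C\<guillemotright>" "g' \<cdot> c = e \<cdot> p"
      using projective_lift[OF P hom_exact_xi[OF T2] comp_in_hom[OF p F'(2)]] .
    have "e \<cdot> p = (e \<cdot> h) \<cdot> c"
      unfolding h(2) using c(2) by simp
    also have "\<dots> = e \<cdot> (h \<cdot> c)"
      using c(1) E' F' by simp
    finally obtain s where s: "\<guillemotleft>s : P \<rightarrow> D\<guillemotright>" "p = (h \<cdot> c) \<otimes>\<^bsub>Hom \<C> P E\<^esub> (d \<cdot> s)"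
      using difference_through_inflation[OF F p comp_in_hom[OF c(1) E'(2)]] by blast
    obtain t where t: "\<guillemotleft>t : P \<rightarrow> B\<guillemotright>" "f' \<cdot> t = s"
      using projective_lift[OF P hom_exact_xi[OF T1] s(1)] .
    have "d \<cdot> s = (d \<cdot> f') \<cdot> t"
      unfolding t(2)[symmetric] using t(1) F' T1' by simp
    also have "\<dots> = h \<cdot> (g \<cdot> t)"
      unfolding h(1)[symmetric] using t(1) E' T2' by simp
    finally have "h \<cdot> (c \<otimes>\<^bsub>Hom \<C> P C\<^esub> (g \<cdot> t)) = p"
      unfolding s(2) using c(1) t(1) T2' E' by simp
    moreover have "\<guillemotleft>c \<otimes>\<^bsub>Hom \<C> P C\<^esub> (g \<cdot> t) : P \<rightarrow> C\<guillemotright>"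
      using c(1) t(1) T2' by auto
    ultimately show ?thesis by blast
  qed
  then have E\<xi>: "(A, C, E, g \<cdot> f, h, \<epsilon>) \<in> \<xi>"
    using xi_iff_projective_lift[OF E] by blast
  have "(A, C, E, g \<cdot> f, h, \<epsilon>) \<in> \<tau>"
  proof (rule hom_exactI[OF E\<xi>])
    fix X u
    assume X: "X \<in> \<X>" and u: "\<guillemotleft>u : A \<rightarrow> X\<guillemotright>"
    obtain v where v: "\<guillemotleft>v : B \<rightarrow> X\<guillemotright>" "v \<cdot> f = u"
      using hom_exact_extend[OF T1 X u] .
    obtain w where w: "\<guillemotleft>w : C \<rightarrow> X\<guillemotright>" "w \<cdot> g = v"
      using hom_exact_extend[OF T2 X v(1)] .
    have "w \<cdot> (g \<cdot> f) = (w \<cdot> g) \<cdot> f"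
      using w(1) T1' T2' by simp
    then show "\<exists>w. \<guillemotleft>w : C \<rightarrow> X\<guillemotright> \<and> w \<cdot> (g \<cdot> f) = u"
      using v(2) w by auto
  next
    fix X u
    assume X: "X \<in> \<X>" and u: "\<guillemotleft>u : E \<rightarrow> X\<guillemotright>" "u \<cdot> h = \<zero>[C, X]"
    have XO: "X \<in> Obj \<C>" using u by auto
    have "(u \<cdot> d) \<cdot> f' = u \<cdot> (h \<cdot> g)"
      unfolding h(1) using u(1) F' T1' by simp
    also have "\<dots> = (u \<cdot> h) \<cdot> g"
      using u(1) E' T2' by simp
    finally have "(u \<cdot> d) \<cdot> f' = \<zero>[B, X]"
      using u(2) T2' XO by simp
    then have "u \<cdot> d = \<zero>[D, X]"
      using hom_exact_cancel[OF T1 X comp_in_hom[OF F'(1) u(1)]] by blast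
    then obtain k where k: "\<guillemotleft>k : F \<rightarrow> X\<guillemotright>" "u = k \<cdot> e"
      using factor_through_deflation[OF F u(1)] by blast
    have "k \<cdot> g' = u \<cdot> h"
      unfolding h(2)[symmetric] k(2) using k(1) E' F' by simp
    then have "k = \<zero>[F, X]"
      using hom_exact_cancel[OF T2 X k(1)] u(2) by simp
    then show "u = \<zero>[E, X]"
      using k(2) F' XO by simp
  qed
  then show ?thesis
    using that F\<xi> by blast
qed

text \<open>
  As \<open>P\<close> is projective, \<open>\<delta>\<close> is a pushout \<open>k\<^sub>*\<gamma>\<close> of the covering triangle. Since maps \<open>K \<rightarrow> X\<close> extend
  to \<open>P\<close>, every \<open>f\<^sub>*\<delta> = (f \<cdot> k)\<^sub>*\<gamma>\<close> vanishes; this is the vanishing of relative first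
  extensions of \<open>C\<close> by \<open>X\<close>. Cancellation of \<open>y\<close> follows from that of \<open>p\<close>, which factors through \<open>y\<close>.
\<close>

lemma hom_exact_of_projective_cover:
  assumes K: "(K, P, C, a, p, \<gamma>) \<in> \<tau>" and P: "P \<in> projectives \<C> \<xi>"
    and T: "(A, B, C, x, y, \<delta>) \<in> \<xi>"
  shows "(A, B, C, x, y, \<delta>) \<in> \<tau>"
proof (rule hom_exactI[OF T])
  note K' = E_triangleD[OF hom_exact_E_triangle[OF K]]
  note T' = E_triangleD[OF xi_E_triangle[OF T]]
  obtain l where l: "\<guillemotleft>l : P \<rightarrow> B\<guillemotright>" "y \<cdot> l = p"
    using projective_lift[OF P T K'(2)] .
  have "\<guillemotleft>Ident \<C> C : C \<rightarrow> C\<guillemotright>" "y \<cdot> l = Ident \<C> C \<cdot> p"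
    using l K' by simp_all
  then obtain k where k: "\<guillemotleft>k : K \<rightarrow> A\<guillemotright>" "push \<C> C k \<gamma> = pull \<C> A (Ident \<C> C) \<delta>"
    using left_map_exists[OF hom_exact_E_triangle[OF K] xi_E_triangle[OF T] l(1)] by blast
  have k\<gamma>: "push \<C> C k \<gamma> = \<delta>"
    using k(2) pull_ident T' by simp
  show "\<exists>h. \<guillemotleft>h : B \<rightarrow> X\<guillemotright> \<and> h \<cdot> x = f" if X: "X \<in> \<X>" and f: "\<guillemotleft>f : A \<rightarrow> X\<guillemotright>" for X f
  proof -
    have "\<exists>h. \<guillemotleft>h : P \<rightarrow> X\<guillemotright> \<and> h \<cdot> a = f \<cdot> k"
      using hom_exact_extend[OF K X comp_in_hom[OF k(1) f]] by blast
    then have "push \<C> C (f \<cdot> k) \<gamma> = \<one>\<^bsub>Ext \<C> C X\<^esub>"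
      using push_eq_one_iff[OF hom_exact_E_triangle[OF K] comp_in_hom[OF k(1) f]] by blast
    then have "push \<C> C f \<delta> = \<one>\<^bsub>Ext \<C> C X\<^esub>"
      using push_comp[OF K'(6) k(1) f K'(3)] k\<gamma> by simp
    then show ?thesis
      using push_eq_one_iff[OF xi_E_triangle[OF T] f] by blast
  qed
  show "f = \<zero>[C, X]" if X: "X \<in> \<X>" and f: "\<guillemotleft>f : C \<rightarrow> X\<guillemotright>" "f \<cdot> y = \<zero>[B, X]" for X f
  proof (rule hom_exact_cancel[OF K X f(1)])
    have "f \<cdot> p = (f \<cdot> y) \<cdot> l"
      unfolding l(2)[symmetric] using f(1) l(1) T' by simp
    then show "f \<cdot> p = \<zero>[P, X]"
      using f l by simp
  qed
qed

end


section \<open>Gorenstein quasi-projective objects\<close>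

context relative_proper_class
begin

text \<open>
  Pulling \<open>B \<rightarrow> C\<close> back to a projective cover of \<open>C\<close> splits it, so the pullback is \<open>A \<oplus> P\<close>, and it maps
  onto \<open>B\<close> with the kernel of the cover. In this way covers of \<open>A\<close> and \<open>C\<close> yield covers of \<open>B\<close>.
\<close>

lemma hom_exact_pullback:
  assumes T: "(A, B, C, x, y, \<delta>) \<in> \<xi>"
    and K: "(K, P, C, c, p, \<gamma>) \<in> \<tau>" and P: "P \<in> projectives \<C> \<xi>"
  obtains M i j s q m e \<epsilon> where "(M, i, j, s, q) \<in> biproducts \<C> A P" "(K, M, B, m, e, \<epsilon>) \<in> \<tau>"
proof -
  note T' = E_triangleD[OF xi_E_triangle[OF T]]
  note K' = E_triangleD[OF hom_exact_E_triangle[OF K]]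
  obtain M i m e q where A: "(A, M, P, i, q, pull \<C> A p \<delta>) \<in> E_triangles \<C>"
    and M: "(K, M, B, m, e, pull \<C> K y \<gamma>) \<in> E_triangles \<C>"
    and comm: "e \<cdot> i = x" "q \<cdot> m = c" "y \<cdot> e = p \<cdot> q"
    using pullback_square[OF xi_E_triangle[OF T] hom_exact_E_triangle[OF K]] .
  note M' = E_triangleD[OF M] and A' = E_triangleD[OF A]
  have "(A, M, P, i, q, \<one>\<^bsub>Ext \<C> P A\<^esub>) \<in> E_triangles \<C>"
    using A projective_pull[OF P T K'(2)] by simp
  then obtain j s where biprod: "(M, i, j, s, q) \<in> biproducts \<C> A P"
    using split_triangle_biproduct by blast
  note biprod' = biproductD[OF biprod T'(4) K'(5)]
  have "y \<in> mor \<C> B C"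
    using T'(2) in_hom_iff by blast
  then have M\<xi>: "(K, M, B, m, e, pull \<C> K y \<gamma>) \<in> \<xi>"
    using base_change[OF hom_exact_xi[OF K] T'(5) _ M] by blast
  have "(K, M, B, m, e, pull \<C> K y \<gamma>) \<in> \<tau>"
  proof (rule hom_exactI[OF M\<xi>])
    fix X f
    assume X: "X \<in> \<X>" and f: "\<guillemotleft>f : K \<rightarrow> X\<guillemotright>"
    obtain h where h: "\<guillemotleft>h : P \<rightarrow> X\<guillemotright>" "h \<cdot> c = f"
      using hom_exact_extend[OF K X f] .
    have "(h \<cdot> q) \<cdot> m = f"
      using h comm(2) A' M' by simp
    then show "\<exists>h. \<guillemotleft>h : M \<rightarrow> X\<guillemotright> \<and> h \<cdot> m = f"
      using comp_in_hom[OF A'(2) h(1)] by blast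
  next
    fix X u
    assume X: "X \<in> \<X>" and u: "\<guillemotleft>u : B \<rightarrow> X\<guillemotright>" "u \<cdot> e = \<zero>[M, X]"
    have XO: "X \<in> Obj \<C>" using u by auto
    have "u \<cdot> x = (u \<cdot> e) \<cdot> i"
      unfolding comm(1)[symmetric] using u(1) M' A' by simp
    then have "u \<cdot> x = \<zero>[A, X]"
      using u(2) A' XO by simp
    then obtain k where k: "\<guillemotleft>k : C \<rightarrow> X\<guillemotright>" "u = k \<cdot> y"
      using factor_through_deflation[OF xi_E_triangle[OF T] u(1)] by blast
    have "k \<cdot> p = (k \<cdot> (p \<cdot> q)) \<cdot> j"
      using k(1) K' biprod' by simp
    also have "k \<cdot> (p \<cdot> q) = u \<cdot> e"
      unfolding comm(3)[symmetric] k(2) using k(1) T' M' by simp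
    finally have "k \<cdot> p = \<zero>[P, X]"
      using u(2) biprod' XO by simp
    then have "k = \<zero>[C, X]"
      using hom_exact_cancel[OF K X k(1)] by blast
    then show "u = \<zero>[B, X]"
      using k(2) T' XO by simp
  qed
  then show ?thesis
    using that biprod by blast
qed

end

locale gorenstein_setting = projective_proper_class +
  fixes \<X> :: "'a set"
  assumes additive: "additive_subcategory \<C> \<X>"
begin

sublocale relative_proper_class
proof
  show "\<X> \<subseteq> Obj \<C>"
    using additive unfolding additive_subcategory_def by (elim conjE)
qed

abbreviation \<P> where "\<P> \<equiv> projectives_in \<C> \<xi> \<X>"

lemma projectives_in_zero:
  obtains Z where "zero_object \<C> Z" "Z \<in> \<P>"
proof -
  obtain Z where "zero_object \<C> Z" "Z \<in> \<X>"
    using additive unfolding additive_subcategory_def by blast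
  then show ?thesis
    using that zero_object_projective unfolding projectives_in_def by blast
qed

lemma projectives_in_biproduct:
  assumes "P \<in> \<P>" "Q \<in> \<P>"
  obtains S i j p q where "(S, i, j, p, q) \<in> biproducts \<C> P Q" "S \<in> \<P>"
proof -
  obtain S i j p q where "(S, i, j, p, q) \<in> biproducts \<C> P Q" "S \<in> \<X>"
    using additive assms unfolding additive_subcategory_def projectives_in_def by fast
  then show ?thesis
    using that biproduct_projective assms unfolding projectives_in_def by blast
qed

lemma GQP_cover:
  assumes "M \<in> GQP \<C> \<xi> \<X>"
  obtains K P x y \<delta> where "(K, P, M, x, y, \<delta>) \<in> \<tau>" "P \<in> \<P>" "K \<in> GQP \<C> \<xi> \<X>"
proof -
  obtain P d K g f \<delta> n where r: "complete_resolution \<C> \<xi> \<X> P d K g f \<delta>" and n: "M = K n"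
    using assms unfolding GQP_def by blast
  have "(K (n + 1), P n, K n, g n, f n, \<delta> n) \<in> \<tau>" "P n \<in> \<P>"
    using r unfolding complete_resolution_def resolution_triangles_def by auto
  moreover have "K (n + 1) \<in> GQP \<C> \<xi> \<X>"
    using r unfolding GQP_def by blast
  ultimately show ?thesis
    using that n by blast
qed

lemma GQP_envelope:
  assumes "M \<in> GQP \<C> \<xi> \<X>"
  obtains K P x y \<delta> where "(M, P, K, x, y, \<delta>) \<in> \<tau>" "P \<in> \<P>" "K \<in> GQP \<C> \<xi> \<X>"
proof -
  obtain P d K g f \<delta> n where r: "complete_resolution \<C> \<xi> \<X> P d K g f \<delta>" and n: "M = K n"
    using assms unfolding GQP_def by blast
  have "(K (n - 1 + 1), P (n - 1), K (n - 1), g (n - 1), f (n - 1), \<delta> (n - 1)) \<in> \<tau>" "P (n - 1) \<in> \<P>"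
    using r unfolding complete_resolution_def resolution_triangles_def by blast+
  moreover have "K (n - 1) \<in> GQP \<C> \<xi> \<X>"
    using r unfolding GQP_def by blast
  ultimately show ?thesis
    using that n by simp
qed

lemma GQP_Obj: "GQP \<C> \<xi> \<X> \<subseteq> Obj \<C>"
proof
  fix M
  assume "M \<in> GQP \<C> \<xi> \<X>"
  then obtain K P x y \<delta> where "(K, P, M, x, y, \<delta>) \<in> \<tau>"
    by (rule GQP_cover)
  then show "M \<in> Obj \<C>"
    by (rule E_triangleD(6)[OF hom_exact_E_triangle])
qed

lemma xi_hom_exact_of_GQP:
  assumes "(A, B, C, x, y, \<delta>) \<in> \<xi>" "C \<in> GQP \<C> \<xi> \<X>"
  shows "(A, B, C, x, y, \<delta>) \<in> \<tau>"
proof -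
  obtain K P a p \<gamma> where "(K, P, C, a, p, \<gamma>) \<in> \<tau>" "P \<in> \<P>"
    using GQP_cover[OF assms(2)] .
  then show ?thesis
    using hom_exact_of_projective_cover assms(1) unfolding projectives_in_def by blast
qed

text \<open>
  The subcategory of Gorenstein quasi-projective objects is the largest class whose members have a
  Hom-exact triangle on each side, with middle term in \<open>\<P>\<close> and the other end in the class again: splicing
  the left triangles indefinitely gives the nonnegative half of a complete resolution, and splicing the
  right ones gives the negative half.
\<close>

lemma GQP_coinduct:
  assumes cover: "\<And>M. M \<in> \<Z> \<Longrightarrow> \<exists>K P x y \<delta>. (K, P, M, x, y, \<delta>) \<in> \<tau> \<and> P \<in> \<P> \<and> K \<in> \<Z>"
    and envelope: "\<And>M. M \<in> \<Z> \<Longrightarrow> \<exists>K P x y \<delta>. (M, P, K, x, y, \<delta>) \<in> \<tau> \<and> P \<in> \<P> \<and> K \<in> \<Z>"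
  shows "\<Z> \<subseteq> GQP \<C> \<xi> \<X>"
proof
  fix M
  assume M: "M \<in> \<Z>"
  obtain LK LP Lx Ly L\<delta> where L: "\<And>N. N \<in> \<Z> \<Longrightarrow>
      (LK N, LP N, N, Lx N, Ly N, L\<delta> N) \<in> \<tau> \<and> LP N \<in> \<P> \<and> LK N \<in> \<Z>"
    using cover by metis
  obtain RK RP Rx Ry R\<delta> where R: "\<And>N. N \<in> \<Z> \<Longrightarrow>
      (N, RP N, RK N, Rx N, Ry N, R\<delta> N) \<in> \<tau> \<and> RP N \<in> \<P> \<and> RK N \<in> \<Z>"
    using envelope by metis
  define l where "l n = (LK ^^ n) M" for n
  define r where "r n = (RK ^^ n) M" for n
  have l: "l n \<in> \<Z>" for n
    by (induction n) (use L M in \<open>simp_all add: l_def\<close>)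
  have r: "r n \<in> \<Z>" for n
    by (induction n) (use R M in \<open>simp_all add: r_def\<close>)
  \<comment> \<open>Position \<open>0\<close> holds \<open>M\<close>. For negative \<open>n\<close> the triangle at \<open>n\<close> ends in \<open>K n\<close>, so it is the right
    triangle of \<open>K (n + 1)\<close>; this is why \<open>- n - 1\<close> occurs.\<close>
  define K where "K n = (if 0 \<le> n then l (nat n) else r (nat (- n)))" for n :: int
  define P where "P n = (if 0 \<le> n then LP (l (nat n)) else RP (r (nat (- n - 1))))" for n :: int
  define g where "g n = (if 0 \<le> n then Lx (l (nat n)) else Rx (r (nat (- n - 1))))" for n :: int
  define f where "f n = (if 0 \<le> n then Ly (l (nat n)) else Ry (r (nat (- n - 1))))" for n :: int
  define \<delta> where "\<delta> n = (if 0 \<le> n then L\<delta> (l (nat n)) else R\<delta> (r (nat (- n - 1))))" for n :: int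
  have tri: "(K (n + 1), P n, K n, g n, f n, \<delta> n) \<in> \<tau> \<and> P n \<in> \<P>" for n
  proof (cases "0 \<le> n")
    case True
    then have "K (n + 1) = LK (l (nat n))" "K n = l (nat n)"
      by (simp_all add: K_def l_def nat_add_distrib)
    then show ?thesis
      using True L[OF l[of "nat n"]] by (simp add: P_def g_def f_def \<delta>_def)
  next
    case False
    define k where "k = nat (- n - 1)"
    have k: "n = - 1 - int k" using False by (simp add: k_def)
    have "K (n + 1) = r k"
      by (cases k) (simp_all add: K_def k l_def r_def nat_add_distrib)
    moreover have "K n = RK (r k)"
      using False by (simp add: K_def r_def k nat_add_distrib)
    ultimately show ?thesis
      using False R[OF r[of k]] by (simp add: P_def g_def f_def \<delta>_def flip: k_def)
  qed
  note tri' = E_triangleD[OF hom_exact_E_triangle[OF conjunct1[OF tri]]]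
  define d where "d n = g (n - 1) \<cdot> f n" for n
  have g: "\<guillemotleft>g (n - 1) : K n \<rightarrow> P (n - 1)\<guillemotright>" for n
    using tri'(1)[of "n - 1"] by simp
  have d: "\<guillemotleft>d n : P n \<rightarrow> P (n - 1)\<guillemotright>" for n
    unfolding d_def using comp_in_hom[OF tri'(2) g] .
  have dd: "d n \<cdot> d (n + 1) = \<zero>[P (n + 1), P (n - 1)]" for n
  proof -
    have "d n \<cdot> d (n + 1) = g (n - 1) \<cdot> ((f n \<cdot> g n) \<cdot> f (n + 1))"
      unfolding d_def using g[of n] tri'(1)[of n] tri'(2)[of n] tri'(2)[of "n + 1"] by simp
    also have "f n \<cdot> g n = \<zero>[K (n + 1), K n]"
      using deflation_comp_inflation[OF hom_exact_E_triangle[OF conjunct1[OF tri]]] .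
    also have "g (n - 1) \<cdot> (\<dots> \<cdot> f (n + 1)) = \<zero>[P (n + 1), P (n - 1)]"
      using g[of n] tri'(2)[of "n + 1"] tri'(6)[of n] by simp
    finally show ?thesis .
  qed
  have "complex \<C> P d"
    unfolding complex_def using d dd in_hom_iff by blast
  then have "complete_resolution \<C> \<xi> \<X> P d K g f \<delta>"
    unfolding complete_resolution_def resolution_triangles_def using tri d_def by blast
  moreover have "M = K 0"
    by (simp add: K_def l_def)
  ultimately show "M \<in> GQP \<C> \<xi> \<X>"
    unfolding GQP_def by blast
qed

lemma GQP_if_cover_envelope:
  assumes "(K, P, M, x, y, \<delta>) \<in> \<tau>" "P \<in> \<P>" "K \<in> GQP \<C> \<xi> \<X>"
    and "(M, P', K', x', y', \<delta>') \<in> \<tau>" "P' \<in> \<P>" "K' \<in> GQP \<C> \<xi> \<X>"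
  shows "M \<in> GQP \<C> \<xi> \<X>"
proof -
  have "insert M (GQP \<C> \<xi> \<X>) \<subseteq> GQP \<C> \<xi> \<X>"
  proof (rule GQP_coinduct)
    fix N
    assume "N \<in> insert M (GQP \<C> \<xi> \<X>)"
    then consider "N = M" | "N \<in> GQP \<C> \<xi> \<X>" by auto
    then show "\<exists>K P x y \<delta>. (K, P, N, x, y, \<delta>) \<in> \<tau> \<and> P \<in> \<P> \<and> K \<in> insert M (GQP \<C> \<xi> \<X>)"
    proof cases
      case 1
      then show ?thesis using assms(1-3) by blast
    next
      case 2
      then show ?thesis by (rule GQP_cover) blast
    qed
    from \<open>N \<in> insert M (GQP \<C> \<xi> \<X>)\<close> consider "N = M" | "N \<in> GQP \<C> \<xi> \<X>" by blast
    then show "\<exists>K P x y \<delta>. (N, P, K, x, y, \<delta>) \<in> \<tau> \<and> P \<in> \<P> \<and> K \<in> insert M (GQP \<C> \<xi> \<X>)"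
    proof cases
      case 1
      then show ?thesis using assms(4-6) by blast
    next
      case 2
      then show ?thesis by (rule GQP_envelope) blast
    qed
  qed
  then show ?thesis by blast
qed

lemma projectives_in_GQP: "\<P> \<subseteq> GQP \<C> \<xi> \<X>"
proof (rule GQP_coinduct)
  fix M
  assume M: "M \<in> \<P>"
  obtain Z where Z: "zero_object \<C> Z" "Z \<in> \<P>"
    using projectives_in_zero .
  have MO: "M \<in> Obj \<C>"
    using M subcategory unfolding projectives_in_def by blast
  show "\<exists>K P x y \<delta>. (K, P, M, x, y, \<delta>) \<in> \<tau> \<and> P \<in> \<P> \<and> K \<in> \<P>"
    using split_hom_exact[OF identity_triangle_right[OF Z(1) MO]] M Z(2) by blast
  show "\<exists>K P x y \<delta>. (M, P, K, x, y, \<delta>) \<in> \<tau> \<and> P \<in> \<P> \<and> K \<in> \<P>"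
    using split_hom_exact[OF identity_triangle_left[OF Z(1) MO]] M Z(2) by blast
qed

text \<open>
  The half of a complete resolution to the left of \<open>K n\<close> resolves it.
\<close>

lemma GQP_resolution: "GQP \<C> \<xi> \<X> \<subseteq> res \<C> \<xi> (projectives_in \<C> \<xi> (GQP \<C> \<xi> \<X>))"
proof
  fix M
  assume "M \<in> GQP \<C> \<xi> \<X>"
  then obtain P d K g f \<delta> n where r: "complete_resolution \<C> \<xi> \<X> P d K g f \<delta>" and n: "M = K n"
    unfolding GQP_def by blast
  have tri: "(K (m + 1), P m, K m, g m, f m, \<delta> m) \<in> \<tau>" and d: "d m = g (m - 1) \<cdot> f m"
    and P: "P m \<in> \<P>" and cpx: "complex \<C> P d" for m
    using r unfolding complete_resolution_def resolution_triangles_def by blast+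
  note tri' = E_triangleD[OF hom_exact_E_triangle[OF tri]]
  define P' where "P' m = P (n + int m)" for m
  define d' where "d' m = (if m = 0 then f n else d (n + int m))" for m
  have "P' m \<in> projectives_in \<C> \<xi> (GQP \<C> \<xi> \<X>)" for m
    using P[of "n + int m"] projectives_in_GQP unfolding projectives_in_def P'_def by blast
  moreover have "augmented_complex \<C> P' d' M"
    unfolding augmented_complex_def
  proof (intro conjI allI)
    show "M \<in> Obj \<C>" using n tri'(6) by blast
    show "d' 0 \<in> mor \<C> (P' 0) M"
      using tri'(2)[of n] n in_hom_iff by (simp add: d'_def P'_def del: in_hom_simp)
    have "f n \<cdot> d (n + 1) = (f n \<cdot> g n) \<cdot> f (n + 1)"
      using d[of "n + 1"] tri'(1,2)[of n] tri'(2)[of "n + 1"] by simp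
    also have "\<dots> = \<zero>[P (n + 1), K n]"
      using deflation_comp_inflation[OF hom_exact_E_triangle[OF tri]] tri'(2)[of "n + 1"] tri'(6)[of n] by simp
    finally show "d' 0 \<cdot> d' 1 = \<zero>[P' 1, M]"
      using n by (simp add: d'_def P'_def)
    fix m
    show "P' m \<in> Obj \<C>"
      using tri'(5) P'_def by simp
    have c: "d k \<in> mor \<C> (P k) (P (k - 1))" "d k \<cdot> d (k + 1) = \<zero>[P (k + 1), P (k - 1)]" for k
      using cpx unfolding complex_def by blast+
    have "P' (Suc m) = P (n + int (Suc m))" "P' m = P (n + int (Suc m) - 1)"
      "P' (Suc (Suc m)) = P (n + int (Suc m) + 1)" "d' (Suc m) = d (n + int (Suc m))"
      "d' (Suc (Suc m)) = d (n + int (Suc m) + 1)"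
      by (simp_all add: P'_def d'_def ac_simps)
    then show "d' (Suc m) \<in> mor \<C> (P' (Suc m)) (P' m)"
      "d' (Suc m) \<cdot> d' (Suc (Suc m)) = \<zero>[P' (Suc (Suc m)), P' m]"
      using c[of "n + int (Suc m)"] by (simp_all only:)
  qed
  moreover have "augmented_resolution_triangles \<C> \<xi> P' d' M (\<lambda>m. K (n + int m)) (\<lambda>m. g (n + int m))
      (\<lambda>m. f (n + int m)) (\<lambda>m. \<delta> (n + int m))"
    unfolding augmented_resolution_triangles_def
  proof (intro conjI allI)
    fix m
    show "(K (n + int (Suc m)), P' m, K (n + int m), g (n + int m), f (n + int m), \<delta> (n + int m)) \<in> \<xi>"
      using hom_exact_xi[OF tri[of "n + int m"]] by (simp add: P'_def add_ac)
    have "n + int (Suc m) - 1 = n + int m" by simp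
    then show "d' (Suc m) = g (n + int m) \<cdot> f (n + int (Suc m))"
      using d[of "n + int (Suc m)"] unfolding d'_def by simp
  qed (simp_all add: n d'_def)
  ultimately show "M \<in> res \<C> \<xi> (projectives_in \<C> \<xi> (GQP \<C> \<xi> \<X>))"
    unfolding res_def by blast
qed

text \<open>
  By coinduction for the class of all extensions \<open>B\<close> of \<open>C\<close> by \<open>A\<close> in \<open>\<xi>\<close>. For the left triangle, cover the
  pullback \<open>A \<oplus> P\<^sub>C\<close> by \<open>P\<^sub>A \<oplus> P\<^sub>C\<close> and compose with \<open>A \<oplus> P\<^sub>C \<rightarrow> B\<close>: the kernel is an
  extension of the kernel of \<open>P\<^sub>C \<rightarrow> C\<close> by that of \<open>P\<^sub>A \<rightarrow> A\<close>. For the right triangle, the pushout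
  of \<open>B\<close> along \<open>A \<rightarrow> P\<^sub>A\<close> splits because this map extends to \<open>B\<close>, so there are
  Hom-exact inflations from \<open>B\<close> to \<open>P\<^sub>A \<oplus> C\<close> and from there to \<open>P\<^sub>A \<oplus> P\<^sub>C\<close>.
\<close>

lemma GQP_extension:
  assumes "(A, B, C, x, y, \<delta>) \<in> \<xi>" "A \<in> GQP \<C> \<xi> \<X>" "C \<in> GQP \<C> \<xi> \<X>"
  shows "B \<in> GQP \<C> \<xi> \<X>"
proof -
  define \<Z> where "\<Z> = {B. \<exists>A C x y \<delta>. (A, B, C, x, y, \<delta>) \<in> \<xi> \<and> A \<in> GQP \<C> \<xi> \<X> \<and> C \<in> GQP \<C> \<xi> \<X>}"
  have \<Z>I: "B \<in> \<Z>" if "(A, B, C, x, y, \<delta>) \<in> \<xi>" "A \<in> GQP \<C> \<xi> \<X>" "C \<in> GQP \<C> \<xi> \<X>"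
    for A B C x y \<delta>
    unfolding \<Z>_def mem_Collect_eq using that by (intro exI conjI)
  have "\<Z> \<subseteq> GQP \<C> \<xi> \<X>"
  proof (rule GQP_coinduct)
    fix B
    assume "B \<in> \<Z>"
    then obtain A C x y \<delta> where T: "(A, B, C, x, y, \<delta>) \<in> \<xi>"
      and A: "A \<in> GQP \<C> \<xi> \<X>" and C: "C \<in> GQP \<C> \<xi> \<X>"
      unfolding \<Z>_def mem_Collect_eq by (elim exE conjE)
    note T\<tau> = xi_hom_exact_of_GQP[OF T C]
    obtain Z where Z: "zero_object \<C> Z"
      using zero_object_exists ..
    {
      obtain K\<^sub>A P\<^sub>A a p \<alpha> where a: "(K\<^sub>A, P\<^sub>A, A, a, p, \<alpha>) \<in> \<tau>" "P\<^sub>A \<in> \<P>" "K\<^sub>A \<in> GQP \<C> \<xi> \<X>"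
        using GQP_cover[OF A] .
      note a' = E_triangleD[OF hom_exact_E_triangle[OF a(1)]]
      obtain K\<^sub>C P\<^sub>C c q \<gamma> where c: "(K\<^sub>C, P\<^sub>C, C, c, q, \<gamma>) \<in> \<tau>" "P\<^sub>C \<in> \<P>" "K\<^sub>C \<in> GQP \<C> \<xi> \<X>"
        using GQP_cover[OF C] .
      note c' = E_triangleD[OF hom_exact_E_triangle[OF c(1)]]
      have P\<^sub>C: "P\<^sub>C \<in> projectives \<C> \<xi>"
        using c(2) unfolding projectives_in_def by blast
      obtain M i j s t m e \<epsilon> where M: "(M, i, j, s, t) \<in> biproducts \<C> A P\<^sub>C"
        and MB: "(K\<^sub>C, M, B, m, e, \<epsilon>) \<in> \<tau>"
        using hom_exact_pullback[OF T c(1) P\<^sub>C] .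
      obtain Q iQ jQ pQ qQ where Q: "(Q, iQ, jQ, pQ, qQ) \<in> biproducts \<C> P\<^sub>A P\<^sub>C" "Q \<in> \<P>"
        using projectives_in_biproduct[OF a(2) c(2)] .
      \<comment> \<open>Add \<open>0 \<rightarrow> P\<^sub>C \<rightarrow> P\<^sub>C\<close>; the kernel remains \<open>K\<^sub>A\<close>, taken as its own biproduct with \<open>0\<close>.\<close>
      obtain u v \<kappa> where QM: "(K\<^sub>A, Q, M, u, v, \<kappa>) \<in> \<tau>"
        using hom_exact_sum[OF a(1) split_hom_exact[OF identity_triangle_right[OF Z c'(5)]]
          zero_biproduct_right[OF Z a'(4)] Q(1) M] .
      obtain E h d e' \<epsilon>' \<kappa>' where E: "(E, Q, B, h, e \<cdot> v, \<epsilon>') \<in> \<tau>" "(K\<^sub>A, E, K\<^sub>C, d, e', \<kappa>') \<in> \<xi>"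
        using hom_exact_comp_deflations[OF QM MB] .
      show "\<exists>K P x y \<delta>. (K, P, B, x, y, \<delta>) \<in> \<tau> \<and> P \<in> \<P> \<and> K \<in> \<Z>"
        by (intro exI conjI) (fact E(1) Q(2) \<Z>I[OF E(2) a(3) c(3)])+
    }
    {
      obtain A' P\<^sub>A a p \<alpha> where a: "(A, P\<^sub>A, A', a, p, \<alpha>) \<in> \<tau>" "P\<^sub>A \<in> \<P>" "A' \<in> GQP \<C> \<xi> \<X>"
        using GQP_envelope[OF A] .
      note a' = E_triangleD[OF hom_exact_E_triangle[OF a(1)]]
      obtain C' P\<^sub>C c q \<gamma> where c: "(C, P\<^sub>C, C', c, q, \<gamma>) \<in> \<tau>" "P\<^sub>C \<in> \<P>" "C' \<in> GQP \<C> \<xi> \<X>"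
        using GQP_envelope[OF C] .
      note c' = E_triangleD[OF hom_exact_E_triangle[OF c(1)]]
      obtain N n e n' e' where BN: "(B, N, A', n, e, push \<C> A' x \<alpha>) \<in> E_triangles \<C>"
        and NC: "(P\<^sub>A, N, C, n', e', push \<C> C a \<delta>) \<in> E_triangles \<C>"
        using pushout_square[OF xi_E_triangle[OF T] hom_exact_E_triangle[OF a(1)]] .
      have x: "B \<in> Obj \<C>" "x \<in> mor \<C> A B"
        using E_triangleD(1)[OF xi_E_triangle[OF T]] in_hom_iff by blast+
      have BN\<tau>: "(B, N, A', n, e, push \<C> A' x \<alpha>) \<in> \<tau>"
        using xi_hom_exact_of_GQP[OF cobase_change[OF hom_exact_xi[OF a(1)] x BN] a(3)] .
      have P\<^sub>A: "P\<^sub>A \<in> \<X>"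
        using a(2) unfolding projectives_in_def by blast
      obtain h where "\<guillemotleft>h : B \<rightarrow> P\<^sub>A\<guillemotright>" "h \<cdot> x = a"
        using hom_exact_extend[OF T\<tau> P\<^sub>A a'(1)] .
      then have "push \<C> C a \<delta> = \<one>\<^bsub>Ext \<C> C P\<^sub>A\<^esub>"
        using push_eq_one_iff[OF xi_E_triangle[OF T] a'(1)] by blast
      with NC have "(P\<^sub>A, N, C, n', e', \<one>\<^bsub>Ext \<C> C P\<^sub>A\<^esub>) \<in> E_triangles \<C>"
        by simp
      then obtain j s where N: "(N, n', j, s, e') \<in> biproducts \<C> P\<^sub>A C"
        by (rule split_triangle_biproduct)
      obtain Q iQ jQ pQ qQ where Q: "(Q, iQ, jQ, pQ, qQ) \<in> biproducts \<C> P\<^sub>A P\<^sub>C" "Q \<in> \<P>"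
        using projectives_in_biproduct[OF a(2) c(2)] .
      \<comment> \<open>Add \<open>P\<^sub>A \<rightarrow> P\<^sub>A \<rightarrow> 0\<close>; the cokernel remains \<open>C'\<close>.\<close>
      obtain u v \<kappa> where NQ: "(N, Q, C', u, v, \<kappa>) \<in> \<tau>"
        using hom_exact_sum[OF split_hom_exact[OF identity_triangle_left[OF Z a'(5)]] c(1)
          N Q(1) zero_biproduct_left[OF Z c'(6)]] .
      obtain E h d e'' \<epsilon> \<kappa>' where E: "(B, Q, E, u \<cdot> n, h, \<epsilon>) \<in> \<tau>" "(A', E, C', d, e'', \<kappa>') \<in> \<xi>"
        using hom_exact_comp_inflations[OF BN\<tau> NQ] .
      show "\<exists>K P x y \<delta>. (B, P, K, x, y, \<delta>) \<in> \<tau> \<and> P \<in> \<P> \<and> K \<in> \<Z>"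
        by (intro exI conjI) (fact E(1) Q(2) \<Z>I[OF E(2) a(3) c(3)])+
    }
  qed
  then show ?thesis
    using \<Z>I[OF assms] by (rule subsetD)
qed

text \<open>
  Closure under extensions makes this direct, without coinduction. On the right, compose \<open>A \<rightarrow> B\<close> with a
  Hom-exact inflation \<open>B \<rightarrow> P\<close>; the cokernel is an extension of Gorenstein quasi-projective objects. On the
  left, \<open>A \<oplus> P\<^sub>C\<close> is an extension of \<open>B\<close> by the kernel of \<open>P\<^sub>C \<rightarrow> C\<close>, so it has a cover \<open>Q\<close>;
  composed with the projection to \<open>A\<close> this covers \<open>A\<close>, with kernel an extension of \<open>P\<^sub>C\<close> by the kernel of
  the cover \<open>Q\<close>.
\<close>

lemma GQP_cocone:
  assumes T: "(A, B, C, x, y, \<delta>) \<in> \<xi>" and B: "B \<in> GQP \<C> \<xi> \<X>" and C: "C \<in> GQP \<C> \<xi> \<X>"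
  shows "A \<in> GQP \<C> \<xi> \<X>"
proof -
  note T' = E_triangleD[OF xi_E_triangle[OF T]]
  obtain B' P b p \<beta> where b: "(B, P, B', b, p, \<beta>) \<in> \<tau>" "P \<in> \<P>" "B' \<in> GQP \<C> \<xi> \<X>"
    using GQP_envelope[OF B] .
  obtain E h d e \<epsilon> \<kappa> where E: "(A, P, E, b \<cdot> x, h, \<epsilon>) \<in> \<tau>" "(C, E, B', d, e, \<kappa>) \<in> \<xi>"
    using hom_exact_comp_inflations[OF xi_hom_exact_of_GQP[OF T C] b(1)] .
  have E_GQP: "E \<in> GQP \<C> \<xi> \<X>"
    using GQP_extension[OF E(2) C b(3)] .
  obtain K\<^sub>C P\<^sub>C c q \<gamma> where c: "(K\<^sub>C, P\<^sub>C, C, c, q, \<gamma>) \<in> \<tau>" "P\<^sub>C \<in> \<P>" "K\<^sub>C \<in> GQP \<C> \<xi> \<X>"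
    using GQP_cover[OF C] .
  have P\<^sub>C: "P\<^sub>C \<in> projectives \<C> \<xi>" "P\<^sub>C \<in> Obj \<C>"
    using c(2) projective_Obj[of P\<^sub>C] unfolding projectives_in_def by simp_all
  obtain M i j s t m e' \<epsilon>' where M: "(M, i, j, s, t) \<in> biproducts \<C> A P\<^sub>C"
    and MB: "(K\<^sub>C, M, B, m, e', \<epsilon>') \<in> \<tau>"
    using hom_exact_pullback[OF T c(1) P\<^sub>C(1)] .
  have "M \<in> GQP \<C> \<xi> \<X>"
    using GQP_extension[OF hom_exact_xi[OF MB] c(3) B] .
  then obtain K Q k k' \<kappa>' where Q: "(K, Q, M, k, k', \<kappa>') \<in> \<tau>" "Q \<in> \<P>" "K \<in> GQP \<C> \<xi> \<X>"
    by (rule GQP_cover)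
  have MA: "(P\<^sub>C, M, A, j, s, \<one>\<^bsub>Ext \<C> A P\<^sub>C\<^esub>) \<in> \<tau>"
    using split_hom_exact[OF split_triangle[OF biproduct_swap[OF M T'(4) P\<^sub>C(2)] P\<^sub>C(2) T'(4)]] .
  obtain F h' d' f \<phi> \<kappa>'' where F: "(F, Q, A, h', s \<cdot> k', \<phi>) \<in> \<tau>" "(K, F, P\<^sub>C, d', f, \<kappa>'') \<in> \<xi>"
    using hom_exact_comp_deflations[OF Q(1) MA] .
  have "F \<in> GQP \<C> \<xi> \<X>"
    by (rule GQP_extension[OF F(2) Q(3) subsetD[OF projectives_in_GQP c(2)]])
  then show ?thesis
    by (rule GQP_if_cover_envelope[OF F(1) Q(2) _ E(1) b(2) E_GQP])
qed

text \<open>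
  A biproduct is the middle term of a split triangle, so this is a case of closure under extensions.
\<close>

lemma GQP_additive: "additive_subcategory \<C> (GQP \<C> \<xi> \<X>)"
  unfolding additive_subcategory_def
proof (intro conjI ballI)
  show "GQP \<C> \<xi> \<X> \<subseteq> Obj \<C>"
    using GQP_Obj .
  show "\<exists>Z \<in> GQP \<C> \<xi> \<X>. zero_object \<C> Z"
    by (rule projectives_in_zero) (use projectives_in_GQP in blast)
  fix A B
  assume AB: "A \<in> GQP \<C> \<xi> \<X>" "B \<in> GQP \<C> \<xi> \<X>"
  then have O: "A \<in> Obj \<C>" "B \<in> Obj \<C>"
    using GQP_Obj by blast+
  obtain S i j p q where S: "(S, i, j, p, q) \<in> biproducts \<C> A B"
    using biproduct_exists[OF O] by fast
  have "S \<in> GQP \<C> \<xi> \<X>"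
    using GQP_extension[OF split_closed[OF split_triangle[OF S O]] AB] .
  then show "\<exists>(S, i, j, p, q) \<in> biproducts \<C> A B. S \<in> GQP \<C> \<xi> \<X>"
    by (intro bexI[OF _ S]) simp
qed

end

theorem theorem5p9:
  fixes \<C> :: "('o, 'm, 'e) extri_data"
    and \<xi> :: "('o, 'm, 'e) triangle set"
    and \<X> :: "'o set"
  assumes "extriangulated_category \<C>"
    and "WIC \<C>"
    and "proper_class \<C> \<xi>"
    and "enough_projectives \<C> \<xi>"
    and "enough_injectives \<C> \<xi>"
    and "quasi_resolving \<C> \<xi> \<X>"
  shows "quasi_resolving \<C> \<xi> (GQP \<C> \<xi> \<X>)"
proof -
  interpret gorenstein_setting \<C> \<xi> \<X>
    using assms unfolding gorenstein_setting_def gorenstein_setting_axioms_def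
      projective_proper_class_def projective_proper_class_axioms_def quasi_resolving_def by blast
  show ?thesis
    unfolding quasi_resolving_def closed_under_extensions_def closed_under_cocones_def
    using GQP_additive GQP_extension GQP_cocone GQP_resolution by fast
qed

end
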